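(* Work over $\mathbb R$. The following is the list of (pairwise) non-isomorphic symplectic $\mathbb N$-graded filiform Lie algebras, together with their homogeneous symplectic forms, which are given up to a non-zero constant factor (for an algebra of dimension $2k$ the form $\omega_{2k+1}$ is homogeneous of weight $2k+1$): - $\mathfrak m_0(2k)$, $k\ge2$: $\ \omega_{2k+1}=e^1\wedge e^{2k}+\beta\sum_{i=2}^k(-1)^i e^i\wedge e^{2k-i+1}$, $\beta\in\mathbb R$, $\beta\neq0$; - $\mathcal V_6$ and $\mathcal V_{2k}$, $k\ge6$: $\ \omega_{2k+1}=(2k-1)e^1\wedge e^{2k}+(2k-3)e^2\wedge e^{2k-1}+\dots+e^k\wedge e^{k+1}$ (with $k=3$ for $\mathcal V_6$); - $\mathfrak g_{8,\alpha}$, $\alpha\in\mathbb R$, $\alpha\neq-\frac52,-2,-1,\frac12$: $\ \omega_9(\alpha)=e^1\wedge e^8+\frac{2\alpha^2+3\alpha-2}{2\alpha+5}e^2\wedge e^7+\frac{2\alpha+2}{2\alpha+5}e^3\wedge e^6+\frac3{2\alpha+5}e^4\wedge e^5$; - $\mathfrak g_{10,\alpha}$, $\alpha\in\mathbb R$, $\alpha\ne-\frac52,-\frac14,-1,-3,\alpha_1,\alpha_2$: $$\omega_{11}(\alpha)=e^1\wedge e^{10}+\tfrac{2\alpha^3+2\alpha^2+3}{2(\alpha^2+4\alpha+3)}e^2\wedge e^9+\tfrac{4\alpha^3+8\alpha^2-8\alpha-21}{2(\alpha^2+4\alpha+3)(2\alpha+5)}e^3\wedge e^8+\tfrac{3(2\alpha^2+4\alpha+5)}{2(\alpha^2+4\alpha+3)(2\alpha+5)}e^4\wedge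 e^7+\tfrac{3(4\alpha+1)}{2(\alpha^2+4\alpha+3)(2\alpha+5)}e^5\wedge e^6,$$ where $\alpha_1\approx-0.893$ and $\alpha_2\approx1.534$ are real roots of the polynomials $2\alpha^3+2\alpha+3$ and $4\alpha^3+8\alpha^2-8\alpha-21$ respectively.
   Context: An $\mathbb N$-graded filiform Lie algebra of dimension $n$ ($n\ge3$) is a Lie algebra $\mathfrak g=\bigoplus_{i=1}^n\mathfrak g_i$ with $[\mathfrak g_i,\mathfrak g_j]\subset\mathfrak g_{i+j}$ ($\mathfrak g_i=0$ for $i>n$), $\dim\mathfrak g_i=1$ for $1\le i\le n$, and $[\mathfrak g_1,\mathfrak g_i]=\mathfrak g_{i+1}$ for $i\ge2$. A symplectic form on a $2k$-dimensional Lie algebra $\mathfrak g$ is a non-degenerate $\omega\in\Lambda^2(\mathfrak g^* )$ with $d\omega=0$, where $d$ is the differential of the cochain complex of $\mathfrak g$ with trivial coefficients (dual to the Lie bracket on $\mathfrak g^*$ and extended as a derivation); $\mathfrak g$ is symplectic if it has one. For a basis $e_1,\dots,e_n$ with $e_i\in\mathfrak g_i$ and dual basis $e^1,\dots,e^n$, a $2$-form is homogeneous of weight $\lambda$ if it is a linear combination of $e^i\wedge e^j$ with $i+j=\lambda$. Algebras (basis $e_1,\dots,e_n$, unlisted brackets $[e_i,e_j]$, $i<j$, are zero): $\mathfrak m_0(n)$: $[e_1,e_i]=e_{i+1}$, $2\le i\le n-1$. $\mathcal V_n$: $[e_i,e_j]=(j-i)e_{i+j}$ for $i+j\le n$. $\mathfrak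 g_{8,\alpha}$ ($n=8$): relations (1), (2). $\mathfrak g_{10,\alpha}$ ($n=10$, $\alpha\ne-\frac52$): relations (1)–(4), where (1) $[e_1,e_i]=e_{i+1}$ ($i=2,\dots,6$), $[e_2,e_3]=(2+\alpha)e_5$, $[e_2,e_4]=(2+\alpha)e_6$, $[e_2,e_5]=(1+\alpha)e_7$, $[e_3,e_4]=e_7$; (2) $[e_1,e_7]=e_8$, $[e_2,e_6]=\alpha e_8$, $[e_3,e_5]=e_8$; (3) $[e_1,e_8]=e_9$, $[e_2,e_7]=\frac{2\alpha^2+3\alpha-2}{2\alpha+5}e_9$, $[e_3,e_6]=\frac{2\alpha+2}{2\alpha+5}e_9$, $[e_4,e_5]=\frac3{2\alpha+5}e_9$; (4) $[e_1,e_9]=e_{10}$, $[e_2,e_8]=\frac{2\alpha^2+\alpha-1}{2\alpha+5}e_{10}$, $[e_3,e_7]=\frac{2\alpha-1}{2\alpha+5}e_{10}$, $[e_4,e_6]=\frac3{2\alpha+5}e_{10}$.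
   Formalization: The polynomial defining α_1 is corrected from 2α^3+2α+3 to 2α^3+2α^2+3 (root ≈ -1.592, where ω_11 degenerates); for V_6 the homogeneous symplectic forms are, up to a factor, ω_7+γ(e^2∧e^5−3e^3∧e^4) with γ≠−3, 1/3, not only the displayed ω_7. *)

theory Defs
  imports "HOL-Analysis.Analysis" "HOL-Analysis.Finite_Function_Topology"
begin

section \<open>Real Lie algebras and symplectic forms\<close>

text \<open>A Lie algebra is given by a linear subspace \<open>L\<close> of a real vector space together with a
  bracket; only the values of the bracket on \<open>L\<close> matter.\<close>

definition bilinear_on ::
    "'a::real_vector set \<Rightarrow> ('a \<Rightarrow> 'a \<Rightarrow> 'b::real_vector) \<Rightarrow> bool" where
  "bilinear_on L f \<longleftrightarrow>
     (\<forall>x\<in>L. \<forall>y\<in>L. \<forall>z\<in>L. f (x + y) z = f x z + f y z \<and> f z (x + y) = f z x + f z y) \<and>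
     (\<forall>c. \<forall>x\<in>L. \<forall>y\<in>L. f (c *\<^sub>R x) y = c *\<^sub>R f x y \<and> f x (c *\<^sub>R y) = c *\<^sub>R f x y)"

definition lie_algebra :: "'a::real_vector set \<Rightarrow> ('a \<Rightarrow> 'a \<Rightarrow> 'a) \<Rightarrow> bool" where
  "lie_algebra L br \<longleftrightarrow>
     subspace L \<and> (\<forall>x\<in>L. \<forall>y\<in>L. br x y \<in> L) \<and> bilinear_on L br \<and> (\<forall>x\<in>L. br x x = 0) \<and>
     (\<forall>x\<in>L. \<forall>y\<in>L. \<forall>z\<in>L. br x (br y z) + br y (br z x) + br z (br x y) = 0)"

text \<open>The isomorphism \<open>f\<close> is a linear map on the whole ambient space; every linear map defined on
  a subspace extends to such a map.\<close>

definition lie_iso ::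
    "('a \<Rightarrow> 'b) \<Rightarrow> 'a::real_vector set \<Rightarrow> ('a \<Rightarrow> 'a \<Rightarrow> 'a) \<Rightarrow>
     'b::real_vector set \<Rightarrow> ('b \<Rightarrow> 'b \<Rightarrow> 'b) \<Rightarrow> bool" where
  "lie_iso f L br L' br' \<longleftrightarrow>
     linear f \<and> bij_betw f L L' \<and> (\<forall>x\<in>L. \<forall>y\<in>L. f (br x y) = br' (f x) (f y))"

text \<open>Elements of the second exterior power of the dual space are alternating bilinear forms.\<close>

definition two_form :: "'a::real_vector set \<Rightarrow> ('a \<Rightarrow> 'a \<Rightarrow> real) \<Rightarrow> bool" where
  "two_form L \<omega> \<longleftrightarrow> bilinear_on L \<omega> \<and> (\<forall>x\<in>L. \<omega> x x = 0)"

definition wedge :: "('a \<Rightarrow> real) \<Rightarrow> ('a \<Rightarrow> real) \<Rightarrow> 'a \<Rightarrow> 'a \<Rightarrow> real" where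
  "wedge f g x y = f x * g y - f y * g x"

text \<open>The differential on 2-forms (trivial coefficients). On 1-forms it is the dual of the bracket,
  \<open>(df)(x, y) = f [x, y]\<close>; the lemma below is the derivation rule
  \<open>d(f \<and> g) = df \<and> g - f \<and> dg\<close>, which determines it on 2-forms.\<close>

definition diff2 ::
    "('a \<Rightarrow> 'a \<Rightarrow> 'a) \<Rightarrow> ('a \<Rightarrow> 'a \<Rightarrow> real) \<Rightarrow> 'a \<Rightarrow> 'a \<Rightarrow> 'a \<Rightarrow> real" where
  "diff2 br \<omega> x y z = \<omega> (br x y) z + \<omega> (br y z) x + \<omega> (br z x) y"

lemma diff2_wedge:
  "diff2 br (wedge f g) x y z =
     (f (br x y) * g z + f (br y z) * g x + f (br z x) * g y) -
     (f x * g (br y z) + f y * g (br z x) + f z * g (br x y))"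
  by (simp add: diff2_def wedge_def)

text \<open>Even dimension is not required separately: it follows from non-degeneracy.\<close>

definition symplectic_form ::
    "'a::real_vector set \<Rightarrow> ('a \<Rightarrow> 'a \<Rightarrow> 'a) \<Rightarrow> ('a \<Rightarrow> 'a \<Rightarrow> real) \<Rightarrow> bool" where
  "symplectic_form L br \<omega> \<longleftrightarrow>
     two_form L \<omega> \<and>
     (\<forall>x\<in>L. (\<forall>y\<in>L. \<omega> x y = 0) \<longrightarrow> x = 0) \<and>
     (\<forall>x\<in>L. \<forall>y\<in>L. \<forall>z\<in>L. diff2 br \<omega> x y z = 0)"

definition symplectic :: "'a::real_vector set \<Rightarrow> ('a \<Rightarrow> 'a \<Rightarrow> 'a) \<Rightarrow> bool" where
  "symplectic L br \<longleftrightarrow> (\<exists>\<omega>. symplectic_form L br \<omega>)"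


section \<open>Graded filiform Lie algebras\<close>

text \<open>The components are indexed by all natural numbers, those outside \<open>{1..n}\<close> being zero.\<close>

definition graded_filiform ::
    "nat \<Rightarrow> 'a::real_vector set \<Rightarrow> ('a \<Rightarrow> 'a \<Rightarrow> 'a) \<Rightarrow> (nat \<Rightarrow> 'a set) \<Rightarrow> bool" where
  "graded_filiform n L br g \<longleftrightarrow>
     n \<ge> 3 \<and> lie_algebra L br \<and>
     (\<forall>i\<in>{1..n}. subspace (g i) \<and> g i \<subseteq> L \<and> dim (g i) = 1) \<and>
     (\<forall>i. i \<notin> {1..n} \<longrightarrow> g i = {0}) \<and>
     (\<forall>x\<in>L. \<exists>!c. (\<forall>i. c i \<in> g i) \<and> x = (\<Sum>i=1..n. c i)) \<and>
     (\<forall>i\<ge>1. \<forall>j\<ge>1. \<forall>x\<in>g i. \<forall>y\<in>g j. br x y \<in> g (i + j)) \<and>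
     (\<forall>i\<ge>2. span {br x y | x y. x \<in> g 1 \<and> y \<in> g i} = g (i + 1))"


section \<open>The algebras in the list\<close>

datatype alg = M0 nat | V nat | G8 real | G10 real

fun alg_dim :: "alg \<Rightarrow> nat" where
  "alg_dim (M0 n) = n"
| "alg_dim (V n) = n"
| "alg_dim (G8 \<alpha>) = 8"
| "alg_dim (G10 \<alpha>) = 10"

text \<open>An entry \<open>((i, j), c)\<close> stands for the relation \<open>[evec i, evec j] = c evec (i + j)\<close>.\<close>

type_synonym relations = "((nat \<times> nat) \<times> real) list"

definition rel1 :: "real \<Rightarrow> relations" where
  "rel1 \<alpha> =
     [((1,2), 1), ((1,3), 1), ((1,4), 1), ((1,5), 1), ((1,6), 1),
      ((2,3), 2 + \<alpha>), ((2,4), 2 + \<alpha>), ((2,5), 1 + \<alpha>), ((3,4), 1)]"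

definition rel2 :: "real \<Rightarrow> relations" where
  "rel2 \<alpha> = [((1,7), 1), ((2,6), \<alpha>), ((3,5), 1)]"

definition rel3 :: "real \<Rightarrow> relations" where
  "rel3 \<alpha> =
     [((1,8), 1), ((2,7), (2 * \<alpha>^2 + 3 * \<alpha> - 2) / (2 * \<alpha> + 5)),
      ((3,6), (2 * \<alpha> + 2) / (2 * \<alpha> + 5)), ((4,5), 3 / (2 * \<alpha> + 5))]"

definition rel4 :: "real \<Rightarrow> relations" where
  "rel4 \<alpha> =
     [((1,9), 1), ((2,8), (2 * \<alpha>^2 + \<alpha> - 1) / (2 * \<alpha> + 5)),
      ((3,7), (2 * \<alpha> - 1) / (2 * \<alpha> + 5)), ((4,6), 3 / (2 * \<alpha> + 5))]"

definition rel_coeff :: "relations \<Rightarrow> nat \<Rightarrow> nat \<Rightarrow> real" where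
  "rel_coeff r i j = (case map_of r (i, j) of Some c \<Rightarrow> c | None \<Rightarrow> 0)"

text \<open>The coefficient of \<open>evec (i + j)\<close> in \<open>[evec i, evec j]\<close>, used only for \<open>1 \<le> i < j\<close> with
  \<open>i + j\<close> at most the dimension.\<close>

fun struct_const :: "alg \<Rightarrow> nat \<Rightarrow> nat \<Rightarrow> real" where
  "struct_const (M0 n) i j = (if i = 1 then 1 else 0)"
| "struct_const (V n) i j = real j - real i"
| "struct_const (G8 \<alpha>) i j = rel_coeff (rel1 \<alpha> @ rel2 \<alpha>) i j"
| "struct_const (G10 \<alpha>) i j = rel_coeff (rel1 \<alpha> @ rel2 \<alpha> @ rel3 \<alpha> @ rel4 \<alpha>) i j"

text \<open>All algebras of the list are realised on coordinate subspaces of the space of finitely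
  supported real sequences. There \<open>lookup x i\<close> is the \<open>i\<close>-th coordinate, so that
  \<open>ee i j\<close> is the wedge product of the dual basis vectors of \<open>evec i\<close> and \<open>evec j\<close>.\<close>

type_synonym fsupp = "nat \<Rightarrow>\<^sub>0 real"
type_synonym form = "fsupp \<Rightarrow> fsupp \<Rightarrow> real"

definition evec :: "nat \<Rightarrow> fsupp" where
  "evec i = Poly_Mapping.single i 1"

definition ee :: "nat \<Rightarrow> nat \<Rightarrow> form" where
  "ee i j = wedge (\<lambda>x. Poly_Mapping.lookup x i) (\<lambda>x. Poly_Mapping.lookup x j)"

definition alg_space :: "alg \<Rightarrow> fsupp set" where
  "alg_space A = span (evec ` {1..alg_dim A})"

definition alg_grade :: "alg \<Rightarrow> nat \<Rightarrow> fsupp set" where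
  "alg_grade A i = (if i \<in> {1..alg_dim A} then span {evec i} else {0})"

definition alg_bracket :: "alg \<Rightarrow> fsupp \<Rightarrow> fsupp \<Rightarrow> fsupp" where
  "alg_bracket A x y =
     (\<Sum>(i, j) \<in> {(i, j). 1 \<le> i \<and> i < j \<and> i + j \<le> alg_dim A}.
        (struct_const A i j * ee i j x y) *\<^sub>R evec (i + j))"

lemma alg_bracket_basis:
  assumes "1 \<le> i" "i < j"
  shows "alg_bracket A (evec i) (evec j) =
    (if i + j \<le> alg_dim A then struct_const A i j *\<^sub>R evec (i + j) else 0)"
proof -
  let ?S = "{(i, j). 1 \<le> i \<and> i < j \<and> i + j \<le> alg_dim A}"
  have "?S \<subseteq> {..alg_dim A} \<times> {..alg_dim A}" by auto
  then have fin: "finite ?S" by (rule finite_subset) simp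
  have ee: "ee k l (evec i) (evec j) = (if (k, l) = (i, j) then 1 else 0)" if "k < l" for k l
    using that assms by (auto simp: ee_def wedge_def evec_def lookup_single when_def)
  have "alg_bracket A (evec i) (evec j) =
      (\<Sum>p\<in>?S. if p = (i, j) then struct_const A i j *\<^sub>R evec (i + j) else 0)"
    unfolding alg_bracket_def by (rule sum.cong) (auto simp: ee split: if_splits)
  then show ?thesis using fin assms by simp
qed

text \<open>The polynomials whose roots are excluded for \<open>G10\<close> (each has exactly one real root) are
  numerators of coefficients of the form given below.\<close>

definition symplectic_list :: "alg set" where
  "symplectic_list =
     {M0 (2 * k) | k. k \<ge> 2} \<union> {V 6} \<union> {V (2 * k) | k. k \<ge> 6} \<union>
     {G8 \<alpha> | \<alpha>. \<alpha> \<notin> {-5/2, -2, -1, 1/2}} \<union>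
     {G10 \<alpha> | \<alpha>. \<alpha> \<notin> {-5/2, -1/4, -1, -3} \<and>
        2 * \<alpha>^3 + 2 * \<alpha>^2 + 3 \<noteq> 0 \<and> 4 * \<alpha>^3 + 8 * \<alpha>^2 - 8 * \<alpha> - 21 \<noteq> 0}"


section \<open>Homogeneous forms\<close>

definition homogeneous :: "alg \<Rightarrow> nat \<Rightarrow> form \<Rightarrow> bool" where
  "homogeneous A w \<omega> \<longleftrightarrow>
     (\<exists>c. \<forall>x\<in>alg_space A. \<forall>y\<in>alg_space A.
        \<omega> x y = (\<Sum>(i, j) \<in> {(i, j). i \<in> {1..alg_dim A} \<and> j \<in> {1..alg_dim A} \<and> i + j = w}.
                   c i j * ee i j x y))"

definition homogeneous_symplectic :: "alg \<Rightarrow> form \<Rightarrow> bool" where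
  "homogeneous_symplectic A \<omega> \<longleftrightarrow>
     (\<exists>w. homogeneous A w \<omega>) \<and> symplectic_form (alg_space A) (alg_bracket A) \<omega>"

definition proportional :: "alg \<Rightarrow> form \<Rightarrow> form \<Rightarrow> bool" where
  "proportional A \<omega> \<omega>' \<longleftrightarrow>
     (\<exists>c. c \<noteq> 0 \<and> (\<forall>x\<in>alg_space A. \<forall>y\<in>alg_space A. \<omega> x y = c * \<omega>' x y))"

definition form_M0 :: "nat \<Rightarrow> real \<Rightarrow> form" where
  "form_M0 k \<beta> x y =
     ee 1 (2 * k) x y + \<beta> * (\<Sum>i=2..k. (-1) ^ i * ee i (2 * k - i + 1) x y)"

definition form_V :: "nat \<Rightarrow> form" where
  "form_V k x y = (\<Sum>i=1..k. (2 * real k + 1 - 2 * real i) * ee i (2 * k + 1 - i) x y)"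

definition form_G8 :: "real \<Rightarrow> form" where
  "form_G8 \<alpha> x y =
     ee 1 8 x y + (2 * \<alpha>^2 + 3 * \<alpha> - 2) / (2 * \<alpha> + 5) * ee 2 7 x y
     + (2 * \<alpha> + 2) / (2 * \<alpha> + 5) * ee 3 6 x y + 3 / (2 * \<alpha> + 5) * ee 4 5 x y"

definition form_G10 :: "real \<Rightarrow> form" where
  "form_G10 \<alpha> x y =
     ee 1 10 x y
     + (2 * \<alpha>^3 + 2 * \<alpha>^2 + 3) / (2 * (\<alpha>^2 + 4 * \<alpha> + 3)) * ee 2 9 x y
     + (4 * \<alpha>^3 + 8 * \<alpha>^2 - 8 * \<alpha> - 21) / (2 * (\<alpha>^2 + 4 * \<alpha> + 3) * (2 * \<alpha> + 5)) * ee 3 8 x y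
     + (3 * (2 * \<alpha>^2 + 4 * \<alpha> + 5)) / (2 * (\<alpha>^2 + 4 * \<alpha> + 3) * (2 * \<alpha> + 5)) * ee 4 7 x y
     + (3 * (4 * \<alpha> + 1)) / (2 * (\<alpha>^2 + 4 * \<alpha> + 3) * (2 * \<alpha> + 5)) * ee 5 6 x y"

text \<open>The forms listed for each algebra; the dimension of \<open>M0 n\<close> and \<open>V n\<close> is even here.\<close>

fun listed_forms :: "alg \<Rightarrow> form set" where
  "listed_forms (M0 n) = {form_M0 (n div 2) \<beta> | \<beta>. \<beta> \<noteq> 0}"
| "listed_forms (V n) = {form_V (n div 2)}"
| "listed_forms (G8 \<alpha>) = {form_G8 \<alpha>}"
| "listed_forms (G10 \<alpha>) = {form_G10 \<alpha>}"

text \<open>In dimension 6 the closed 2-forms of weight 7 on \<open>V 6\<close> form a plane, so the homogeneous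
  symplectic forms are a one-parameter family (up to scaling) containing \<open>form_V 3\<close> at
  \<open>\<gamma> = 0\<close>.\<close>

definition form_V6 :: "real \<Rightarrow> form" where
  "form_V6 \<gamma> x y = form_V 3 x y + \<gamma> * (ee 2 5 x y - 3 * ee 3 4 x y)"

end

theory Submission
  imports Defs
begin

text \<open>A homogeneous symplectic form of weight \<open>n + 1\<close> on a graded filiform algebra of dimension \<open>n\<close> is a
  further row of structure constants: closedness is the Jacobi identity in weight \<open>n + 1\<close> for the
  central extension by \<open>e\<^sub>n\<^sub>+\<^sub>1\<close>, and non-degeneracy says that no entry of this row vanishes. Normalising
  \<open>[e\<^sub>1, e\<^sub>i] = e\<^sub>i\<^sub>+\<^sub>1\<close>, the identities with \<open>e\<^sub>1\<close> leave one free parameter in each odd weight, and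
  the identity for \<open>e\<^sub>2, e\<^sub>3, e\<^sub>w\<^sub>-\<^sub>5\<close> is linear in the parameter of weight \<open>w\<close>. Hence the algebra and the
  form are governed by \<open>x = [e\<^sub>2, e\<^sub>3]\<close> and \<open>y = [e\<^sub>3, e\<^sub>4]\<close>. From dimension \<open>8\<close> on: if
  \<open>x = y = 0\<close>, non-degeneracy forces \<open>M0\<close>; if \<open>y = 0 \<noteq> x\<close>,
  all brackets \<open>[e\<^sub>3, e\<^sub>i]\<close> with \<open>i > 3\<close> vanish and the form degenerates; if \<open>y \<noteq> 0\<close>, scaling gives \<open>y = 1\<close> and the
  family \<open>x = 2 + \<alpha>\<close>, in which the identity of weight \<open>12\<close> leaves only \<open>\<alpha> = 8\<close>, the algebra \<open>V\<close>. An
  arbitrary symplectic form has no components of weight above \<open>n + 1\<close>, so its component of weight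
  \<open>n + 1\<close> is non-degenerate.\<close>

section \<open>Structure constant tables\<close>

text \<open>A nontrivial Jacobi identity in degrees at least 2 involves three distinct degrees, so
  its weight is at least 2 + 3 + 4 = 9. Hence \<open>x\<close> (weight 5) and \<open>y\<close>
  (weight 7) are unconstrained. In odd weight \<open>w \<ge> 9\<close>, with the brackets by e_1
  normalised, the coefficient of the free parameter is the sum of the structure constants of (2, 3),
  (3, w - 5) and (2, w - 5). For \<open>y = 1\<close> it is 2 \<alpha> + 5 in weight 9 and 4
  (\<alpha> + 1) (\<alpha> + 3) / (2 \<alpha> + 5) in weight 11. This is the origin of the
  denominators in the list, and at their zeros the identity has no solution. The obstacle is that
  the coefficient vanishes on \<open>M0\<close>. There the identity does not determine the
  parameter: the forms keep a free \<beta>, and \<open>x = y = 0\<close> alone does not kill the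
  higher brackets. Excluding those takes identities of several weights together with non-degeneracy.
  In weight 7 the identity for degrees 2, 3, 2 is empty, which is why \<open>V 6\<close> carries a
  one-parameter family of forms.\<close>

definition jac :: "(nat \<Rightarrow> nat \<Rightarrow> real) \<Rightarrow> nat \<Rightarrow> nat \<Rightarrow> nat \<Rightarrow> real" where
  "jac a i j k = a j k * a i (j + k) + a k i * a j (k + i) + a i j * a k (i + j)"

text \<open>\<open>jac a i j k\<close> is the coefficient of \<open>e (i + j + k)\<close> in the
  Jacobi sum for \<open>[e i, e j] = a i j e (i + j)\<close>. The bound \<open>N\<close> is the
  dimension for an algebra, and the dimension plus one for an algebra together with a form.
  Antisymmetry is asked of all indices, so that rewriting with it has no side conditions.\<close>

definition lie_table :: "nat \<Rightarrow> (nat \<Rightarrow> nat \<Rightarrow> real) \<Rightarrow> bool" where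
  "lie_table N a \<longleftrightarrow> (\<forall>i j. a j i = - a i j) \<and>
     (\<forall>i j k. 1 \<le> i \<and> 1 \<le> j \<and> 1 \<le> k \<and> i + j + k \<le> N \<longrightarrow> jac a i j k = 0)"

definition alt :: "(nat \<Rightarrow> nat \<Rightarrow> real) \<Rightarrow> nat \<Rightarrow> nat \<Rightarrow> real" where
  "alt c i j = (if i < j then c i j else if j < i then - c j i else 0)"

lemma alt_anti: "alt c j i = - alt c i j"
  by (simp add: alt_def)

lemma lie_table_anti: "lie_table N a \<Longrightarrow> a j i = - a i j"
  unfolding lie_table_def by blast

lemma lie_table_self: "lie_table N a \<Longrightarrow> a i i = 0"
  using lie_table_anti[of N a i i] by simp

lemma lie_table_jac:
  "lie_table N a \<Longrightarrow> 1 \<le> i \<Longrightarrow> 1 \<le> j \<Longrightarrow> 1 \<le> k \<Longrightarrow> i + j + k \<le> N \<Longrightarrow> jac a i j k = 0"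
  unfolding lie_table_def by blast

lemma lie_table_mono: "lie_table N a \<Longrightarrow> M \<le> N \<Longrightarrow> lie_table M a"
  unfolding lie_table_def by (meson le_trans)

lemma jac_swap:
  assumes "\<And>i j. a j i = - a i j"
  shows "jac a j i k = - jac a i j k" "jac a i k j = - jac a i j k"
proof -
  have "a i k = - a k i" "a k j = - a j k" "a j i = - a i j" by (rule assms)+
  then show "jac a j i k = - jac a i j k" "jac a i k j = - jac a i j k"
    by (simp_all add: jac_def add.commute)
qed

text \<open>\<open>jac\<close> changes sign under transpositions of its degrees, so increasing
  triples suffice.\<close>

lemma lie_tableI:
  assumes anti: "\<And>i j. a j i = - a i j"
    and J: "\<And>i j k. \<lbrakk>1 \<le> i; i < j; j < k; i + j + k \<le> N\<rbrakk> \<Longrightarrow> jac a i j k = 0"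
  shows "lie_table N a"
  unfolding lie_table_def
proof (intro conjI allI impI)
  fix i j show "a j i = - a i j" by (rule anti)
next
  fix i j k assume ijk: "1 \<le> i \<and> 1 \<le> j \<and> 1 \<le> k \<and> i + j + k \<le> N"
  note swap = jac_swap[of a, OF anti]
  consider "i = j" | "j = k" | "i = k" | "i < j" "j < k" | "i < k" "k < j" | "j < i" "i < k"
    | "j < k" "k < i" | "k < i" "i < j" | "k < j" "j < i"
    using less_linear[of i j] less_linear[of j k] less_linear[of i k] by metis
  then show "jac a i j k = 0"
  proof cases
    case 1
    have "jac a i i k = 0" using swap(1)[of i i k] by linarith
    with 1 show ?thesis by simp
  next
    case 2
    have "jac a i j j = 0" using swap(2)[of i j j] by linarith
    with 2 show ?thesis by simp
  next
    case 3
    have "jac a i j i = 0" using swap(1)[of i j i] swap(2)[of j i i] by linarith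
    with 3 show ?thesis by simp
  next
    case 4 then show ?thesis using J[of i j k] ijk by linarith
  next
    case 5 then show ?thesis using J[of i k j] swap(2)[of i j k] ijk by linarith
  next
    case 6 then show ?thesis using J[of j i k] swap(1)[of i j k] ijk by linarith
  next
    case 7 then show ?thesis using J[of j k i] swap(1)[of i j k] swap(2)[of j i k] ijk by linarith
  next
    case 8 then show ?thesis using J[of k i j] swap(2)[of i j k] swap(1)[of i k j] ijk by linarith
  next
    case 9 then show ?thesis
      using J[of k j i] swap(1)[of i j k] swap(2)[of j i k] swap(1)[of j k i] ijk by linarith
  qed
qed

section \<open>The recursion along e_1 and the uniqueness of rows\<close>

lemma table_rec:
  assumes "lie_table N a" "1 \<le> i" "1 \<le> j" "i + j < N"
  shows "a i j * a 1 (i + j) = a 1 j * a i (j + 1) + a 1 i * a (i + 1) j"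
proof -
  have "jac a 1 i j = 0" using lie_table_jac[of N a 1 i j] assms by simp
  moreover have "a j 1 = - a 1 j" "a j (1 + i) = - a (i + 1) j"
    using lie_table_anti[OF assms(1)] by (metis add.commute)+
  ultimately show ?thesis unfolding jac_def by simp
qed

lemma table_rec1:
  assumes "lie_table N a" "\<And>i. 2 \<le> i \<Longrightarrow> i < N \<Longrightarrow> a 1 i = 1" "2 \<le> i" "2 \<le> j" "i + j < N"
  shows "a (i + 1) j = a i j - a i (j + 1)"
proof -
  have "a 1 i = 1" "a 1 j = 1" "a 1 (i + j) = 1"
    using assms by auto
  moreover have "a i j * a 1 (i + j) = a 1 j * a i (j + 1) + a 1 i * a (i + 1) j"
    by (rule table_rec) (use assms in auto)
  ultimately show ?thesis by (simp only: mult_1 mult_1_right)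
qed

text \<open>In the basis \<open>s i e i\<close> bracketing with e_1 is a plain shift, and
  \<open>s i * s (w - i)\<close> is the change of basis up to the common factor \<open>s w\<close>.
  There the recursions for \<open>a\<close> and \<open>a'\<close>, which agree in lower weight, show
  that consecutive differences within row \<open>w\<close> add up to zero.\<close>

lemma weight_diff:
  assumes a: "lie_table N a" and a': "lie_table N a'" and w: "w \<le> N"
    and agree: "\<And>i j. \<lbrakk>1 \<le> i; 1 \<le> j; i + j < w\<rbrakk> \<Longrightarrow> a i j = a' i j"
    and first: "a 1 (w - 1) = a' 1 (w - 1)"
    and s: "\<And>i. \<lbrakk>2 \<le> i; i + 2 < w\<rbrakk> \<Longrightarrow> s (i + 1) = a 1 i * s i"
    and i: "2 \<le> i" "i + 2 \<le> w"
  shows "(a i (w - i) - a' i (w - i)) * (s i * s (w - i)) =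
    (- 1) ^ i * ((a 2 (w - 2) - a' 2 (w - 2)) * (s 2 * s (w - 2)))"
  using i
proof (induction i rule: nat_induct_at_least)
  case base
  then show ?case by simp
next
  case (Suc i)
  define j where "j = w - Suc i"
  have i: "2 \<le> i" "Suc i + 2 \<le> w" using Suc.hyps Suc.prems by auto
  have j: "2 \<le> j" "w - i = j + 1" "w - 1 = i + j" "i + j < N" "i + j < w" "i + 2 < w" "j + 2 < w"
    using i w unfolding j_def by linarith+
  have ra: "a i j * a 1 (i + j) = a 1 j * a i (j + 1) + a 1 i * a (i + 1) j"
    by (rule table_rec[OF a]) (use i j in linarith)+
  have ra': "a' i j * a' 1 (i + j) = a' 1 j * a' i (j + 1) + a' 1 i * a' (i + 1) j"
    by (rule table_rec[OF a']) (use i j in linarith)+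
  have "a i j = a' i j" "a 1 i = a' 1 i" "a 1 j = a' 1 j"
    by (rule agree; use i j in linarith)+
  moreover have "a 1 (i + j) = a' 1 (i + j)"
    using first unfolding j(3) .
  ultimately have d: "a 1 j * (a i (j + 1) - a' i (j + 1)) + a 1 i * (a (i + 1) j - a' (i + 1) j) = 0"
    using ra ra' by (simp add: algebra_simps)
  have si: "s (i + 1) = a 1 i * s i" "s (j + 1) = a 1 j * s j"
    by (rule s; use i j in linarith)+
  \<comment> \<open>The difference of the recursions times \<open>s i * s j\<close>; the factors
    \<open>a 1 i\<close> and \<open>a 1 j\<close> are absorbed into \<open>s (i + 1)\<close> and
    \<open>s (j + 1)\<close>.\<close>
  have "(a (i + 1) j - a' (i + 1) j) * (s (i + 1) * s j) + (a i (j + 1) - a' i (j + 1)) * (s i * s (j + 1))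
    = (a 1 j * (a i (j + 1) - a' i (j + 1)) + a 1 i * (a (i + 1) j - a' (i + 1) j)) * (s i * s j)"
    unfolding si by (simp add: algebra_simps)
  then have "(a (i + 1) j - a' (i + 1) j) * (s (i + 1) * s j) = - ((a i (w - i) - a' i (w - i)) * (s i * s (w - i)))"
    unfolding d j(2) by linarith
  also have "\<dots> = - ((- 1) ^ i * ((a 2 (w - 2) - a' 2 (w - 2)) * (s 2 * s (w - 2))))"
    using Suc.IH i by simp
  finally show ?case
    by (simp add: j_def)
qed

lemma weight_unique_aux:
  assumes a: "lie_table N a" and a': "lie_table N a'" and w: "w \<le> N"
    and agree: "\<And>i j. \<lbrakk>1 \<le> i; 1 \<le> j; i + j < w\<rbrakk> \<Longrightarrow> a i j = a' i j"
    and first: "a 1 (w - 1) = a' 1 (w - 1)"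
    and s: "\<And>i. \<lbrakk>2 \<le> i; i + 2 < w\<rbrakk> \<Longrightarrow> s (i + 1) = a 1 i * s i"
    and s0: "\<And>i. 2 \<le> i \<Longrightarrow> s i \<noteq> 0"
    and two: "(a 2 (w - 2) - a' 2 (w - 2)) * (s 2 * s (w - 2)) = 0"
    and ij: "1 \<le> i" "1 \<le> j" "i + j = w"
  shows "a i j = a' i j"
proof -
  consider "i = 1" | "j = 1" | "2 \<le> i" "2 \<le> j" using ij by linarith
  then show ?thesis
  proof cases
    case 1
    have "j = w - 1" using ij 1 by linarith
    then show ?thesis using first 1 by metis
  next
    case 2
    have "i = w - 1" using ij 2 by linarith
    then show ?thesis
      using first 2 lie_table_anti[OF a, of i j] lie_table_anti[OF a', of i j] by metis
  next
    case 3
    have "w - i = j" using ij by simp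
    then have "(a i j - a' i j) * (s i * s j) = 0"
      using weight_diff[where s = s, OF a a' w agree first s, of i] 3 ij unfolding two by simp
    then show ?thesis using s0[of i] s0[of j] 3 by simp
  qed
qed

text \<open>The middle entry \<open>a m m\<close> of an even row vanishes, and by
  \<open>weight_diff\<close> the other differences in the row are tied to the one in the
  middle.\<close>

lemma weight_unique_even:
  assumes a: "lie_table N a" and a': "lie_table N a'" and w: "w \<le> N" "even w" "4 \<le> w"
    and agree: "\<And>i j. \<lbrakk>1 \<le> i; 1 \<le> j; i + j < w\<rbrakk> \<Longrightarrow> a i j = a' i j"
    and first: "a 1 (w - 1) = a' 1 (w - 1)"
    and s: "\<And>i. \<lbrakk>2 \<le> i; i + 2 < w\<rbrakk> \<Longrightarrow> s (i + 1) = a 1 i * s i"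
    and s0: "\<And>i. 2 \<le> i \<Longrightarrow> s i \<noteq> 0"
    and ij: "1 \<le> i" "1 \<le> j" "i + j = w"
  shows "a i j = a' i j"
proof -
  obtain m where m: "w = 2 * m" using w(2) by blast
  have mw: "w - m = m" "2 \<le> m" "m + 2 \<le> w" using m w by auto
  have "(a m (w - m) - a' m (w - m)) * (s m * s (w - m)) = 0"
    unfolding mw(1) lie_table_self[OF a] lie_table_self[OF a'] by simp
  then have "(- 1) ^ m * ((a 2 (w - 2) - a' 2 (w - 2)) * (s 2 * s (w - 2))) = 0"
    using weight_diff[where s = s, OF a a' w(1) agree first s mw(2,3)] by metis
  then have "(a 2 (w - 2) - a' 2 (w - 2)) * (s 2 * s (w - 2)) = 0" by simp
  from weight_unique_aux[where s = s, OF a a' w(1) agree first s s0 this ij] show ?thesis .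
qed

text \<open>In odd weight the grading leaves one free parameter; the Jacobi identity for the basis
  vectors of degrees \<open>2\<close>, \<open>3\<close>, \<open>w - 5\<close> is linear in it.\<close>

lemma weight_unique_odd:
  assumes a: "lie_table N a" and a': "lie_table N a'" and w: "w \<le> N" "7 \<le> w"
    and agree: "\<And>i j. \<lbrakk>1 \<le> i; 1 \<le> j; i + j < w\<rbrakk> \<Longrightarrow> a i j = a' i j"
    and first: "a 1 (w - 1) = a' 1 (w - 1)"
    and s: "\<And>i. \<lbrakk>2 \<le> i; i + 2 < w\<rbrakk> \<Longrightarrow> s (i + 1) = a 1 i * s i"
    and s0: "\<And>i. 2 \<le> i \<Longrightarrow> s i \<noteq> 0"
    and co: "a' 2 3 / (s 5 * s (w - 5)) + a' 3 (w - 5) / (s 2 * s (w - 2))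
      + a' 2 (w - 5) / (s 3 * s (w - 3)) \<noteq> 0"
    and ij: "1 \<le> i" "1 \<le> j" "i + j = w"
  shows "a i j = a' i j"
proof -
  define D where "D = (a 2 (w - 2) - a' 2 (w - 2)) * (s 2 * s (w - 2))"
  define j where "j = w - 5"
  have j: "w - 5 = j" "w - 2 = j + 3" "w - 3 = j + 2" "2 \<le> j" "j + 5 \<le> N" "j + 5 = w"
    using w by (auto simp: j_def)
  note wd = weight_diff[where s = s, OF a a' w(1) agree first s]
  have s': "s 5 \<noteq> 0" "s 2 \<noteq> 0" "s 3 \<noteq> 0" "s j \<noteq> 0" "s (j + 2) \<noteq> 0" "s (j + 3) \<noteq> 0"
    using s0 j by auto
  have "(a 5 j - a' 5 j) * (s 5 * s j) = - D"
    using wd[of 5] j by (simp add: D_def)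
  then have 5: "a 5 j = a' 5 j - D / (s 5 * s j)" using s' by (simp add: field_simps)
  have "(a 3 (j + 2) - a' 3 (j + 2)) * (s 3 * s (j + 2)) = - D"
    using wd[of 3] j by (simp add: D_def)
  then have 3: "a 3 (j + 2) = a' 3 (j + 2) - D / (s 3 * s (j + 2))" using s' by (simp add: field_simps)
  have "(a 2 (j + 3) - a' 2 (j + 3)) * (s 2 * s (j + 3)) = D"
    using j by (simp add: D_def)
  then have 2: "a 2 (j + 3) = a' 2 (j + 3) + D / (s 2 * s (j + 3))" using s' by (simp add: field_simps)
  \<comment> \<open>Subtract the two identities for (2, 3, j). Only the factors of weight
    \<open>w\<close> differ, by \<open>D\<close> over products of \<open>s\<close>, with sign + at 2
    and - at 3 and 5. \<open>jac\<close> contributes a further minus at 3 and 5, so everything adds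
    up to \<open>D\<close> times the coefficient in \<open>co\<close>.\<close>
  have J: "jac a 2 3 j = 0" "jac a' 2 3 j = 0"
    using lie_table_jac[OF a, of 2 3 j] lie_table_jac[OF a', of 2 3 j] j by auto
  have anti: "a j 2 = - a 2 j" "a' j 2 = - a' 2 j" "a j 5 = - a 5 j" "a' j 5 = - a' 5 j"
    using lie_table_anti[OF a] lie_table_anti[OF a'] by metis+
  have eqs: "a 2 3 = a' 2 3" "a 3 j = a' 3 j" "a 2 j = a' 2 j"
    using agree j by auto
  have "a' 3 j * a 2 (j + 3) - a' 2 j * a 3 (j + 2) - a' 2 3 * a 5 j = 0"
    using J(1) anti eqs by (simp add: jac_def add.commute)
  moreover have "a' 3 j * a' 2 (j + 3) - a' 2 j * a' 3 (j + 2) - a' 2 3 * a' 5 j = 0"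
    using J(2) anti by (simp add: jac_def add.commute)
  ultimately have "D * (a' 2 3 / (s 5 * s j) + a' 3 j / (s 2 * s (j + 3))
      + a' 2 j / (s 3 * s (j + 2))) = 0"
    unfolding 2 3 5 by (simp add: algebra_simps)
  then have "D = 0" using co j by simp
  then show ?thesis
    using weight_unique_aux[where s = s, OF a a' w(1) agree first s s0 _ ij] D_def by simp
qed

text \<open>The table of the same bracket in the basis \<open>t i e i\<close>.\<close>

definition rescale :: "(nat \<Rightarrow> real) \<Rightarrow> (nat \<Rightarrow> nat \<Rightarrow> real) \<Rightarrow> nat \<Rightarrow> nat \<Rightarrow> real" where
  "rescale t a i j = t i * t j / t (i + j) * a i j"

lemma lie_table_rescale:
  assumes "lie_table N a" "\<And>i. 1 \<le> i \<Longrightarrow> t i \<noteq> 0"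
  shows "lie_table N (rescale t a)"
  unfolding lie_table_def
proof (intro conjI allI impI)
  fix i j
  show "rescale t a j i = - rescale t a i j"
    using lie_table_anti[OF assms(1), of j i] by (simp add: rescale_def add.commute)
next
  fix i j k assume ijk: "1 \<le> i \<and> 1 \<le> j \<and> 1 \<le> k \<and> i + j + k \<le> N"
  have t: "t (i + j) \<noteq> 0" "t (j + k) \<noteq> 0" "t (k + i) \<noteq> 0" "t (i + j + k) \<noteq> 0"
    using assms(2) ijk by auto
  have w: "i + (j + k) = i + j + k" "j + (k + i) = i + j + k" "k + (i + j) = i + j + k" by auto
  have "rescale t a j k * rescale t a i (j + k) = t i * t j * t k / t (i + j + k) * (a j k * a i (j + k))"
    "rescale t a k i * rescale t a j (k + i) = t i * t j * t k / t (i + j + k) * (a k i * a j (k + i))"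
    "rescale t a i j * rescale t a k (i + j) = t i * t j * t k / t (i + j + k) * (a i j * a k (i + j))"
    using t unfolding rescale_def w by simp_all
  then have "jac (rescale t a) i j k = t i * t j * t k / t (i + j + k) * jac a i j k"
    by (simp add: jac_def distrib_left)
  then show "jac (rescale t a) i j k = 0"
    using lie_table_jac[OF assms(1)] ijk by simp
qed

text \<open>Induction on the weight. Brackets with e_1 fix the first entry of a row, even rows are
  then forced, and in an odd row one entry, here \<open>a 2 (w - 2)\<close>, remains to be compared.
  The hypothesis \<open>odd\<close> may use agreement in all lower weights, so that Jacobi
  identities of weight \<open>w\<close> can be compared.\<close>

lemma table_agree:
  assumes a: "lie_table N a" and a': "lie_table N a'"
    and b: "\<And>i. 2 \<le> i \<Longrightarrow> i < N \<Longrightarrow> a 1 i = a' 1 i"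
    and s: "\<And>i. \<lbrakk>2 \<le> i; i + 2 < N\<rbrakk> \<Longrightarrow> s (i + 1) = a 1 i * s i"
    and s0: "\<And>i. 2 \<le> i \<Longrightarrow> s i \<noteq> 0"
    and odd: "\<And>w. \<lbrakk>odd w; 5 \<le> w; w \<le> N; \<And>i j. \<lbrakk>1 \<le> i; 1 \<le> j; i + j < w\<rbrakk> \<Longrightarrow> a i j = a' i j\<rbrakk>
      \<Longrightarrow> a 2 (w - 2) = a' 2 (w - 2)"
  shows "\<lbrakk>1 \<le> i; 1 \<le> j; i + j \<le> N\<rbrakk> \<Longrightarrow> a i j = a' i j"
proof (induction "i + j" arbitrary: i j rule: less_induct)
  case less
  define w where "w = i + j"
  have agree: "a k l = a' k l" if "1 \<le> k" "1 \<le> l" "k + l < w" for k l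
    by (rule less.hyps) (use that less.prems(3) in \<open>simp_all add: w_def\<close>)
  have w: "w \<le> N" and ijw: "i + j = w" using less.prems w_def by simp_all
  consider "i = j" | "i = 1" "2 \<le> j" | "j = 1" "2 \<le> i" | "2 \<le> i" "2 \<le> j" "5 \<le> w"
    using less.prems unfolding w_def by linarith
  then show ?case
  proof cases
    case 1
    then show ?thesis using lie_table_self[OF a] lie_table_self[OF a'] by simp
  next
    case 2
    then show ?thesis using b[of j] less.prems by simp
  next
    case 3
    then have "a j i = a' j i" using b[of i] less.prems by simp
    then show ?thesis using lie_table_anti[OF a, of i j] lie_table_anti[OF a', of i j] by linarith
  next
    case 4
    have first: "a 1 (w - 1) = a' 1 (w - 1)"
      by (rule b) (use 4 w in linarith)+
    have s': "s (i + 1) = a 1 i * s i" if "2 \<le> i" "i + 2 < w" for i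
      using s that w by simp
    show ?thesis
    proof (cases "even w")
      case True
      have w4: "4 \<le> w" using 4 by linarith
      show ?thesis
        by (rule weight_unique_even[where N = N and w = w and s = s]; fact)
    next
      case False
      have "a 2 (w - 2) = a' 2 (w - 2)"
        by (rule odd; fact)
      then have two: "(a 2 (w - 2) - a' 2 (w - 2)) * (s 2 * s (w - 2)) = 0" by simp
      show ?thesis
        by (rule weight_unique_aux[where N = N and w = w and s = s]; fact)
    qed
  qed
qed

text \<open>From weight 9 on \<open>weight_unique_odd\<close> applies. In weight 7, where
  \<open>w - 5 = 2\<close>, its coefficient is identically zero, so the parameters of weights 5 and
  7 have to agree by hypothesis.\<close>

lemma table_agree_low:
  assumes a: "lie_table N a" and a': "lie_table N a'"
    and b: "\<And>i. 2 \<le> i \<Longrightarrow> i < N \<Longrightarrow> a 1 i = a' 1 i"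
    and s: "\<And>i. \<lbrakk>2 \<le> i; i + 2 < N\<rbrakk> \<Longrightarrow> s (i + 1) = a 1 i * s i"
    and s0: "\<And>i. 2 \<le> i \<Longrightarrow> s i \<noteq> 0"
    and x2: "a 2 3 = a' 2 3" and x3: "a 3 4 = a' 3 4"
    and co: "\<And>w. \<lbrakk>odd w; 9 \<le> w; w \<le> N\<rbrakk> \<Longrightarrow>
      a' 2 3 / (s 5 * s (w - 5)) + a' 3 (w - 5) / (s 2 * s (w - 2)) + a' 2 (w - 5) / (s 3 * s (w - 3)) \<noteq> 0"
    and ij: "1 \<le> i" "1 \<le> j" "i + j \<le> N"
  shows "a i j = a' i j"
proof (rule table_agree[where N = N and s = s, OF a a'])
  fix w assume w: "odd w" "5 \<le> w" "w \<le> N"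
    and agree: "\<And>i j. \<lbrakk>1 \<le> i; 1 \<le> j; i + j < w\<rbrakk> \<Longrightarrow> a i j = a' i j"
  consider "w = 5" | "w = 7" | "9 \<le> w"
  proof -
    have "w \<noteq> 6" "w \<noteq> 8" using w(1) by auto
    then show ?thesis using w(2) that by linarith
  qed
  then show "a 2 (w - 2) = a' 2 (w - 2)"
  proof cases
    case 1
    then show ?thesis using x2 by simp
  next
    case 2
    have N: "7 \<le> N" using w 2 by simp
    \<comment> \<open>The recursion turns agreement of \<open>a 3 4\<close> into agreement of
      \<open>a 2 5\<close>, the entry of weight 7 that \<open>table_agree\<close> asks for.\<close>
    have e: "a 2 4 * a 1 6 = a 1 4 * a 2 5 + a 1 2 * a 3 4"
      using table_rec[OF a, of 2 4] N by simp
    have e': "a' 2 4 * a' 1 6 = a' 1 4 * a' 2 5 + a' 1 2 * a' 3 4"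
      using table_rec[OF a', of 2 4] N by simp
    have q: "a 2 4 = a' 2 4" by (rule agree) (use 2 in auto)
    have q': "a 1 4 = a' 1 4" "a 1 2 = a' 1 2" "a 1 6 = a' 1 6"
      by (rule b; use N in simp)+
    have "a' 1 4 * a 2 5 = a' 1 4 * a' 2 5"
      using e e' unfolding q q' x3 by linarith
    moreover have "a 1 4 \<noteq> 0" using s[of 4] s0[of 5] N by auto
    ultimately have "a 2 5 = a' 2 5" unfolding q' by simp
    then show ?thesis using 2 by simp
  next
    case 3
    show ?thesis
    proof (rule weight_unique_odd[where N = N and w = w and s = s])
      show "a 1 (w - 1) = a' 1 (w - 1)" by (rule b) (use 3 w in linarith)+
      show "s (i + 1) = a 1 i * s i" if "2 \<le> i" "i + 2 < w" for i
        using s that w by simp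
      show "a' 2 3 / (s 5 * s (w - 5)) + a' 3 (w - 5) / (s 2 * s (w - 2))
        + a' 2 (w - 5) / (s 3 * s (w - 3)) \<noteq> 0"
        by (rule co; fact)
    qed (fact | use 3 in simp)+
  qed
qed (fact a a' b s s0 ij)+

section \<open>Tables with y = 0\<close>

definition table_m2 :: "real \<Rightarrow> nat \<Rightarrow> nat \<Rightarrow> real" where
  "table_m2 c = alt (\<lambda>i j. if i = 1 then 1 else if i = 2 then c else 0)"

text \<open>e_1 and e_2 act on the abelian ideal spanned by e_3, e_4, ... by commuting shifts, the
  second with factor \<open>c\<close>, and \<open>[e1, e2] = e3\<close> acts on it as zero. For
  \<open>c = 0\<close> this is m_0, for \<open>c = 1\<close> the algebra known as m_2.\<close>

lemma lie_table_m2: "lie_table N (table_m2 c)"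
proof (rule lie_tableI)
  show "table_m2 c j i = - table_m2 c i j" for i j
    unfolding table_m2_def by (rule alt_anti)
next
  fix i j k :: nat assume "1 \<le> i" "i < j" "j < k"
  then show "jac (table_m2 c) i j k = 0"
    by (auto simp: jac_def table_m2_def alt_def)
qed

text \<open>If \<open>w\<close> were the lowest weight of a nonzero bracket without \<open>e\<^sub>1\<close>, the Jacobi identities of weight
  \<open>w + 2\<close> and \<open>w + 3\<close> would give \<open>a 2 w = 0\<close> and \<open>a 2 (w + 1) = 0\<close>; this contradicts the non-degeneracy
  assumption if \<open>w + 2 = N\<close> and the recursion in the weights \<open>w, \<dots>, w + 3\<close> otherwise.\<close>

lemma minimal_weight_zero:
  assumes a: "lie_table N a" and b: "\<And>i. 2 \<le> i \<Longrightarrow> i < N \<Longrightarrow> a 1 i = 1"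
    and N: "odd N" and nz: "a 2 (N - 2) \<noteq> 0"
    and w: "odd w" "9 \<le> w" "w + 2 \<le> N"
    and low: "\<And>i j. \<lbrakk>2 \<le> i; 2 \<le> j; i + j < w\<rbrakk> \<Longrightarrow> a i j = 0"
  shows "a 2 (w - 2) = 0"
proof (rule ccontr)
  define t where "t = a 2 (w - 2)"
  assume "a 2 (w - 2) \<noteq> 0"
  then have t: "t \<noteq> 0" unfolding t_def .
  obtain r where r: "w = 2 * r + 1" using w(1) oddE by blast
  have r4: "4 \<le> r" using r w by linarith
  have rec: "a (i + 1) j = a i j - a i (j + 1)" if "2 \<le> i" "2 \<le> j" "i + j < N" for i j
    by (rule table_rec1[OF a]) (use b that in auto)
  have lev0: "a i (w - i) = (- 1) ^ i * t" if "2 \<le> i" "i + 2 \<le> w" for i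
    using that
  proof (induction i rule: nat_induct_at_least)
    case base
    show ?case by (simp add: t_def)
  next
    case (Suc i)
    have "a (i + 1) (w - Suc i) = a i (w - Suc i) - a i (w - Suc i + 1)"
      by (rule rec) (use Suc w in auto)
    moreover have "a i (w - Suc i) = 0" by (rule low) (use Suc in auto)
    moreover have "w - Suc i + 1 = w - i" using Suc by simp
    ultimately show ?case using Suc by simp
  qed
  have ar: "a r (r + 1) \<noteq> 0" using lev0[of r] t r r4 by simp
  \<comment> \<open>Degrees 2, r, r + 1 have total weight \<open>w + 2\<close>; two of the three
    products contain a bracket of weight below \<open>w\<close>. The same happens below for 2, r, r
    + 2.\<close>
  have "jac a 2 r (r + 1) = 0" by (rule lie_table_jac[OF a]) (use r r4 w in auto)
  moreover have "a (r + 1) 2 = 0" "a 2 r = 0" by (rule low; use r r4 in simp)+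
  ultimately have z1: "a 2 w = 0" using ar by (simp add: jac_def r mult_2)
  then have "w + 2 \<noteq> N" using nz by auto
  then have w4: "w + 4 \<le> N" using N w by presburger
  have "a (r + 1) (r + 1) = a r (r + 1) - a r (r + 1 + 1)"
    by (rule rec) (use r r4 w4 in auto)
  then have ar2: "a r (r + 2) \<noteq> 0" using ar lie_table_self[OF a] by simp
  have "jac a 2 r (r + 2) = 0" by (rule lie_table_jac[OF a]) (use r r4 w4 in auto)
  moreover have "a (r + 2) 2 = 0" "a 2 r = 0" by (rule low; use r r4 in simp)+
  ultimately have z2: "a 2 (w + 1) = 0" using ar2 by (simp add: jac_def r mult_2)
  \<comment> \<open>The rows \<open>w + 1\<close>, \<open>w + 2\<close>, \<open>w + 3\<close> are
    now obtained by summing the preceding row. Up to sign they are polynomials in \<open>i\<close>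
    of degree 1, 2, 3, with initial values \<open>u\<close>, 0, 0 at \<open>i = 2\<close>.\<close>
  define u where "u = a 2 (w - 1)"
  have lev1: "a i (w + 1 - i) = (- 1) ^ i * (u - t * (real i - 2))" if "2 \<le> i" "i + 2 \<le> w + 1" for i
    using that
  proof (induction i rule: nat_induct_at_least)
    case base
    show ?case by (simp add: u_def)
  next
    case (Suc i)
    have "a (i + 1) (w - i) = a i (w - i) - a i (w - i + 1)"
      by (rule rec) (use Suc w in auto)
    moreover have "w - i + 1 = w + 1 - i" using Suc by simp
    ultimately show ?case using Suc lev0[of i] by (simp add: algebra_simps)
  qed
  \<comment> \<open>The middle entry of row \<open>w + 1 = 2 r + 2\<close> is zero.\<close>
  have u: "u = t * (real r - 1)"
    using lev1[of "r + 1"] lie_table_self[OF a, of "r + 1"] r r4 by simp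
  have lev2: "a i (w + 2 - i) = (- 1) ^ i * (t * (real i - 2) * (real i - 3) / 2 - (real i - 2) * u)"
    if "2 \<le> i" "i + 2 \<le> w + 2" for i
    using that
  proof (induction i rule: nat_induct_at_least)
    case base
    show ?case using z1 by simp
  next
    case (Suc i)
    have "a (i + 1) (w + 1 - i) = a i (w + 1 - i) - a i (w + 1 - i + 1)"
      by (rule rec) (use Suc w in auto)
    moreover have "w + 1 - i + 1 = w + 2 - i" using Suc by simp
    ultimately show ?case using Suc lev1[of i] by (simp add: field_simps)
  qed
  have lev3: "a i (w + 3 - i) = (- 1) ^ i *
      (u * (real i - 2) * (real i - 3) / 2 - t * (real i - 2) * (real i - 3) * (real i - 4) / 6)"
    if "2 \<le> i" "i + 2 \<le> w + 3" for i
    using that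
  proof (induction i rule: nat_induct_at_least)
    case base
    show ?case using z2 by simp
  next
    case (Suc i)
    have "a (i + 1) (w + 2 - i) = a i (w + 2 - i) - a i (w + 2 - i + 1)"
      by (rule rec) (use Suc w4 in auto)
    moreover have "w + 2 - i + 1 = w + 3 - i" using Suc by simp
    ultimately show ?case using Suc lev2[of i] by (simp add: field_simps)
  qed
  \<comment> \<open>Likewise the middle entry of row \<open>w + 3 = 2 r + 4\<close>. With the value
    of \<open>u\<close> it equals \<open>t r (r - 1) (2 r - 1) / 6\<close> up to sign.\<close>
  have E: "u * real r * (real r - 1) / 2 - t * real r * (real r - 1) * (real r - 2) / 6 = 0"
    using lev3[of "r + 2"] lie_table_self[OF a, of "r + 2"] r r4 by simp
  have "t * (real r * (real r - 1) * (2 * real r - 1)) =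
    6 * (u * real r * (real r - 1) / 2 - t * real r * (real r - 1) * (real r - 2) / 6)"
    unfolding u by (simp add: field_simps)
  then have "t * (real r * (real r - 1) * (2 * real r - 1)) = 0"
    unfolding E by simp
  then show False using t r4 by simp
qed

text \<open>The guards in \<open>x2\<close> and \<open>x3\<close> leave out the sizes in which the
  entry has weight \<open>N\<close>: there it belongs to the form and may be non-zero. For an odd
  weight \<open>w\<close> below the odd \<open>N\<close>, parity gives \<open>w + 2 \<le> N\<close>,
  the room that \<open>minimal_weight_zero\<close> needs.\<close>

lemma table_M0:
  assumes a: "lie_table N a" and b: "\<And>i. 2 \<le> i \<Longrightarrow> i < N \<Longrightarrow> a 1 i = 1"
    and N: "odd N" and nz: "a 2 (N - 2) \<noteq> 0"
    and x2: "5 < N \<Longrightarrow> a 2 3 = 0" and x3: "7 < N \<Longrightarrow> a 3 4 = 0"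
    and ij: "2 \<le> i" "2 \<le> j" "i + j < N"
  shows "a i j = 0"
proof -
  have m2: "table_m2 0 k l = 0" if "2 \<le> k" "2 \<le> l" for k l
    using that by (auto simp: table_m2_def alt_def)
  have "a i j = table_m2 0 i j"
  proof (rule table_agree[where N = "N - 1" and s = "\<lambda>i. 1"])
    show "lie_table (N - 1) a" using a by (rule lie_table_mono) simp
    show "lie_table (N - 1) (table_m2 0)" by (rule lie_table_m2)
    show "a 1 i = table_m2 0 1 i" if "2 \<le> i" "i < N - 1" for i
      using b[of i] that by (simp add: table_m2_def alt_def)
    show "(1::real) = a 1 i * 1" if "2 \<le> i" "i + 2 < N - 1" for i
      using b[of i] that by simp
    show "a 2 (w - 2) = table_m2 0 2 (w - 2)"
      if w: "odd w" "5 \<le> w" "w \<le> N - 1"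
      and agree: "\<And>i j. \<lbrakk>1 \<le> i; 1 \<le> j; i + j < w\<rbrakk> \<Longrightarrow> a i j = table_m2 0 i j" for w
    proof -
      have N': "w + 2 \<le> N" using N w by presburger
      consider "w = 5" | "w = 7" | "9 \<le> w"
      proof -
        have "w \<noteq> 6" "w \<noteq> 8" using w(1) by auto
        then show ?thesis using w(2) that by linarith
      qed
      then have "a 2 (w - 2) = 0"
      proof cases
        case 1
        then show ?thesis using x2 N' by simp
      next
        case 2
        have "a (2 + 1) 4 = a 2 4 - a 2 (4 + 1)"
          by (rule table_rec1[OF a b]) (use 2 N' in auto)
        moreover have "a 2 4 = 0" using agree[of 2 4] m2[of 2 4] 2 by simp
        ultimately show ?thesis using x3 N' 2 by simp
      next
        case 3
        show ?thesis
        proof (rule minimal_weight_zero[OF a b N nz w(1) 3 N'])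
          show "a i j = 0" if "2 \<le> i" "2 \<le> j" "i + j < w" for i j
            using agree[of i j] m2[of i j] that by simp
        qed
      qed
      then show ?thesis using m2[of 2 "w - 2"] w by simp
    qed
  qed (use ij in auto)
  then show ?thesis using m2 ij by simp
qed

text \<open>With \<open>y = 0\<close> the coefficient of the free parameter is \<open>2 x\<close> in
  every odd weight from 9 on, so the table is that of \<open>table_m2\<close>, where e_3 commutes
  with all later vectors.\<close>

lemma table_m2_degenerate:
  assumes a: "lie_table N a" and b: "\<And>i. 2 \<le> i \<Longrightarrow> i < N \<Longrightarrow> a 1 i = 1"
    and x: "a 3 4 = 0" "a 2 3 \<noteq> 0" and N: "8 \<le> N"
  shows "a 3 (N - 3) = 0"
proof -
  have "a 3 (N - 3) = table_m2 (a 2 3) 3 (N - 3)"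
  proof (rule table_agree_low[where N = N and s = "\<lambda>i. 1", OF a lie_table_m2])
    fix w :: nat assume "odd w" "9 \<le> w" "w \<le> N"
    then show "table_m2 (a 2 3) 2 3 / (1 * 1) + table_m2 (a 2 3) 3 (w - 5) / (1 * 1) +
      table_m2 (a 2 3) 2 (w - 5) / (1 * 1) \<noteq> 0"
      using x by (simp add: table_m2_def alt_def)
  qed (use N b x in \<open>auto simp: table_m2_def alt_def\<close>)
  then show ?thesis using N by (auto simp: table_m2_def alt_def)
qed

section \<open>The tables of V and of the family in \<alpha>\<close>

definition table_V :: "nat \<Rightarrow> nat \<Rightarrow> real" where
  "table_V i j = real j - real i"

text \<open>This is the bracket of the vector fields x^(i+1) d/dx.\<close>

lemma lie_table_V: "lie_table N table_V"
  unfolding lie_table_def jac_def table_V_def by (simp add: algebra_simps)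

text \<open>The coefficients of the symplectic form on \<open>G10 \<alpha>\<close>, read as structure constants of weight \<open>11\<close>;
  likewise \<open>rel3 \<alpha>\<close> contains those of the form on \<open>G8 \<alpha>\<close>.\<close>

definition rel5 :: "real \<Rightarrow> relations" where
  "rel5 \<alpha> =
     [((1,10), 1),
      ((2,9), (2 * \<alpha>^3 + 2 * \<alpha>^2 + 3) / (2 * (\<alpha>^2 + 4 * \<alpha> + 3))),
      ((3,8), (4 * \<alpha>^3 + 8 * \<alpha>^2 - 8 * \<alpha> - 21) / (2 * (\<alpha>^2 + 4 * \<alpha> + 3) * (2 * \<alpha> + 5))),
      ((4,7), (3 * (2 * \<alpha>^2 + 4 * \<alpha> + 5)) / (2 * (\<alpha>^2 + 4 * \<alpha> + 3) * (2 * \<alpha> + 5))),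
      ((5,6), (3 * (4 * \<alpha> + 1)) / (2 * (\<alpha>^2 + 4 * \<alpha> + 3) * (2 * \<alpha> + 5)))]"

text \<open>One table serves \<open>G8\<close> and \<open>G10\<close>: row 9 is at once the form on
  \<open>G8\<close> and part of the bracket of \<open>G10\<close>, and row 11 is the form on
  \<open>G10\<close>.\<close>

definition table_G :: "real \<Rightarrow> nat \<Rightarrow> nat \<Rightarrow> real" where
  "table_G \<alpha> = alt (rel_coeff (rel1 \<alpha> @ rel2 \<alpha> @ rel3 \<alpha> @ rel4 \<alpha> @ rel5 \<alpha>))"

lemma table_G_anti: "table_G \<alpha> j i = - table_G \<alpha> i j"
  unfolding table_G_def by (rule alt_anti)

lemma table_G_flip: "j < i \<Longrightarrow> table_G \<alpha> i j = - table_G \<alpha> j i"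
  by (rule table_G_anti)

lemma table_G_self: "table_G \<alpha> i i = 0"
  by (simp add: table_G_def alt_def)

lemma table_G_values:
  "table_G \<alpha> (Suc 0) 2 = 1" "table_G \<alpha> (Suc 0) 3 = 1" "table_G \<alpha> (Suc 0) 4 = 1"
  "table_G \<alpha> (Suc 0) 5 = 1" "table_G \<alpha> (Suc 0) 6 = 1" "table_G \<alpha> (Suc 0) 7 = 1"
  "table_G \<alpha> (Suc 0) 8 = 1" "table_G \<alpha> (Suc 0) 9 = 1" "table_G \<alpha> (Suc 0) 10 = 1"
  "table_G \<alpha> 2 3 = 2 + \<alpha>" "table_G \<alpha> 2 4 = 2 + \<alpha>" "table_G \<alpha> 2 5 = 1 + \<alpha>"
  "table_G \<alpha> 2 6 = \<alpha>" "table_G \<alpha> 3 4 = 1" "table_G \<alpha> 3 5 = 1"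
  "table_G \<alpha> 2 7 = (2 * \<alpha>^2 + 3 * \<alpha> - 2) / (2 * \<alpha> + 5)"
  "table_G \<alpha> 3 6 = (2 * \<alpha> + 2) / (2 * \<alpha> + 5)" "table_G \<alpha> 4 5 = 3 / (2 * \<alpha> + 5)"
  "table_G \<alpha> 2 8 = (2 * \<alpha>^2 + \<alpha> - 1) / (2 * \<alpha> + 5)"
  "table_G \<alpha> 3 7 = (2 * \<alpha> - 1) / (2 * \<alpha> + 5)" "table_G \<alpha> 4 6 = 3 / (2 * \<alpha> + 5)"
  "table_G \<alpha> 2 9 = (2 * \<alpha>^3 + 2 * \<alpha>^2 + 3) / (2 * (\<alpha>^2 + 4 * \<alpha> + 3))"
  "table_G \<alpha> 3 8 = (4 * \<alpha>^3 + 8 * \<alpha>^2 - 8 * \<alpha> - 21) / (2 * (\<alpha>^2 + 4 * \<alpha> + 3) * (2 * \<alpha> + 5))"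
  "table_G \<alpha> 4 7 = (3 * (2 * \<alpha>^2 + 4 * \<alpha> + 5)) / (2 * (\<alpha>^2 + 4 * \<alpha> + 3) * (2 * \<alpha> + 5))"
  "table_G \<alpha> 5 6 = (3 * (4 * \<alpha> + 1)) / (2 * (\<alpha>^2 + 4 * \<alpha> + 3) * (2 * \<alpha> + 5))"
  by (simp_all add: table_G_def alt_def rel_coeff_def rel1_def rel2_def rel3_def rel4_def rel5_def)

lemma triples_weight_le_11:
  assumes "1 \<le> i" "i < j" "j < k" "i + j + k \<le> (11::nat)"
  shows "i = 1 \<and> (j = 2 \<and> k \<in> {3,4,5,6,7,8} \<or> j = 3 \<and> k \<in> {4,5,6,7} \<or> j = 4 \<and> k \<in> {5,6}) \<or>
    i = 2 \<and> (j = 3 \<and> k \<in> {4,5,6} \<or> j = 4 \<and> k = 5)"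
proof -
  have i: "i = 1 \<or> i = 2" using assms by linarith
  show ?thesis
  proof (rule disjE[OF i])
    assume i: "i = 1"
    have "j = 2 \<or> j = 3 \<or> j = 4" using assms i by linarith
    then show ?thesis
    proof (elim disjE)
      assume j: "j = 2"
      have "k \<in> {3,4,5,6,7,8}" using assms i j by auto
      then show ?thesis using i j by blast
    next
      assume j: "j = 3"
      have "k \<in> {4,5,6,7}" using assms i j by auto
      then show ?thesis using i j by blast
    next
      assume j: "j = 4"
      have "k \<in> {5,6}" using assms i j by auto
      then show ?thesis using i j by blast
    qed
  next
    assume i: "i = 2"
    have "j = 3 \<or> j = 4" using assms i by linarith
    then show ?thesis
    proof (elim disjE)
      assume j: "j = 3"
      have "k \<in> {4,5,6}" using assms i j by auto
      then show ?thesis using i j by blast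
    next
      assume j: "j = 4"
      have "k = 5" using assms i j by auto
      then show ?thesis using i j by blast
    qed
  qed
qed

lemma table_G_first:
  assumes "2 \<le> j" "j \<le> 10"
  shows "table_G \<alpha> (Suc 0) j = 1"
proof -
  have "j \<in> {2,3,4,5,6,7,8,9,10}" using assms by auto
  then show ?thesis by (auto simp: table_G_values)
qed

lemma lie_table_G:
  assumes "2 * \<alpha> + 5 \<noteq> 0" and "N \<le> 10 \<or> N = 11 \<and> \<alpha>^2 + 4 * \<alpha> + 3 \<noteq> 0"
  shows "lie_table N (table_G \<alpha>)"
proof (rule lie_tableI)
  show "table_G \<alpha> j i = - table_G \<alpha> i j" for i j
    by (rule table_G_anti)
next
  fix i j k :: nat assume ijk: "1 \<le> i" "i < j" "j < k" "i + j + k \<le> N"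
  have three: "Suc (Suc (Suc 0)) = 3" by simp
  note tg = table_G_values table_G_flip table_G_self jac_def three
  \<comment> \<open>The two denominators are named so that they are cleared as atoms; the polynomial
    identities that remain are checked after unfolding them.\<close>
  define b where "b = 2 * \<alpha> + 5"
  define c where "c = \<alpha>^2 + 4 * \<alpha> + 3"
  have b: "b \<noteq> 0" using assms(1) by (simp add: b_def)
  have low: "jac (table_G \<alpha>) 2 3 4 = 0" "jac (table_G \<alpha>) 2 3 5 = 0"
    "jac (table_G \<alpha>) 1 2 3 = 0" "jac (table_G \<alpha>) 1 2 4 = 0" "jac (table_G \<alpha>) 1 2 5 = 0"
    "jac (table_G \<alpha>) 1 2 6 = 0" "jac (table_G \<alpha>) 1 2 7 = 0" "jac (table_G \<alpha>) 1 3 4 = 0"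
    "jac (table_G \<alpha>) 1 3 5 = 0" "jac (table_G \<alpha>) 1 3 6 = 0" "jac (table_G \<alpha>) 1 4 5 = 0"
    by (simp_all add: tg flip: b_def, simp_all add: b field_simps)
      (simp_all add: b_def algebra_simps power2_eq_square power3_eq_cube)
  have high: "jac (table_G \<alpha>) 2 3 6 = 0" "jac (table_G \<alpha>) 2 4 5 = 0"
    "jac (table_G \<alpha>) 1 2 8 = 0" "jac (table_G \<alpha>) 1 3 7 = 0" "jac (table_G \<alpha>) 1 4 6 = 0"
    if "\<alpha>^2 + 4 * \<alpha> + 3 \<noteq> 0"
  proof -
    have c: "c \<noteq> 0" using that by (simp add: c_def)
    show "jac (table_G \<alpha>) 2 3 6 = 0" "jac (table_G \<alpha>) 2 4 5 = 0"
      "jac (table_G \<alpha>) 1 2 8 = 0" "jac (table_G \<alpha>) 1 3 7 = 0" "jac (table_G \<alpha>) 1 4 6 = 0"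
      by (simp_all add: tg flip: b_def c_def, simp_all add: b c field_simps)
        (simp_all add: b_def c_def algebra_simps power2_eq_square power3_eq_cube)
  qed
  have "i + j + k \<le> 11" using assms ijk by auto
  note tri = triples_weight_le_11[OF ijk(1-3) this]
  show "jac (table_G \<alpha>) i j k = 0"
  proof (cases "i + j + k \<le> 10")
    case True
    with tri low show ?thesis by (elim disjE conjE insertE emptyE) simp_all
  next
    case False
    with assms(2) ijk(4) have "\<alpha>^2 + 4 * \<alpha> + 3 \<noteq> 0" by auto
    with tri low high[OF this] False show ?thesis by (elim disjE conjE insertE emptyE) simp_all
  qed
qed

section \<open>Classification of tables\<close>

text \<open>\<open>a\<close> is the structure table of \<open>A\<close> in the basis \<open>t i *\<^sub>R evec i\<close>.\<close>

definition table_of :: "alg \<Rightarrow> (nat \<Rightarrow> real) \<Rightarrow> (nat \<Rightarrow> nat \<Rightarrow> real) \<Rightarrow> bool" where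
  "table_of A t a \<longleftrightarrow> (\<forall>i\<ge>1. t i \<noteq> 0) \<and>
     (\<forall>i j. 1 \<le> i \<and> i < j \<and> i + j \<le> alg_dim A \<longrightarrow> a i j * t (i + j) = t i * t j * struct_const A i j)"

lemma table_of_rescale:
  assumes "table_of A t (rescale u a)" and u: "\<And>i. 1 \<le> i \<Longrightarrow> u i \<noteq> 0"
  shows "table_of A (\<lambda>i. t i / u i) a"
  unfolding table_of_def
proof (intro conjI allI impI)
  fix i :: nat assume "1 \<le> i"
  then show "t i / u i \<noteq> 0" using assms unfolding table_of_def by simp
next
  fix i j assume ij: "1 \<le> i \<and> i < j \<and> i + j \<le> alg_dim A"
  have "u i \<noteq> 0" "u j \<noteq> 0" "u (i + j) \<noteq> 0" using u ij by auto
  moreover have "u i * u j / u (i + j) * a i j * t (i + j) = t i * t j * struct_const A i j"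
    using assms(1) ij unfolding table_of_def rescale_def by blast
  ultimately show "a i j * (t (i + j) / u (i + j)) = t i / u i * (t j / u j) * struct_const A i j"
    by (simp add: field_simps)
qed

lemma table_of_one:
  assumes "\<And>i j. \<lbrakk>1 \<le> i; i < j; i + j \<le> alg_dim A\<rbrakk> \<Longrightarrow> a i j = struct_const A i j"
  shows "table_of A (\<lambda>i. 1) a"
  using assms by (simp add: table_of_def)

lemma table_G_struct_const:
  assumes "1 \<le> i" "i < j"
  shows "i + j \<le> 8 \<Longrightarrow> struct_const (G8 \<alpha>) i j = table_G \<alpha> i j"
    and "i + j \<le> 10 \<Longrightarrow> struct_const (G10 \<alpha>) i j = table_G \<alpha> i j"
proof -
  have "map_of (rel3 \<alpha> @ rel4 \<alpha> @ rel5 \<alpha>) (i, j) = None" if "i + j \<le> 8"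
    using that by (auto simp: map_of_eq_None_iff rel3_def rel4_def rel5_def)
  then show "i + j \<le> 8 \<Longrightarrow> struct_const (G8 \<alpha>) i j = table_G \<alpha> i j"
    using assms by (auto simp: table_G_def alt_def rel_coeff_def map_add_def split: option.splits)
  have "map_of (rel5 \<alpha>) (i, j) = None" if "i + j \<le> 10"
    using that by (auto simp: map_of_eq_None_iff rel5_def)
  then show "i + j \<le> 10 \<Longrightarrow> struct_const (G10 \<alpha>) i j = table_G \<alpha> i j"
    using assms by (auto simp: table_G_def alt_def rel_coeff_def map_add_def split: option.splits)
qed

section \<open>Normalised tables with y = 1\<close>

context
  fixes b :: "nat \<Rightarrow> nat \<Rightarrow> real" and N :: nat and \<alpha> :: real
  assumes b: "lie_table N b" and b1: "\<And>i. 2 \<le> i \<Longrightarrow> i < N \<Longrightarrow> b 1 i = 1"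
    and b34: "b 3 4 = 1" and b23: "b 2 3 = 2 + \<alpha>" and N: "9 \<le> N"
begin

lemma normal_rec: "2 \<le> i \<Longrightarrow> 2 \<le> j \<Longrightarrow> i + j < N \<Longrightarrow> b (i + 1) j = b i j - b i (j + 1)"
  using table_rec1[OF b b1] by blast

text \<open>The identity for (2, 3, 4) amounts to
  \<open>(2 \<alpha> + 5) b 2 7 = (2 + \<alpha>) (2 \<alpha> - 1)\<close>, whose right side is 3 at
  \<alpha> = -5/2.\<close>

lemma weight_9_obstruction: "2 * \<alpha> + 5 \<noteq> 0"
proof
  assume z: "2 * \<alpha> + 5 = 0"
  have "b 2 4 = 2 + \<alpha>" using normal_rec[of 2 3] lie_table_self[OF b] b23 N by simp
  moreover from this have "b 2 5 = 1 + \<alpha>" using normal_rec[of 2 4] b34 N by simp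
  moreover have "b 3 5 = 1" using normal_rec[of 3 4] lie_table_self[OF b] b34 N by simp
  moreover have "b 2 6 = \<alpha>" using normal_rec[of 2 5] calculation N by simp
  moreover have "b 3 6 = \<alpha> - b 2 7" using normal_rec[of 2 6] calculation N by simp
  moreover have "b 4 5 = 1 - \<alpha> + b 2 7" using normal_rec[of 3 5] calculation N by simp
  moreover have "b 4 2 = - b 2 4" by (rule lie_table_anti[OF b])
  moreover have "b 3 4 * b 2 7 + b 4 2 * b 3 6 + b 2 3 * b 4 5 = 0"
    using lie_table_jac[OF b, of 2 3 4] N by (simp add: jac_def)
  ultimately have "b 2 7 - (2 + \<alpha>) * (\<alpha> - b 2 7) + (2 + \<alpha>) * (1 - \<alpha> + b 2 7) = 0"
    using b23 b34 by (simp only: mult_minus_left mult_1 add_uminus_conv_diff)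
  then have "(2 * \<alpha> + 5) * b 2 7 = (2 + \<alpha>) * (2 * \<alpha> - 1)"
    by (simp add: algebra_simps)
  moreover have "\<alpha> = - 5 / 2" using z by simp
  ultimately show False by simp
qed

text \<open>The bound \<open>M\<close> is kept apart from \<open>N\<close> because
  \<open>weight_11_obstruction\<close> starts from the agreement up to weight 10, at a stage where
  row 11 is not yet under control.\<close>

lemma agree_G:
  assumes M: "M \<le> N" and ok: "M \<le> 10 \<or> M = 11 \<and> \<alpha>^2 + 4 * \<alpha> + 3 \<noteq> 0"
    and ij: "1 \<le> i" "1 \<le> j" "i + j \<le> M"
  shows "b i j = table_G \<alpha> i j"
proof (rule table_agree_low[where N = M and s = "\<lambda>i. 1"])
  show "lie_table M b" using b M by (rule lie_table_mono)
  show "lie_table M (table_G \<alpha>)" using weight_9_obstruction ok by (rule lie_table_G)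
  show "b 1 k = table_G \<alpha> 1 k" if "2 \<le> k" "k < M" for k
    using that b1[of k] table_G_first[of k \<alpha>] ok M by auto
  show "(1::real) = b 1 k * 1" if "2 \<le> k" "k + 2 < M" for k
    using that b1[of k] M by auto
  show "b 2 3 = table_G \<alpha> 2 3" "b 3 4 = table_G \<alpha> 3 4"
    by (simp_all add: b23 b34 table_G_values)
  show "table_G \<alpha> 2 3 / (1 * 1) + table_G \<alpha> 3 (w - 5) / (1 * 1) + table_G \<alpha> 2 (w - 5) / (1 * 1) \<noteq> 0"
    if w: "odd w" "9 \<le> w" "w \<le> M" for w
  proof -
    consider "w = 9" | "w = 11" "M = 11"
    proof -
      have "w \<noteq> 10" using w(1) by auto
      then show ?thesis using w ok that by linarith
    qed
    then show ?thesis
    proof cases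
      case 1
      then show ?thesis using weight_9_obstruction by (simp add: table_G_values algebra_simps)
    next
      case 2
      have "(2 + \<alpha>) + (2 * \<alpha> + 2) / (2 * \<alpha> + 5) + \<alpha> = 4 * (\<alpha>^2 + 4 * \<alpha> + 3) / (2 * \<alpha> + 5)"
        using weight_9_obstruction by (simp add: divide_simps) (simp add: algebra_simps power2_eq_square)
      then show ?thesis using 2 weight_9_obstruction ok by (simp add: table_G_values)
    qed
  qed
qed (use ij in auto)

text \<open>At \<alpha> = -1 and \<alpha> = -3 the free entry \<open>b 2 9\<close> drops out of the
  identity for (2, 3, 6), and the constant that is left is -2 and -66 respectively.\<close>

lemma weight_11_obstruction:
  assumes "11 \<le> N" shows "\<alpha>^2 + 4 * \<alpha> + 3 \<noteq> 0"
proof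
  assume z: "\<alpha>^2 + 4 * \<alpha> + 3 = 0"
  have "(\<alpha> + 1) * (\<alpha> + 3) = 0" using z by (simp add: algebra_simps power2_eq_square)
  then have \<alpha>: "\<alpha> = -1 \<or> \<alpha> = -3" by auto
  have g: "b i j = table_G \<alpha> i j" if "1 \<le> i" "1 \<le> j" "i + j \<le> 10" for i j
    by (rule agree_G[of 10]) (use that assms in auto)
  have v: "b 2 6 = \<alpha>" "b 2 8 = table_G \<alpha> 2 8" "b 3 7 = table_G \<alpha> 3 7" "b 4 6 = table_G \<alpha> 4 6"
    "b 3 6 = table_G \<alpha> 3 6"
    using g by (simp_all add: table_G_values)
  have "b 3 8 = b 2 8 - b 2 9" using normal_rec[of 2 8] assms by simp
  moreover have "b 4 7 = b 3 7 - b 3 8" using normal_rec[of 3 7] assms by simp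
  moreover have "b 5 6 = b 4 6 - b 4 7" using normal_rec[of 4 6] assms by simp
  moreover have "b 6 2 = - b 2 6" "b 6 5 = - b 5 6" by (rule lie_table_anti[OF b])+
  moreover have "jac b 2 3 6 = 0" using lie_table_jac[OF b, of 2 3 6] assms by simp
  ultimately show False using \<alpha> v b23 by (auto simp: jac_def table_G_values)
qed

text \<open>Row 12 has no parameter: from \<open>b 6 6 = 0\<close> the recursion determines it, so
  the identity for (2, 3, 7) is a condition on \<alpha>. Over the common denominator
  \<open>2 c d d\<close> all higher powers of \<alpha> cancel and the numerator is 18 (\<alpha> -
  8).\<close>

lemma weight_12_obstruction:
  assumes "12 \<le> N" shows "\<alpha> = 8"
proof -
  define c where "c = \<alpha>^2 + 4 * \<alpha> + 3"
  define d where "d = 2 * \<alpha> + 5"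
  have c: "c \<noteq> 0" using weight_11_obstruction assms by (simp add: c_def)
  have d: "d \<noteq> 0" using weight_9_obstruction by (simp add: d_def)
  have g: "b i j = table_G \<alpha> i j" if "1 \<le> i" "1 \<le> j" "i + j \<le> 11" for i j
    by (rule agree_G[of 11]) (use that assms c in \<open>auto simp: c_def\<close>)
  have "b 5 7 = b 5 6" using normal_rec[of 5 6] lie_table_self[OF b, of 6] assms by simp
  moreover have "b 4 8 = b 4 7 - b 5 7" using normal_rec[of 4 7] assms by simp
  moreover have "b 3 9 = b 3 8 - b 4 8" using normal_rec[of 3 8] assms by simp
  moreover have "b 2 10 = b 2 9 - b 3 9" using normal_rec[of 2 9] assms by simp
  moreover have "b 7 2 = - b 2 7" "b 7 5 = - b 5 7" by (rule lie_table_anti[OF b])+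
  moreover have "jac b 2 3 7 = 0" using lie_table_jac[OF b, of 2 3 7] assms by simp
  ultimately have "b 3 7 * (b 2 9 - (b 3 8 - (b 4 7 - b 5 6))) - b 2 7 * (b 3 8 - (b 4 7 - b 5 6))
    - b 2 3 * b 5 6 = 0"
    by (simp add: jac_def)
  then have E: "table_G \<alpha> 3 7 * (table_G \<alpha> 2 9 - (table_G \<alpha> 3 8 - (table_G \<alpha> 4 7 - table_G \<alpha> 5 6)))
    - table_G \<alpha> 2 7 * (table_G \<alpha> 3 8 - (table_G \<alpha> 4 7 - table_G \<alpha> 5 6))
    - table_G \<alpha> 2 3 * table_G \<alpha> 5 6 = 0"
    using g by simp
  have comb: "x / d * (p / D - (q / D - (r / D - s / D))) - y / d * (q / D - (r / D - s / D)) - z * (s / D)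
    = (x * (p - (q - (r - s))) - y * (q - (r - s)) - z * s * d) / (d * D)"
    if "D \<noteq> 0" for x y z p q r s D :: real
    using d that by (simp add: field_simps)
  have G: "table_G \<alpha> 2 9 = (2 * \<alpha>^3 + 2 * \<alpha>^2 + 3) * d / (2 * c * d)"
    "table_G \<alpha> 3 8 = (4 * \<alpha>^3 + 8 * \<alpha>^2 - 8 * \<alpha> - 21) / (2 * c * d)"
    "table_G \<alpha> 4 7 = 3 * (2 * \<alpha>^2 + 4 * \<alpha> + 5) / (2 * c * d)"
    "table_G \<alpha> 5 6 = 3 * (4 * \<alpha> + 1) / (2 * c * d)"
    "table_G \<alpha> 3 7 = (2 * \<alpha> - 1) / d" "table_G \<alpha> 2 7 = (2 * \<alpha>^2 + 3 * \<alpha> - 2) / d"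
    unfolding table_G_values c_def[symmetric] d_def[symmetric] using d by simp_all
  have "2 * c * d \<noteq> 0" using c d by simp
  from E[unfolded G comb[OF this]]
  have "(2 * \<alpha> - 1) * ((2 * \<alpha>^3 + 2 * \<alpha>^2 + 3) * d - ((4 * \<alpha>^3 + 8 * \<alpha>^2 - 8 * \<alpha> - 21)
      - (3 * (2 * \<alpha>^2 + 4 * \<alpha> + 5) - 3 * (4 * \<alpha> + 1))))
    - (2 * \<alpha>^2 + 3 * \<alpha> - 2) * ((4 * \<alpha>^3 + 8 * \<alpha>^2 - 8 * \<alpha> - 21)
      - (3 * (2 * \<alpha>^2 + 4 * \<alpha> + 5) - 3 * (4 * \<alpha> + 1)))
    - table_G \<alpha> 2 3 * (3 * (4 * \<alpha> + 1)) * d = 0"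
    using c d by simp
  then have "18 * (\<alpha> - 8) = 0"
    unfolding table_G_values d_def by (simp add: algebra_simps power2_eq_square power3_eq_cube)
  then show ?thesis by simp
qed

text \<open>Non-degeneracy supplies the remaining excluded values. In row 9 the entries (2, 7) and
  (3, 6) vanish at -2, 1/2 and at -1; in row 11 the entries (2, 9), (3, 8), (5, 6) vanish at the
  roots of the two cubics and at -1/4.\<close>

lemma table_G_class:
  assumes n: "N = n + 1" "even n"
    and nd: "\<And>i. 1 \<le> i \<Longrightarrow> i \<le> n \<Longrightarrow> b i (n + 1 - i) \<noteq> 0"
  shows "\<exists>A\<in>symplectic_list. alg_dim A = n \<and> (\<exists>t. table_of A t b)"
proof -
  consider "n = 8" | "n = 10" | "12 \<le> n"
  proof -
    have "n \<noteq> 9" "n \<noteq> 11" using n(2) by auto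
    then show ?thesis using n N that by linarith
  qed
  then show ?thesis
  proof cases
    case 1
    have g: "b i j = table_G \<alpha> i j" if "1 \<le> i" "1 \<le> j" "i + j \<le> 9" for i j
      by (rule agree_G[of 9]) (use that N in auto)
    have tab: "table_of (G8 \<alpha>) (\<lambda>i. 1) b"
    proof (rule table_of_one)
      fix i j :: nat assume "1 \<le> i" "i < j" "i + j \<le> alg_dim (G8 \<alpha>)"
      then show "b i j = struct_const (G8 \<alpha>) i j"
        using g[of i j] table_G_struct_const(1)[of i j \<alpha>] by (simp del: struct_const.simps)
    qed
    have "table_G \<alpha> 2 7 \<noteq> 0" "table_G \<alpha> 3 6 \<noteq> 0"
      using nd[of 2] nd[of 3] g[of 2 7] g[of 3 6] 1 by auto
    moreover have "2 * \<alpha>^2 + 3 * \<alpha> - 2 = (2 * \<alpha> - 1) * (\<alpha> + 2)"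
      by (simp add: algebra_simps power2_eq_square)
    ultimately have "\<alpha> \<notin> {-5/2, -2, -1, 1/2}"
      using weight_9_obstruction by (auto simp: table_G_values)
    then show ?thesis
      using 1 tab by (intro bexI[of _ "G8 \<alpha>"]) (auto simp: symplectic_list_def)
  next
    case 2
    have z: "\<alpha>^2 + 4 * \<alpha> + 3 \<noteq> 0" using weight_11_obstruction 2 n by simp
    have g: "b i j = table_G \<alpha> i j" if "1 \<le> i" "1 \<le> j" "i + j \<le> 11" for i j
      by (rule agree_G[of 11]) (use that 2 n z in auto)
    have "table_of (G10 \<alpha>) (\<lambda>i. 1) b"
    proof (rule table_of_one)
      fix i j :: nat assume "1 \<le> i" "i < j" "i + j \<le> alg_dim (G10 \<alpha>)"
      then show "b i j = struct_const (G10 \<alpha>) i j"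
        using g[of i j] table_G_struct_const(2)[of i j \<alpha>] by (simp del: struct_const.simps)
    qed
    moreover have "table_G \<alpha> 2 9 \<noteq> 0" "table_G \<alpha> 3 8 \<noteq> 0" "table_G \<alpha> 5 6 \<noteq> 0"
      using nd[of 2] nd[of 3] nd[of 5] g[of 2 9] g[of 3 8] g[of 5 6] 2 by auto
    then have "\<alpha> \<notin> {-5/2, -1/4, -1, -3}" "2 * \<alpha>^3 + 2 * \<alpha>^2 + 3 \<noteq> 0"
      "4 * \<alpha>^3 + 8 * \<alpha>^2 - 8 * \<alpha> - 21 \<noteq> 0"
      using weight_9_obstruction z by (auto simp: table_G_values power2_eq_square)
    ultimately show ?thesis
      using 2 by (intro bexI[of _ "G10 \<alpha>"]) (auto simp: symplectic_list_def)
  next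
    case 3
    have \<alpha>: "\<alpha> = 8" using weight_12_obstruction 3 n by simp
    \<comment> \<open>In \<open>V\<close>, bracketing e_2 repeatedly with e_1 gives the basis
      \<open>(i - 2)! e i\<close>. In it the entries (2, 3) and (3, 4) are 1/6 and 1/60; the factor
      60 scales them to 10 = 2 + 8 and 1, the values of \<open>b\<close>.\<close>
    define u :: "nat \<Rightarrow> real" where "u i = (if i = 1 then 1 else 1 / (60 * fact (i - 2)))" for i
    have u: "u i \<noteq> 0" for i by (simp add: u_def)
    have f: "fact (i - Suc 0) = (real i - 1) * fact (i - 2)" if "2 \<le> i" for i
    proof -
      have "i - Suc 0 = Suc (i - 2)" "real (Suc (i - 2)) = real i - 1" using that by auto
      then show ?thesis by (metis fact_Suc)
    qed
    have r1: "rescale u b 1 i = real i - 1" if "2 \<le> i" "i < N" for i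
      using b1[of i] that f[of i] by (simp add: rescale_def u_def)
    have ag: "rescale u b i j = table_V i j" if "1 \<le> i" "1 \<le> j" "i + j \<le> N" for i j
    proof (rule table_agree_low[where N = N and s = "\<lambda>i. fact (i - 2)"])
      show "lie_table N (rescale u b)" using b u by (rule lie_table_rescale)
      show "lie_table N table_V" by (rule lie_table_V)
      show "rescale u b 1 i = table_V 1 i" if "2 \<le> i" "i < N" for i
        using r1[OF that] by (simp add: table_V_def)
      show "(fact (i + 1 - 2) :: real) = rescale u b 1 i * fact (i - 2)" if "2 \<le> i" "i + 2 < N" for i
        using r1[of i] that f[of i] by simp
      show "(fact (i - 2) :: real) \<noteq> 0" for i by simp
      show "rescale u b 2 3 = table_V 2 3" "rescale u b 3 4 = table_V 3 4"
        by (simp_all add: rescale_def u_def table_V_def b23 b34 \<alpha> fact_numeral)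
      show "table_V 2 3 / (fact (5 - 2) * fact (w - 5 - 2)) + table_V 3 (w - 5) / (fact (2 - 2) * fact (w - 2 - 2))
        + table_V 2 (w - 5) / (fact (3 - 2) * fact (w - 3 - 2)) \<noteq> 0" if "9 \<le> w" for w
      proof -
        \<comment> \<open>All three summands of the coefficient are positive because
          \<open>w - 5 > 3\<close>.\<close>
        have "table_V 2 3 / (fact (5 - 2) * fact (w - 5 - 2)) > 0"
          "table_V 3 (w - 5) / (fact (2 - 2) * fact (w - 2 - 2)) > 0"
          "table_V 2 (w - 5) / (fact (3 - 2) * fact (w - 3 - 2)) > 0"
          using that by (auto simp: table_V_def intro!: divide_pos_pos)
        then show ?thesis by linarith
      qed
    qed (use that in auto)
    obtain k where k: "n = 2 * k" using n(2) by blast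
    have "table_of (V n) (\<lambda>i. 1) (rescale u b)"
      by (rule table_of_one) (use ag n in \<open>simp add: table_V_def\<close>)
    then have "table_of (V n) (\<lambda>i. (1 / u i) :: real) b"
      by (rule table_of_rescale) (rule u)
    then show ?thesis
      using 3 k by (intro bexI[of _ "V n"]) (auto simp: symplectic_list_def)
  qed
qed

end

lemma table_class:
  assumes a: "lie_table (n + 1) a" and a1: "\<And>i. 2 \<le> i \<Longrightarrow> i \<le> n \<Longrightarrow> a 1 i = 1"
    and n: "even n" "4 \<le> n"
    and nd: "\<And>i. 1 \<le> i \<Longrightarrow> i \<le> n \<Longrightarrow> a i (n + 1 - i) \<noteq> 0"
  shows "\<exists>A\<in>symplectic_list. alg_dim A = n \<and> (\<exists>t. table_of A t a)"
proof -
  have a1': "a 1 i = 1" if "2 \<le> i" "i < n + 1" for i using a1 that by simp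
  obtain k where k: "n = 2 * k" using n(1) by blast
  consider "5 < n + 1 \<longrightarrow> a 2 3 = 0" "7 < n + 1 \<longrightarrow> a 3 4 = 0"
    | "n = 6" "a 2 3 \<noteq> 0" | "8 \<le> n" "a 3 4 = 0" "a 2 3 \<noteq> 0" | "8 \<le> n" "a 3 4 \<noteq> 0"
  proof -
    have "n \<noteq> 5" "n \<noteq> 7" using n(1) by auto
    then have "n = 4 \<or> n = 6 \<or> 8 \<le> n" using n(2) by linarith
    moreover have "\<not> 5 < n + 1" if "n = 4" using that by simp
    moreover have "\<not> 7 < n + 1" if "n = 4 \<or> n = 6" using that by auto
    ultimately show ?thesis using that by metis
  qed
  then show ?thesis
  proof cases
    case 1
    have "a i j = 0" if "2 \<le> i" "2 \<le> j" "i + j \<le> n" for i j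
      by (rule table_M0[OF a a1']) (use 1 that n nd[of 2] in auto)
    then have "table_of (M0 n) (\<lambda>i. 1) a"
      using a1 by (auto simp: table_of_def)
    then show ?thesis
      using k n by (intro bexI[of _ "M0 n"]) (auto simp: symplectic_list_def)
  next
    case 2
    \<comment> \<open>In dimension 6 the entry (3, 4) has weight 7 and belongs to the form, so the
      algebra depends on \<open>a 2 3\<close> alone. \<open>t\<close> consists of the factorials
      natural to \<open>V\<close> and the factor that matches \<open>[e2, e3]\<close>.\<close>
    define t :: "nat \<Rightarrow> real" where "t i = (if i = 1 then 1 else 6 * a 2 3 * fact (i - 2))" for i
    have t: "t i \<noteq> 0" for i using 2 by (simp add: t_def)
    have "a (2 + 1) 3 = a 2 3 - a 2 (3 + 1)" by (rule table_rec1[OF a a1']) (use 2 in auto)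
    then have a24: "a 2 4 = a 2 3" using lie_table_self[OF a] by simp
    have "table_of (V 6) t a"
      unfolding table_of_def
    proof (intro conjI allI impI)
      fix i j :: nat assume ij: "1 \<le> i \<and> i < j \<and> i + j \<le> alg_dim (V 6)"
      then have "i = 1 \<and> j \<in> {2,3,4,5} \<or> i = 2 \<and> j \<in> {3,4}" by auto
      then show "a i j * t (i + j) = t i * t j * struct_const (V 6) i j"
        using a1 2 a24 by (auto simp: t_def fact_numeral)
    qed (rule t)
    then show ?thesis
      using 2 by (intro bexI[of _ "V 6"]) (auto simp: symplectic_list_def)
  next
    case 3
    have "a 3 (n + 1 - 3) = 0"
      by (rule table_m2_degenerate[OF a a1']) (use 3 in auto)
    then show ?thesis using nd[of 3] 3 by simp
  next
    case 4
    \<comment> \<open>Dividing every basis vector but e_1 by \<open>y\<close> divides the brackets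
      among degrees at least 2 by \<open>y\<close> and keeps those with e_1.\<close>
    define u where "u i = (if i = (1::nat) then 1 else 1 / a 3 4)" for i
    have u: "u i \<noteq> 0" for i using 4 by (simp add: u_def)
    have "\<exists>A\<in>symplectic_list. alg_dim A = n \<and> (\<exists>t. table_of A t (rescale u a))"
    proof (rule table_G_class[where N = "n + 1" and \<alpha> = "a 2 3 / a 3 4 - 2"])
      show "lie_table (n + 1) (rescale u a)" using a u by (rule lie_table_rescale)
      show "rescale u a 1 i = 1" if "2 \<le> i" "i < n + 1" for i
        using a1'[OF that] that 4 by (simp add: rescale_def u_def)
      show "rescale u a i (n + 1 - i) \<noteq> 0" if "1 \<le> i" "i \<le> n" for i
        using nd[OF that] u by (simp add: rescale_def)
    qed (use 4 n in \<open>auto simp: rescale_def u_def field_simps\<close>)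
    then show ?thesis using table_of_rescale[where u = u] u by blast
  qed
qed

section \<open>Algebras on coordinate spaces\<close>

lemma eq_uminus_imp_zero: "(v::'a::real_vector) = - v \<Longrightarrow> v = 0"
  by (metis eq_neg_iff_add_eq_0 scaleR_2 scaleR_eq_0_iff zero_neq_numeral)

abbreviation coord :: "fsupp \<Rightarrow> nat \<Rightarrow> real" where
  "coord \<equiv> Poly_Mapping.lookup"

lemma lookup_scaleR [simp]:
  "coord (r *\<^sub>R x) i = r *\<^sub>R coord x i"
proof -
  have "finite {i. r *\<^sub>R coord x i \<noteq> 0}"
    by (rule finite_subset[OF _ finite_lookup[of x]]) auto
  then show ?thesis by (simp add: scaleR_poly_mapping_def)
qed

lemma lookup_evec: "coord (evec i) j = (if i = j then 1 else 0)"
  by (simp add: evec_def lookup_single when_def)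

lemma evec_nonzero: "evec i \<noteq> 0"
  by (metis lookup_evec lookup_zero zero_neq_one)

lemma linear_lookup: "linear (\<lambda>x::fsupp. coord x i)"
  by (rule linearI) (simp_all add: lookup_add)

lemma span_evec: "span {evec i} = range (\<lambda>c. c *\<^sub>R evec i)"
  by (rule span_singleton)

lemma span_evecD:
  assumes "x \<in> span (evec ` {1..n})"
  shows "i \<notin> {1..n} \<Longrightarrow> coord x i = 0"
    and "x = (\<Sum>i=1..n. coord x i *\<^sub>R evec i)"
proof -
  show z: "coord x i = 0" if "i \<notin> {1..n}" for i
    by (rule linear_eq_0_on_span[OF linear_lookup _ assms]) (use that in \<open>auto simp: lookup_evec\<close>)
  show "x = (\<Sum>i=1..n. coord x i *\<^sub>R evec i)"
  proof (rule poly_mapping_eqI)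
    fix k
    have "coord (\<Sum>i=1..n. coord x i *\<^sub>R evec i) k
        = (\<Sum>i=1..n. if i = k then coord x i else 0)"
      unfolding lookup_sum by (rule sum.cong) (auto simp: lookup_evec)
    then show "coord x k = coord (\<Sum>i=1..n. coord x i *\<^sub>R evec i) k"
      using z[of k] by simp
  qed
qed

lemma evec_in_alg_space: "1 \<le> i \<Longrightarrow> i \<le> alg_dim A \<Longrightarrow> evec i \<in> alg_space A"
  unfolding alg_space_def by (intro span_base) auto

lemma subspace_alg_space: "subspace (alg_space A)"
  unfolding alg_space_def by (rule subspace_span)

lemma linear_ee: "linear (\<lambda>x. ee i j x y)" "linear (\<lambda>y. ee i j x y)"
  by (rule linearI; simp add: ee_def wedge_def lookup_add algebra_simps)+

lemma linear_alg_bracket: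
  shows "linear (\<lambda>x. alg_bracket A x y)" "linear (\<lambda>y. alg_bracket A x y)"
  unfolding alg_bracket_def case_prod_beta
  by (rule linearI; simp add: linear_add[OF linear_ee(1)] linear_add[OF linear_ee(2)]
      linear_scale[OF linear_ee(1)] linear_scale[OF linear_ee(2)]
      distrib_left scaleR_add_left sum.distrib scaleR_sum_right algebra_simps)+

lemma alg_bracket_anti: "alg_bracket A y x = - alg_bracket A x y"
proof -
  have "ee i j y x = - ee i j x y" for i j by (simp add: ee_def wedge_def)
  then show ?thesis by (simp add: alg_bracket_def case_prod_beta flip: sum_negf)
qed

text \<open>\<open>struct_const\<close> is meaningful only above the diagonal; this is the
  antisymmetric table to which \<open>lie_table\<close> applies.\<close>

definition tab :: "alg \<Rightarrow> nat \<Rightarrow> nat \<Rightarrow> real" where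
  "tab A = alt (struct_const A)"

lemma tab_anti: "tab A j i = - tab A i j"
  unfolding tab_def by (rule alt_anti)

lemma tab_eq: "i < j \<Longrightarrow> tab A i j = struct_const A i j"
  by (simp add: tab_def alt_def)

lemma alg_bracket_evec:
  assumes "1 \<le> i" "1 \<le> j"
  shows "alg_bracket A (evec i) (evec j) =
    (if i + j \<le> alg_dim A then tab A i j *\<^sub>R evec (i + j) else 0)"
proof -
  consider "i < j" | "i = j" | "j < i" by linarith
  then show ?thesis
  proof cases
    case 1
    then show ?thesis using alg_bracket_basis[of i j A] assms by (simp add: tab_eq)
  next
    case 2
    have "alg_bracket A (evec i) (evec i) = 0"
      using alg_bracket_anti by (rule eq_uminus_imp_zero)
    then show ?thesis using 2 by (simp add: tab_def alt_def)
  next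
    case 3
    then show ?thesis
      using alg_bracket_basis[of j i A] alg_bracket_anti[of A "evec i" "evec j"] tab_anti[of A i j] assms
      by (simp add: tab_eq add.commute)
  qed
qed

lemma alg_bracket_in: "alg_bracket A x y \<in> alg_space A"
  unfolding alg_bracket_def case_prod_beta
  by (intro subspace_sum[OF subspace_alg_space] subspace_scale[OF subspace_alg_space] evec_in_alg_space) auto

lemma trilinear_zero:
  fixes F :: "'a::real_vector \<Rightarrow> 'a \<Rightarrow> 'a \<Rightarrow> 'b::real_vector"
  assumes "\<And>y z. linear (\<lambda>x. F x y z)" "\<And>x z. linear (\<lambda>y. F x y z)" "\<And>x y. linear (\<lambda>z. F x y z)"
    and B: "\<And>x y z. \<lbrakk>x \<in> B; y \<in> B; z \<in> B\<rbrakk> \<Longrightarrow> F x y z = 0"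
    and "x \<in> span B" "y \<in> span B" "z \<in> span B"
  shows "F x y z = 0"
proof -
  have 1: "F x y z = 0" if "x \<in> B" "y \<in> B" for x y
    by (rule linear_eq_0_on_span[OF assms(3) _ assms(7)]) (use B that in auto)
  have 2: "F x y z = 0" if "x \<in> B" for x
    by (rule linear_eq_0_on_span[OF assms(2) _ assms(6)]) (use 1 that in auto)
  show ?thesis
    by (rule linear_eq_0_on_span[OF assms(1) _ assms(5)]) (use 2 in auto)
qed

lemma bilinear_on_linear:
  assumes "\<And>y. linear (\<lambda>x. f x y)" "\<And>x. linear (\<lambda>y. f x y)"
  shows "bilinear_on L f"
  unfolding bilinear_on_def
  using linear_add[OF assms(1)] linear_add[OF assms(2)] linear_scale[OF assms(1)] linear_scale[OF assms(2)]
  by blast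

lemma linear_alg_bracket_compose:
  "linear f \<Longrightarrow> linear (\<lambda>x. alg_bracket A (f x) y)"
  "linear f \<Longrightarrow> linear (\<lambda>x. alg_bracket A y (f x))"
  using linear_compose[OF _ linear_alg_bracket(1)] linear_compose[OF _ linear_alg_bracket(2)]
  by (auto simp: o_def)

lemma lie_algebra_alg:
  assumes T: "lie_table (alg_dim A) (tab A)"
  shows "lie_algebra (alg_space A) (alg_bracket A)"
  unfolding lie_algebra_def
proof (intro conjI ballI)
  show "alg_bracket A x x = 0" for x
    using alg_bracket_anti by (rule eq_uminus_imp_zero)
  show "bilinear_on (alg_space A) (alg_bracket A)"
    by (rule bilinear_on_linear) (rule linear_alg_bracket)+
  let ?J = "\<lambda>x y z. alg_bracket A x (alg_bracket A y z) + alg_bracket A y (alg_bracket A z x)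
    + alg_bracket A z (alg_bracket A x y)"
  fix x y z assume xyz: "x \<in> alg_space A" "y \<in> alg_space A" "z \<in> alg_space A"
  show "?J x y z = 0"
  proof (rule trilinear_zero[where F = ?J and B = "evec ` {1..alg_dim A}"])
    fix x y z assume "x \<in> evec ` {1..alg_dim A}" "y \<in> evec ` {1..alg_dim A}" "z \<in> evec ` {1..alg_dim A}"
    then obtain i j k where e: "x = evec i" "y = evec j" "z = evec k"
      and ijk: "1 \<le> i" "1 \<le> j" "1 \<le> k" by auto
    have br2: "alg_bracket A (evec p) (alg_bracket A (evec q) (evec r)) =
      (if p + q + r \<le> alg_dim A then (tab A q r * tab A p (q + r)) *\<^sub>R evec (p + q + r) else 0)"
      if "1 \<le> p" "1 \<le> q" "1 \<le> r" for p q r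
    proof (cases "q + r \<le> alg_dim A")
      case True
      have "alg_bracket A (evec p) (alg_bracket A (evec q) (evec r))
        = tab A q r *\<^sub>R alg_bracket A (evec p) (evec (q + r))"
        using that True by (simp add: alg_bracket_evec linear_scale[OF linear_alg_bracket(2)])
      then show ?thesis using that by (simp add: alg_bracket_evec add.assoc)
    next
      case False
      then have "alg_bracket A (evec q) (evec r) = 0" using that by (simp add: alg_bracket_evec)
      then show ?thesis using False linear_0[OF linear_alg_bracket(2)] by simp
    qed
    have w: "j + k + i = i + j + k" "k + i + j = i + j + k" by auto
    have "?J x y z = (if i + j + k \<le> alg_dim A then jac (tab A) i j k *\<^sub>R evec (i + j + k) else 0)"
      using ijk unfolding e by (simp add: br2 w jac_def scaleR_add_left)
    then show "?J x y z = 0" using lie_table_jac[OF T] ijk by simp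
  qed (use xyz in \<open>auto simp: alg_space_def intro!: linear_compose_add linear_alg_bracket_compose linear_alg_bracket\<close>)
qed (auto intro: alg_bracket_in subspace_alg_space)

lemma graded_filiform_alg:
  assumes T: "lie_table (alg_dim A) (tab A)" and n: "3 \<le> alg_dim A"
    and T1: "\<And>i. 2 \<le> i \<Longrightarrow> i < alg_dim A \<Longrightarrow> tab A 1 i \<noteq> 0"
  shows "graded_filiform (alg_dim A) (alg_space A) (alg_bracket A) (alg_grade A)"
proof -
  define n where "n = alg_dim A"
  have grade: "alg_grade A i = range (\<lambda>c. c *\<^sub>R evec i)" if "i \<in> {1..n}" for i
    using that by (simp add: alg_grade_def n_def span_evec)
  have grade0: "alg_grade A i = {0}" if "i \<notin> {1..n}" for i
    using that by (auto simp: alg_grade_def n_def)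
  have sub: "subspace (alg_grade A i)" for i
    by (auto simp: alg_grade_def subspace_span)
  have gin: "alg_grade A i \<subseteq> alg_space A" for i
  proof (cases "i \<in> {1..n}")
    case True
    then have "span {evec i} \<subseteq> span (evec ` {1..n})" by (intro span_mono) auto
    then show ?thesis using True by (simp add: alg_grade_def alg_space_def n_def)
  next
    case False
    then show ?thesis using grade0[OF False] by (simp add: alg_space_def span_zero)
  qed
  have unique: "\<exists>!c. (\<forall>i. c i \<in> alg_grade A i) \<and> x = (\<Sum>i=1..n. c i)" if x: "x \<in> alg_space A" for x
  proof (rule ex1I)
    show "(\<forall>i. (if i \<in> {1..n} then coord x i *\<^sub>R evec i else 0) \<in> alg_grade A i) \<and>
        x = (\<Sum>i=1..n. if i \<in> {1..n} then coord x i *\<^sub>R evec i else 0)"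
      using span_evecD(2)[of x n] x grade grade0 by (auto simp: alg_space_def n_def)
  next
    fix c assume c: "(\<forall>i. c i \<in> alg_grade A i) \<and> x = (\<Sum>i=1..n. c i)"
    have ck: "c i = coord (c i) i *\<^sub>R evec i" if i: "i \<in> {1..n}" for i
    proof -
      obtain a where "c i = a *\<^sub>R evec i" using c grade[OF i] by blast
      then show ?thesis by (simp add: lookup_evec)
    qed
    have "coord x i = coord (c i) i" if i: "i \<in> {1..n}" for i
    proof -
      have "coord x i = (\<Sum>k=1..n. coord (c k) i)"
        using c by (simp add: lookup_sum)
      also have "\<dots> = (\<Sum>k=1..n. if k = i then coord (c k) i else 0)"
      proof (rule sum.cong)
        fix k assume k: "k \<in> {1..n}"
        have "coord (c k) i = 0" if "k \<noteq> i"
          using ck[OF k] that by (metis lookup_evec lookup_scaleR scaleR_zero_right)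
        then show "coord (c k) i = (if k = i then coord (c k) i else 0)" by simp
      qed simp
      finally show ?thesis using i by simp
    qed
    then show "c = (\<lambda>i. if i \<in> {1..n} then coord x i *\<^sub>R evec i else 0)"
      using ck c grade0 by (intro ext) (metis singletonD)
  qed
  have br0: "alg_bracket A 0 y = 0" "alg_bracket A x 0 = 0" for x y
    using linear_0[OF linear_alg_bracket(1)] linear_0[OF linear_alg_bracket(2)] by auto
  have graded: "alg_bracket A x y \<in> alg_grade A (i + j)"
    if ij: "1 \<le> i" "1 \<le> j" and xy: "x \<in> alg_grade A i" "y \<in> alg_grade A j" for i j x y
  proof (cases "i \<le> n \<and> j \<le> n")
    case True
    then obtain a b where "x = a *\<^sub>R evec i" "y = b *\<^sub>R evec j"
      using xy grade ij by auto
    then have "alg_bracket A x y = (a * b) *\<^sub>R alg_bracket A (evec i) (evec j)"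
      by (simp add: linear_scale[OF linear_alg_bracket(1)] linear_scale[OF linear_alg_bracket(2)])
    moreover have "alg_bracket A (evec i) (evec j) \<in> alg_grade A (i + j)"
      using ij by (auto simp: alg_bracket_evec alg_grade_def span_base span_scale n_def)
    ultimately show ?thesis using subspace_scale[OF sub] by simp
  next
    case False
    then have "x = 0 \<or> y = 0" using xy grade0[of i] grade0[of j] ij by auto
    then show ?thesis using br0 subspace_0[OF sub] by auto
  qed
  have gen: "span {alg_bracket A x y | x y. x \<in> alg_grade A 1 \<and> y \<in> alg_grade A i} = alg_grade A (i + 1)"
    if i: "2 \<le> i" for i
  proof
    show "span {alg_bracket A x y | x y. x \<in> alg_grade A 1 \<and> y \<in> alg_grade A i} \<subseteq> alg_grade A (i + 1)"
      by (rule span_minimal[OF _ sub]) (use graded[of 1 i] i in \<open>auto simp: add.commute\<close>)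
    show "alg_grade A (i + 1) \<subseteq> span {alg_bracket A x y | x y. x \<in> alg_grade A 1 \<and> y \<in> alg_grade A i}"
    proof (cases "i + 1 \<le> n")
      case True
      have "tab A 1 i \<noteq> 0" using T1 i True n_def by simp
      then have "evec (i + 1) = alg_bracket A (evec 1) ((1 / tab A 1 i) *\<^sub>R evec i)"
        using i True by (simp add: alg_bracket_evec linear_scale[OF linear_alg_bracket(2)] n_def)
      moreover have "evec 1 \<in> alg_grade A 1" "(1 / tab A 1 i) *\<^sub>R evec i \<in> alg_grade A i"
        using i True by (auto simp: alg_grade_def n_def intro: span_base span_scale)
      ultimately have "evec (i + 1) \<in> {alg_bracket A x y | x y. x \<in> alg_grade A 1 \<and> y \<in> alg_grade A i}"
        by blast
      then show ?thesis
        using True i by (auto simp: grade intro!: span_scale intro: span_base)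
    next
      case False
      then show ?thesis using grade0[of "i + 1"] by (auto intro: span_zero)
    qed
  qed
  have "dim (alg_grade A i) = 1" if "i \<in> {1..n}" for i
  proof -
    have "independent {evec i}" using evec_nonzero by simp
    then show ?thesis using that dim_eq_card_independent[of "{evec i}"] by (simp add: alg_grade_def n_def)
  qed
  then show ?thesis
    unfolding graded_filiform_def n_def[symmetric]
    using lie_algebra_alg[OF T] n sub gin grade0 unique graded gen by (simp add: n_def)
qed

section \<open>Forms of weight n + 1 as sequences\<close>

definition hform :: "nat \<Rightarrow> (nat \<Rightarrow> real) \<Rightarrow> form" where
  "hform n C x y = (\<Sum>i=1..n. C i * coord x i * coord y (n + 1 - i))"

lemma hform_evec:
  assumes "i \<in> {1..n}" "j \<in> {1..n}"
  shows "hform n C (evec i) (evec j) = (if i + j = n + 1 then C i else 0)"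
proof -
  have "hform n C (evec i) (evec j) = (\<Sum>k=1..n. if k = i then (if i + j = n + 1 then C i else 0) else 0)"
    unfolding hform_def by (rule sum.cong) (use assms in \<open>auto simp: lookup_evec\<close>)
  then show ?thesis using assms by simp
qed

lemma linear_hform: "linear (\<lambda>x. hform n C x y)" "linear (\<lambda>y. hform n C x y)"
  unfolding hform_def
  by (rule linearI; simp add: lookup_add sum.distrib sum_distrib_left algebra_simps)+

lemma hform_flip:
  assumes "\<And>i. i \<in> {1..n} \<Longrightarrow> C (n + 1 - i) = - C i"
  shows "hform n C y x = - hform n C x y"
proof -
  have "hform n C y x = (\<Sum>i=1..n. C (n + 1 - i) * coord y (n + 1 - i) * coord x i)"
    unfolding hform_def
    by (rule sum.reindex_bij_witness[of _ "\<lambda>i. n + 1 - i" "\<lambda>i. n + 1 - i"]) auto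
  also have "\<dots> = - hform n C x y"
    unfolding hform_def sum_negf[symmetric] by (rule sum.cong) (use assms in auto)
  finally show ?thesis .
qed

text \<open>The conditions express non-degeneracy, antisymmetry and closedness of
  \<open>hform\<close>. If \<open>C i\<close> is read as the entry \<open>(i, n + 1 - i)\<close> of
  an extra row, the last one is the Jacobi identity in weight \<open>n + 1\<close>.\<close>

definition closed_seq :: "alg \<Rightarrow> (nat \<Rightarrow> real) \<Rightarrow> bool" where
  "closed_seq A C \<longleftrightarrow> (\<forall>i\<in>{1..alg_dim A}. C i \<noteq> 0 \<and> C (alg_dim A + 1 - i) = - C i) \<and>
     (\<forall>i j k. 1 \<le> i \<and> 1 \<le> j \<and> 1 \<le> k \<and> i + j + k = alg_dim A + 1 \<longrightarrow>
        tab A j k * C i + tab A k i * C j + tab A i j * C k = 0)"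

lemma symplectic_hform:
  assumes C: "closed_seq A C"
  shows "symplectic_form (alg_space A) (alg_bracket A) (hform (alg_dim A) C)"
proof -
  define n where "n = alg_dim A"
  define \<omega> where "\<omega> = hform n C"
  have C0: "C i \<noteq> 0" "C (n + 1 - i) = - C i" if "i \<in> {1..n}" for i
    using C that unfolding closed_seq_def n_def by auto
  note lin = linear_hform[of n C, folded \<omega>_def]
  have two: "two_form (alg_space A) \<omega>"
    unfolding two_form_def
  proof (intro conjI ballI)
    show "bilinear_on (alg_space A) \<omega>" by (rule bilinear_on_linear) (rule lin)+
    show "\<omega> x x = 0" for x using hform_flip[of n C x x] C0(2) by (simp add: \<omega>_def)
  qed
  have nd: "x = 0" if x: "x \<in> alg_space A" and z: "\<forall>y\<in>alg_space A. \<omega> x y = 0" for x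
  proof -
    have "coord x i = 0" if i: "i \<in> {1..n}" for i
    proof -
      have "0 = \<omega> x (evec (n + 1 - i))"
        using z evec_in_alg_space[of "n + 1 - i" A] i by (auto simp: n_def)
      also have "\<dots> = (\<Sum>k=1..n. if k = i then C i * coord x i else 0)"
        unfolding \<omega>_def hform_def by (rule sum.cong) (use i in \<open>auto simp: lookup_evec\<close>)
      also have "\<dots> = C i * coord x i" using i by simp
      finally show ?thesis using C0(1)[OF i] by simp
    qed
    then show ?thesis using span_evecD(2)[of x n] x by (simp add: alg_space_def n_def)
  qed
  have closed: "diff2 (alg_bracket A) \<omega> x y z = 0"
    if "x \<in> alg_space A" "y \<in> alg_space A" "z \<in> alg_space A" for x y z
  proof (rule trilinear_zero[where B = "evec ` {1..n}"])
    have lb: "linear f \<Longrightarrow> linear (\<lambda>x. \<omega> (f x) y)" "linear f \<Longrightarrow> linear (\<lambda>x. \<omega> y (f x))" for f y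
      using linear_compose[OF _ lin(1)] linear_compose[OF _ lin(2)] by (auto simp: o_def)
    show "linear (\<lambda>x. diff2 (alg_bracket A) \<omega> x y z)" "linear (\<lambda>x. diff2 (alg_bracket A) \<omega> y x z)"
      "linear (\<lambda>x. diff2 (alg_bracket A) \<omega> y z x)" for y z
      unfolding diff2_def by (intro linear_compose_add lb linear_alg_bracket linear_ident)+
    fix x y z assume "x \<in> evec ` {1..n}" "y \<in> evec ` {1..n}" "z \<in> evec ` {1..n}"
    then obtain i j k where e: "x = evec i" "y = evec j" "z = evec k"
      and ijk: "i \<in> {1..n}" "j \<in> {1..n}" "k \<in> {1..n}" by auto
    \<comment> \<open>\<open>C\<close> is indexed by the first argument of the form, here
      \<open>p + q = n + 1 - r\<close>; passing to \<open>C r\<close> costs the minus sign.\<close>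
    have br2: "\<omega> (alg_bracket A (evec p) (evec q)) (evec r) = (if p + q + r = n + 1 then - tab A p q * C r else 0)"
      if "p \<in> {1..n}" "q \<in> {1..n}" "r \<in> {1..n}" for p q r
    proof (cases "p + q \<le> n")
      case True
      have "\<omega> (alg_bracket A (evec p) (evec q)) (evec r) = tab A p q * \<omega> (evec (p + q)) (evec r)"
        using that True by (simp add: alg_bracket_evec linear_scale[OF lin(1)] n_def)
      moreover have "C (p + q) = - C r" if "p + q + r = n + 1"
        using C0(2)[of r] \<open>r \<in> {1..n}\<close> that by (metis diff_add_inverse2)
      ultimately show ?thesis using that True by (auto simp: \<omega>_def hform_evec)
    next
      case False
      then show ?thesis
        using that linear_0[OF lin(1)] by (auto simp: alg_bracket_evec n_def)
    qed
    have w: "j + k + i = i + j + k" "k + i + j = i + j + k" by auto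
    show "diff2 (alg_bracket A) \<omega> x y z = 0"
    proof (cases "i + j + k = n + 1")
      case True
      have "tab A j k * C i + tab A k i * C j + tab A i j * C k = 0"
        using C True ijk unfolding closed_seq_def n_def by auto
      then show ?thesis using ijk True by (simp add: diff2_def e br2 w)
    next
      case False
      then show ?thesis using ijk by (simp add: diff2_def e br2 w)
    qed
  qed (use that in \<open>auto simp: alg_space_def n_def\<close>)
  show ?thesis
    unfolding symplectic_form_def using two nd closed by (simp add: \<omega>_def n_def)
qed

section \<open>The listed algebras and forms\<close>

text \<open>The algebra extended by the row of weight \<open>n + 1\<close> that holds its listed
  form. \<beta> is the parameter of the forms on \<open>M0\<close>; the other families are constant
  in it, so that one set indexed by non-zero \<beta> describes the forms of all four.\<close>

fun ext_table :: "real \<Rightarrow> alg \<Rightarrow> nat \<Rightarrow> nat \<Rightarrow> real" where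
  "ext_table \<beta> (M0 n) = alt (\<lambda>i j. if i = 1 then 1 else if i + j = n + 1 then (- 1) ^ i * \<beta> else 0)"
| "ext_table \<beta> (V n) = table_V"
| "ext_table \<beta> (G8 \<alpha>) = table_G \<alpha>"
| "ext_table \<beta> (G10 \<alpha>) = table_G \<alpha>"

lemma symplectic_list_cases:
  assumes "A \<in> symplectic_list"
  obtains (M0) k where "A = M0 (2 * k)" "2 \<le> k"
  | (V) k where "A = V (2 * k)" "k = 3 \<or> 6 \<le> k"
  | (G8) \<alpha> where "A = G8 \<alpha>" "2 * \<alpha> + 5 \<noteq> 0" "\<alpha> \<noteq> -2" "\<alpha> \<noteq> -1" "2 * \<alpha> - 1 \<noteq> 0"
  | (G10) \<alpha> where "A = G10 \<alpha>" "2 * \<alpha> + 5 \<noteq> 0" "\<alpha>^2 + 4 * \<alpha> + 3 \<noteq> 0" "4 * \<alpha> + 1 \<noteq> 0"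
      "2 * \<alpha>^3 + 2 * \<alpha>^2 + 3 \<noteq> 0" "4 * \<alpha>^3 + 8 * \<alpha>^2 - 8 * \<alpha> - 21 \<noteq> 0"
proof -
  have q: "\<alpha>^2 + 4 * \<alpha> + 3 = (\<alpha> + 1) * (\<alpha> + 3)" for \<alpha> :: real
    by (simp add: algebra_simps power2_eq_square)
  consider k where "A = M0 (2 * k)" "2 \<le> k" | "A = V 6" | k where "A = V (2 * k)" "6 \<le> k"
    | \<alpha> where "A = G8 \<alpha>" "\<alpha> \<notin> {-5/2, -2, -1, 1/2}"
    | \<alpha> where "A = G10 \<alpha>" "\<alpha> \<notin> {-5/2, -1/4, -1, -3}" "2 * \<alpha>^3 + 2 * \<alpha>^2 + 3 \<noteq> 0"
      "4 * \<alpha>^3 + 8 * \<alpha>^2 - 8 * \<alpha> - 21 \<noteq> 0"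
    using assms unfolding symplectic_list_def by blast
  then show thesis
  proof cases
    case 1 then show thesis by (rule M0)
  next
    case 2 then show thesis using V[of 3] by simp
  next
    case 3 then show thesis using V by blast
  next
    case (4 \<alpha>)
    then have "2 * \<alpha> + 5 \<noteq> 0" "2 * \<alpha> - 1 \<noteq> 0" by auto
    then show thesis using G8[of \<alpha>] 4 by auto
  next
    case (5 \<alpha>)
    then have "2 * \<alpha> + 5 \<noteq> 0" "4 * \<alpha> + 1 \<noteq> 0" "\<alpha> + 1 \<noteq> 0" "\<alpha> + 3 \<noteq> 0" by auto
    then show thesis using G10[of \<alpha>] 5 q[of \<alpha>] by auto
  qed
qed

lemma alg_dim_even:
  assumes "A \<in> symplectic_list"
  shows "even (alg_dim A)" "4 \<le> alg_dim A"
  by (rule symplectic_list_cases[OF assms]; auto)+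

lemma ext_table_anti: "ext_table \<beta> A j i = - ext_table \<beta> A i j"
  by (cases A) (auto simp: alt_anti[of _ j i] table_V_def table_G_anti[of _ j i])

lemma lie_table_ext:
  assumes "A \<in> symplectic_list"
  shows "lie_table (alg_dim A + 1) (ext_table \<beta> A)"
  using assms
proof (cases rule: symplectic_list_cases)
  case (M0 k)
  show ?thesis
  proof (rule lie_tableI)
    fix i j l :: nat assume ijl: "1 \<le> i" "i < j" "j < l" "i + j + l \<le> alg_dim A + 1"
    let ?T = "ext_table \<beta> A"
    have z: "?T p q = 0" if "2 \<le> p" "2 \<le> q" "p + q \<noteq> 2 * k + 1" for p q
      using that by (auto simp: M0 alt_def)
    have one: "?T 1 p = 1" "?T p 1 = - 1" if "2 \<le> p" for p
      using that by (auto simp: M0 alt_def)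
    show "jac ?T i j l = 0"
    proof (cases "i = 1")
      case True
      have T: "?T j l = 0" using z[of j l] ijl True by (simp add: M0)
      have "?T l (j + 1) = ?T j (l + 1)"
      proof (cases "j + l = 2 * k")
        case False
        then show ?thesis using z[of j "l + 1"] z[of l "j + 1"] ijl True by simp
      next
        case True
        \<comment> \<open>By parity \<open>j + 1 < l\<close>, so \<open>(j + 1, l)\<close> and
          \<open>(j, l + 1)\<close> are neighbours in the last row with opposite signs; reversing
          the first makes the two values equal.\<close>
        then have "l \<noteq> j + 1" by presburger
        then have "?T l (j + 1) = - ((- 1) ^ (j + 1) * \<beta>)" "?T j (l + 1) = (- 1) ^ j * \<beta>"
          using True ijl by (auto simp: M0 alt_def)
        then show ?thesis by simp
      qed
      then show ?thesis using T one[of j] one[of l] ijl True by (simp add: jac_def add.commute)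
    next
      case False
      then show ?thesis
        using z[of j l] z[of l i] z[of i j] ijl by (simp add: jac_def M0)
    qed
  qed (rule ext_table_anti)
next
  case (V k)
  then show ?thesis by (simp add: lie_table_V)
next
  case (G8 \<alpha>)
  then show ?thesis using lie_table_G[of \<alpha> 9] by simp
next
  case (G10 \<alpha>)
  then show ?thesis using lie_table_G[of \<alpha> 11] by simp
qed

lemma ext_table_eq_tab:
  assumes A: "A \<in> symplectic_list" and ij: "1 \<le> i" "1 \<le> j" "i + j \<le> alg_dim A"
  shows "ext_table \<beta> A i j = tab A i j"
proof -
  have lt: "ext_table \<beta> A i j = tab A i j" if ij: "1 \<le> i" "i < j" "i + j \<le> alg_dim A" for i j
    using A
  proof (cases rule: symplectic_list_cases)
    case (M0 k)
    then show ?thesis using ij by (auto simp: tab_def alt_def)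
  next
    case (V k)
    then show ?thesis using ij by (auto simp: tab_def alt_def table_V_def)
  next
    case (G8 \<alpha>)
    then show ?thesis using ij table_G_struct_const(1)[of i j \<alpha>] tab_eq[of i j A]
      by (simp del: struct_const.simps)
  next
    case (G10 \<alpha>)
    then show ?thesis using ij table_G_struct_const(2)[of i j \<alpha>] tab_eq[of i j A]
      by (simp del: struct_const.simps)
  qed
  consider "i < j" | "i = j" | "j < i" by linarith
  then show ?thesis
  proof cases
    case 1 then show ?thesis using lt ij by simp
  next
    case 2
    then show ?thesis using ext_table_anti[of \<beta> A i i] tab_anti[of A i i] by simp
  next
    case 3
    then have "ext_table \<beta> A j i = tab A j i" using lt[of j i] ij by simp
    then show ?thesis using ext_table_anti[of \<beta> A i j] tab_anti[of A i j] by simp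
  qed
qed

lemma ext_table_nonzero:
  assumes A: "A \<in> symplectic_list" and \<beta>: "\<beta> \<noteq> 0" and i: "1 \<le> i" "i \<le> alg_dim A"
  shows "ext_table \<beta> A i (alg_dim A + 1 - i) \<noteq> 0"
proof -
  define n where "n = alg_dim A"
  have half: "ext_table \<beta> A i (n + 1 - i) \<noteq> 0" if i: "1 \<le> i" "i < n + 1 - i" for i
    using A
  proof (cases rule: symplectic_list_cases)
    case (M0 k)
    then show ?thesis using i \<beta> by (auto simp: alt_def n_def)
  next
    case (V k)
    then show ?thesis using i by (auto simp: table_V_def n_def)
  next
    case (G8 \<alpha>)
    have "2 * \<alpha>^2 + 3 * \<alpha> - 2 = (2 * \<alpha> - 1) * (\<alpha> + 2)"
      by (simp add: algebra_simps power2_eq_square)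
    then have "2 * \<alpha>^2 + 3 * \<alpha> - 2 \<noteq> 0" "2 * \<alpha> + 2 \<noteq> 0" using G8 by auto
    moreover have "i = 1 \<or> i = 2 \<or> i = 3 \<or> i = 4"
      using i unfolding n_def G8(1) alg_dim.simps by presburger
    ultimately show ?thesis using G8 by (elim disjE) (simp_all add: table_G_values n_def)
  next
    case (G10 \<alpha>)
    \<comment> \<open>The entry (4, 7) has no real zero, which is why it excludes no
      \<alpha>.\<close>
    have "2 * \<alpha>^2 + 4 * \<alpha> + 5 = 2 * (\<alpha> + 1)^2 + 3" by (simp add: algebra_simps power2_eq_square)
    then have "2 * \<alpha>^2 + 4 * \<alpha> + 5 \<noteq> 0" using zero_le_power2[of "\<alpha> + 1"] by linarith
    moreover have "i = 1 \<or> i = 2 \<or> i = 3 \<or> i = 4 \<or> i = 5"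
      using i unfolding n_def G10(1) alg_dim.simps by presburger
    ultimately show ?thesis using G10 by (elim disjE) (simp_all add: table_G_values n_def)
  qed
  show ?thesis
  proof (cases "i < n + 1 - i")
    case True
    then show ?thesis using half i by (simp add: n_def)
  next
    case False
    obtain k where "n = 2 * k" using alg_dim_even(1)[OF A] unfolding n_def by blast
    then have "n + 1 - i < i" "1 \<le> n + 1 - i" "n + 1 - (n + 1 - i) = i"
      using False i unfolding n_def by presburger+
    then have "ext_table \<beta> A (n + 1 - i) i \<noteq> 0" using half[of "n + 1 - i"] by simp
    then show ?thesis using ext_table_anti[of \<beta> A i "n + 1 - i"] by (simp add: n_def)
  qed
qed

lemma closed_seq_of_table:
  assumes T: "lie_table (alg_dim A + 1) T"
    and eq: "\<And>i j. \<lbrakk>1 \<le> i; 1 \<le> j; i + j \<le> alg_dim A\<rbrakk> \<Longrightarrow> T i j = tab A i j"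
    and nz: "\<And>i. \<lbrakk>1 \<le> i; i \<le> alg_dim A\<rbrakk> \<Longrightarrow> T i (alg_dim A + 1 - i) \<noteq> 0"
  shows "closed_seq A (\<lambda>i. T i (alg_dim A + 1 - i))"
  unfolding closed_seq_def
proof (intro conjI ballI allI impI)
  fix i assume i: "i \<in> {1..alg_dim A}"
  then show "T i (alg_dim A + 1 - i) \<noteq> 0" using nz by simp
  have "alg_dim A + 1 - (alg_dim A + 1 - i) = i" using i by auto
  then show "T (alg_dim A + 1 - i) (alg_dim A + 1 - (alg_dim A + 1 - i)) = - T i (alg_dim A + 1 - i)"
    using lie_table_anti[OF T, of "alg_dim A + 1 - i" i] by simp
next
  fix i j k assume ijk: "1 \<le> i \<and> 1 \<le> j \<and> 1 \<le> k \<and> i + j + k = alg_dim A + 1"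
  have w: "alg_dim A + 1 - i = j + k" "alg_dim A + 1 - j = k + i" "alg_dim A + 1 - k = i + j"
    using ijk by auto
  have "T i j = tab A i j" "T j k = tab A j k" "T k i = tab A k i"
    by (rule eq; use ijk in linarith)+
  moreover have "jac T i j k = 0"
    by (rule lie_table_jac[OF T]) (use ijk in auto)
  ultimately show "tab A j k * T i (alg_dim A + 1 - i) + tab A k i * T j (alg_dim A + 1 - j)
    + tab A i j * T k (alg_dim A + 1 - k) = 0"
    unfolding w jac_def by simp
qed

definition ext_seq :: "real \<Rightarrow> alg \<Rightarrow> nat \<Rightarrow> real" where
  "ext_seq \<beta> A i = ext_table \<beta> A i (alg_dim A + 1 - i)"

lemma closed_ext_seq:
  assumes "A \<in> symplectic_list" "\<beta> \<noteq> 0"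
  shows "closed_seq A (ext_seq \<beta> A)"
  unfolding ext_seq_def
  by (rule closed_seq_of_table[OF lie_table_ext[OF assms(1)]])
    (use assms ext_table_eq_tab ext_table_nonzero in auto)

lemma hform_half:
  assumes "\<And>i. i \<in> {1..2 * k} \<Longrightarrow> C (2 * k + 1 - i) = - C i"
  shows "hform (2 * k) C x y = (\<Sum>i=1..k. C i * ee i (2 * k + 1 - i) x y)"
proof -
  let ?f = "\<lambda>i. C i * coord x i * coord y (2 * k + 1 - i)"
  have "{1..2 * k} = {1..k} \<union> {k + 1..2 * k}" by auto
  then have "hform (2 * k) C x y = sum ?f {1..k} + sum ?f {k + 1..2 * k}"
    unfolding hform_def by (simp add: sum.union_disjoint)
  also have "sum ?f {k + 1..2 * k} = (\<Sum>i=1..k. ?f (2 * k + 1 - i))"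
    by (rule sum.reindex_bij_witness[of _ "\<lambda>i. 2 * k + 1 - i" "\<lambda>i. 2 * k + 1 - i"]) auto
  also have "sum ?f {1..k} + (\<Sum>i=1..k. ?f (2 * k + 1 - i)) = (\<Sum>i=1..k. C i * ee i (2 * k + 1 - i) x y)"
    unfolding sum.distrib[symmetric]
    by (rule sum.cong) (use assms in \<open>auto simp: ee_def wedge_def algebra_simps\<close>)
  finally show ?thesis .
qed

lemma ext_seq_flip:
  assumes "i \<in> {1..alg_dim A}"
  shows "ext_seq \<beta> A (alg_dim A + 1 - i) = - ext_seq \<beta> A i"
proof -
  have "alg_dim A + 1 - (alg_dim A + 1 - i) = i" using assms by auto
  then show ?thesis
    unfolding ext_seq_def using ext_table_anti[of \<beta> A "alg_dim A + 1 - i" i] by simp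
qed

lemma listed_forms_eq:
  assumes "A \<in> symplectic_list"
  shows "listed_forms A = {hform (alg_dim A) (ext_seq \<beta> A) | \<beta>. \<beta> \<noteq> 0}"
proof -
  obtain k where k: "alg_dim A = 2 * k" "2 \<le> k"
  proof -
    obtain k where "alg_dim A = 2 * k" using alg_dim_even(1)[OF assms] by blast
    then show thesis using that[of k] alg_dim_even(2)[OF assms] by simp
  qed
  have half: "hform (alg_dim A) (ext_seq \<beta> A) x y =
      (\<Sum>i=1..k. ext_table \<beta> A i (2 * k + 1 - i) * ee i (2 * k + 1 - i) x y)" for \<beta> x y
    using hform_half[of k "ext_seq \<beta> A" x y] ext_seq_flip[of _ A \<beta>] k by (simp add: ext_seq_def)
  have const: "listed_forms A = {hform (alg_dim A) (ext_seq \<beta> A) | \<beta>. \<beta> \<noteq> 0}"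
    if "listed_forms A = {\<omega>}" "\<And>\<beta>. hform (alg_dim A) (ext_seq \<beta> A) = \<omega>" for \<omega>
    using that zero_neq_one[where 'a = real] by auto
  show ?thesis
    using assms
  proof (cases rule: symplectic_list_cases)
    case (M0 m)
    have "form_M0 k \<beta> x y = hform (alg_dim A) (ext_seq \<beta> A) x y" for \<beta> x y
    proof -
      have "{1..k} = insert 1 {2..k}" using k by auto
      then have "hform (alg_dim A) (ext_seq \<beta> A) x y = ee 1 (2 * k) x y
          + (\<Sum>i=2..k. ext_table \<beta> A i (2 * k + 1 - i) * ee i (2 * k + 1 - i) x y)"
        unfolding half using M0 k by (simp add: alt_def)
      also have "(\<Sum>i=2..k. ext_table \<beta> A i (2 * k + 1 - i) * ee i (2 * k + 1 - i) x y)
          = \<beta> * (\<Sum>i=2..k. (- 1) ^ i * ee i (2 * k - i + 1) x y)"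
        unfolding sum_distrib_left
      proof (rule sum.cong)
        fix i assume i: "i \<in> {2..k}"
        then have "2 * k + 1 - i = 2 * k - i + 1" by auto
        moreover have "ext_table \<beta> A i (2 * k - i + 1) = (- 1) ^ i * \<beta>"
          using i M0 k by (auto simp: alt_def)
        ultimately show "ext_table \<beta> A i (2 * k + 1 - i) * ee i (2 * k + 1 - i) x y =
          \<beta> * ((- 1) ^ i * ee i (2 * k - i + 1) x y)" by simp
      qed simp
      finally show ?thesis by (simp add: form_M0_def)
    qed
    then have "form_M0 k \<beta> = hform (alg_dim A) (ext_seq \<beta> A)" for \<beta> by blast
    then show ?thesis using M0 k by auto
  next
    case (V m)
    have "hform (alg_dim A) (ext_seq \<beta> A) x y = form_V k x y" for \<beta> x y
      unfolding half form_V_def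
    proof (rule sum.cong)
      fix i assume "i \<in> {1..k}"
      then show "ext_table \<beta> A i (2 * k + 1 - i) * ee i (2 * k + 1 - i) x y
        = (2 * real k + 1 - 2 * real i) * ee i (2 * k + 1 - i) x y"
        using V by (simp add: table_V_def of_nat_diff)
    qed simp
    then have "hform (alg_dim A) (ext_seq \<beta> A) = form_V k" for \<beta> by blast
    then show ?thesis using const[of "form_V k"] V k by simp
  next
    case (G8 \<alpha>)
    have "hform (alg_dim A) (ext_seq \<beta> A) x y = form_G8 \<alpha> x y" for \<beta> x y
    proof -
      have "{1..4::nat} = {1,2,3,4}" by auto
      then show ?thesis unfolding half using k G8 by (simp add: form_G8_def table_G_values)
    qed
    then have "hform (alg_dim A) (ext_seq \<beta> A) = form_G8 \<alpha>" for \<beta> by blast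
    then show ?thesis using const[of "form_G8 \<alpha>"] G8 by simp
  next
    case (G10 \<alpha>)
    have "hform (alg_dim A) (ext_seq \<beta> A) x y = form_G10 \<alpha> x y" for \<beta> x y
    proof -
      have "{1..5::nat} = {1,2,3,4,5}" by auto
      then show ?thesis unfolding half using k G10 by (simp add: form_G10_def table_G_values)
    qed
    then have "hform (alg_dim A) (ext_seq \<beta> A) = form_G10 \<alpha>" for \<beta> by blast
    then show ?thesis using const[of "form_G10 \<alpha>"] G10 by simp
  qed
qed

lemma lie_table_tab:
  assumes "A \<in> symplectic_list"
  shows "lie_table (alg_dim A) (tab A)"
proof (rule lie_tableI)
  fix i j k assume "1 \<le> i" "i < j" "j < k" "i + j + k \<le> alg_dim A"
  then show "jac (tab A) i j k = 0"
    using lie_table_jac[OF lie_table_ext[OF assms, of 0], of i j k] ext_table_eq_tab[OF assms, of _ _ 0]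
    by (simp add: jac_def)
qed (rule tab_anti)

lemma tab_first:
  assumes "A \<in> symplectic_list" "2 \<le> i" "i < alg_dim A"
  shows "tab A 1 i = (case A of V n \<Rightarrow> real i - 1 | _ \<Rightarrow> 1)"
  using assms(1)
proof (cases rule: symplectic_list_cases)
  case (G8 \<alpha>)
  then show ?thesis
    using assms ext_table_eq_tab[of A 1 i 0] table_G_first[of i \<alpha>] by simp
next
  case (G10 \<alpha>)
  then show ?thesis
    using assms ext_table_eq_tab[of A 1 i 0] table_G_first[of i \<alpha>] by simp
qed (use assms in \<open>auto simp: tab_def alt_def\<close>)

lemma tab_first_nonzero:
  "A \<in> symplectic_list \<Longrightarrow> 2 \<le> i \<Longrightarrow> i < alg_dim A \<Longrightarrow> tab A 1 i \<noteq> 0"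
  using tab_first[of A i] by (auto split: alg.splits)

lemma graded_filiform_listed:
  assumes "A \<in> symplectic_list"
  shows "graded_filiform (alg_dim A) (alg_space A) (alg_bracket A) (alg_grade A)"
  by (rule graded_filiform_alg)
    (use assms lie_table_tab tab_first_nonzero alg_dim_even(2)[OF assms] in auto)

section \<open>Uniqueness of the homogeneous forms\<close>

lemma bilinear_eq_on_evec:
  fixes f h :: form
  assumes f: "\<And>y. linear (\<lambda>x. f x y)" "\<And>x. linear (\<lambda>y. f x y)"
    and h: "\<And>y. linear (\<lambda>x. h x y)" "\<And>x. linear (\<lambda>y. h x y)"
    and eq: "\<And>i j. \<lbrakk>i \<in> {1..n}; j \<in> {1..n}\<rbrakk> \<Longrightarrow> f (evec i) (evec j) = h (evec i) (evec j)"
    and "x \<in> span (evec ` {1..n})" "y \<in> span (evec ` {1..n})"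
  shows "f x y = h x y"
proof -
  have 1: "f (evec i) y = h (evec i) y" if "i \<in> {1..n}" for i
    by (rule linear_eq_on_span[OF f(2) h(2) _ assms(7)]) (use eq that in auto)
  show ?thesis
    by (rule linear_eq_on_span[OF f(1) h(1) _ assms(6)]) (use 1 in auto)
qed

lemma hform_scale: "hform n (\<lambda>i. c * C i) x y = c * hform n C x y"
  by (simp add: hform_def sum_distrib_left mult.assoc)

lemma hform_cong: "(\<And>i. i \<in> {1..n} \<Longrightarrow> C i = D i) \<Longrightarrow> hform n C = hform n D"
  by (auto simp: hform_def fun_eq_iff intro!: sum.cong)

lemma sum_antidiagonal:
  "(\<Sum>(i, j) \<in> {(i, j). i \<in> {1..n} \<and> j \<in> {1..n} \<and> i + j = n + 1}. f i j) = (\<Sum>i=1..n. f i (n + 1 - i))" for n :: nat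
proof (rule sum.reindex_bij_witness[of _ "\<lambda>i. (i, n + 1 - i)" fst])
  fix p assume "p \<in> {(i, j). i \<in> {1..n} \<and> j \<in> {1..n} \<and> i + j = n + 1}"
  then obtain i j where p: "p = (i, j)" "i \<in> {1..n}" and "i + j = n + 1" by blast
  then have j: "n + 1 - i = j" by linarith
  show "f (fst p) (n + 1 - fst p) = (case p of (i, j) \<Rightarrow> f i j)"
    unfolding p(1) fst_conv j by simp
qed auto

lemma homogeneous_hform:
  assumes C: "\<And>i. i \<in> {1..alg_dim A} \<Longrightarrow> C (alg_dim A + 1 - i) = - C i"
    and \<omega>: "\<And>x y. \<lbrakk>x \<in> alg_space A; y \<in> alg_space A\<rbrakk> \<Longrightarrow> \<omega> x y = hform (alg_dim A) C x y"
  shows "homogeneous A (alg_dim A + 1) \<omega>"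
  unfolding homogeneous_def
proof (intro exI ballI)
  fix x y assume xy: "x \<in> alg_space A" "y \<in> alg_space A"
  have "(\<Sum>i=1..alg_dim A. C i / 2 * ee i (alg_dim A + 1 - i) x y)
    = (hform (alg_dim A) C x y - hform (alg_dim A) C y x) / 2"
    unfolding hform_def sum_subtractf[symmetric] sum_divide_distrib
    by (rule sum.cong) (auto simp: ee_def wedge_def field_simps)
  then show "\<omega> x y = (\<Sum>(i, j)\<in>{(i, j). i \<in> {1..alg_dim A} \<and> j \<in> {1..alg_dim A} \<and> i + j = alg_dim A + 1}.
      C i / 2 * ee i j x y)"
    unfolding sum_antidiagonal using \<omega>[OF xy] hform_flip[of "alg_dim A" C y x] C by simp
qed

lemma symplectic_form_cong:
  assumes "\<And>x y. \<lbrakk>x \<in> alg_space A; y \<in> alg_space A\<rbrakk> \<Longrightarrow> \<omega> x y = \<omega>' x y"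
    and "symplectic_form (alg_space A) (alg_bracket A) \<omega>'"
  shows "symplectic_form (alg_space A) (alg_bracket A) \<omega>"
proof -
  have "x + y \<in> alg_space A" "c *\<^sub>R x \<in> alg_space A" if "x \<in> alg_space A" "y \<in> alg_space A" for x y c
    using that subspace_add[OF subspace_alg_space] subspace_scale[OF subspace_alg_space] by auto
  then show ?thesis
    using assms alg_bracket_in
    unfolding symplectic_form_def two_form_def bilinear_on_def diff2_def by simp
qed

text \<open>Non-degeneracy fixes the weight: a partner of e_1 has degree at most \<open>n\<close>
  and a partner of e_n has degree at least 1, so the weight is at most and at least
  \<open>n + 1\<close>.\<close>

lemma homogeneous_symplecticD:
  assumes n: "1 \<le> alg_dim A" and h: "homogeneous_symplectic A \<omega>"
  obtains C where "closed_seq A C"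
    and "\<And>x y. \<lbrakk>x \<in> alg_space A; y \<in> alg_space A\<rbrakk> \<Longrightarrow> \<omega> x y = hform (alg_dim A) C x y"
proof -
  define n where "n = alg_dim A"
  have n1: "1 \<le> n" using assms by (simp add: n_def)
  obtain w c where \<omega>: "\<And>x y. \<lbrakk>x \<in> alg_space A; y \<in> alg_space A\<rbrakk> \<Longrightarrow>
      \<omega> x y = (\<Sum>(i, j)\<in>{(i, j). i \<in> {1..n} \<and> j \<in> {1..n} \<and> i + j = w}. c i j * ee i j x y)"
    using h unfolding homogeneous_symplectic_def homogeneous_def n_def by blast
  \<comment> \<open>\<omega> is arbitrary off the subspace; \<Omega> equals it there and is bilinear
    everywhere.\<close>
  define \<Omega> where "\<Omega> x y = (\<Sum>(i, j)\<in>{(i, j). i \<in> {1..n} \<and> j \<in> {1..n} \<and> i + j = w}. c i j * ee i j x y)" for x y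
  have \<omega>\<Omega>: "\<omega> x y = \<Omega> x y" if "x \<in> alg_space A" "y \<in> alg_space A" for x y
    using \<omega> that by (simp add: \<Omega>_def)
  have lin: "linear (\<lambda>x. \<Omega> x y)" "linear (\<lambda>y. \<Omega> x y)" for x y
    unfolding \<Omega>_def case_prod_beta
    by (rule linearI; simp add: linear_add[OF linear_ee(1)] linear_add[OF linear_ee(2)]
      linear_scale[OF linear_ee(1)] linear_scale[OF linear_ee(2)]
      distrib_left sum.distrib sum_distrib_left algebra_simps)+
  have sf: "symplectic_form (alg_space A) (alg_bracket A) \<Omega>"
  proof (rule symplectic_form_cong)
    show "symplectic_form (alg_space A) (alg_bracket A) \<omega>"
      using h unfolding homogeneous_symplectic_def by blast
  qed (simp add: \<omega>\<Omega>)
  have anti: "\<Omega> y x = - \<Omega> x y" for x y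
  proof -
    have "ee i j y x = - ee i j x y" for i j by (simp add: ee_def wedge_def)
    then show ?thesis by (simp add: \<Omega>_def case_prod_beta sum_negf)
  qed
  have off: "\<Omega> (evec p) (evec q) = 0" if "p + q \<noteq> w" for p q
    unfolding \<Omega>_def
    by (rule sum.neutral) (use that in \<open>auto simp: ee_def wedge_def lookup_evec\<close>)
  have partner: "\<exists>q\<in>{1..n}. \<Omega> (evec p) (evec q) \<noteq> 0" if p: "p \<in> {1..n}" for p
  proof (rule ccontr)
    assume "\<not> ?thesis"
    then have none: "\<Omega> (evec p) (evec q) = 0" if "q \<in> {1..n}" for q using that by blast
    have "\<Omega> (evec p) y = 0" if "y \<in> alg_space A" for y
    proof (rule linear_eq_0_on_span[OF lin(2)])
      show "y \<in> span (evec ` {1..n})" using that by (simp add: alg_space_def n_def)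
      show "\<Omega> (evec p) x = 0" if "x \<in> evec ` {1..n}" for x using that none by blast
    qed
    moreover have "evec p \<in> alg_space A" using evec_in_alg_space p by (simp add: n_def)
    ultimately show False using sf evec_nonzero unfolding symplectic_form_def by blast
  qed
  have w: "w = n + 1"
  proof -
    obtain q where "q \<in> {1..n}" "1 + q = w" using partner[of 1] off n1 by force
    moreover obtain q' where "q' \<in> {1..n}" "n + q' = w" using partner[of n] off n1 by force
    ultimately show ?thesis by auto
  qed
  define C where "C i = \<Omega> (evec i) (evec (n + 1 - i))" for i
  have \<Omega>_evec: "\<Omega> (evec i) (evec j) = (if i + j = n + 1 then C i else 0)" for i j
  proof (cases "i + j = n + 1")
    case True
    then have "n + 1 - i = j" by simp
    then show ?thesis using True by (simp add: C_def)
  qed (use off w in auto)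
  have C_flip: "C (n + 1 - i) = - C i" if "i \<in> {1..n}" for i
  proof -
    have "n + 1 - (n + 1 - i) = i" using that by auto
    then show ?thesis unfolding C_def using anti[of "evec i" "evec (n + 1 - i)"] by simp
  qed
  have C_nz: "C i \<noteq> 0" if "i \<in> {1..n}" for i
    using partner[OF that] \<Omega>_evec[of i] by (auto split: if_splits)
  have C_cl: "tab A j k * C i + tab A k i * C j + tab A i j * C k = 0"
    if ijk: "1 \<le> i" "1 \<le> j" "1 \<le> k" "i + j + k = n + 1" for i j k
  proof -
    have in_space: "evec i \<in> alg_space A" "evec j \<in> alg_space A" "evec k \<in> alg_space A"
      by (rule evec_in_alg_space; use ijk n_def in linarith)+
    have T: "\<Omega> (alg_bracket A (evec p) (evec q)) (evec r) = - tab A p q * C r"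
      if "1 \<le> p" "1 \<le> q" "1 \<le> r" "p + q + r = n + 1" for p q r
    proof -
      have "C (p + q) = - C r"
      proof -
        have "p + q = n + 1 - r" using that by linarith
        then show ?thesis using C_flip[of r] that by simp
      qed
      then show ?thesis
        using that by (simp add: alg_bracket_evec linear_scale[OF lin(1)] \<Omega>_evec n_def)
    qed
    have "diff2 (alg_bracket A) \<Omega> (evec i) (evec j) (evec k) = 0"
      using sf in_space unfolding symplectic_form_def by blast
    then show ?thesis
      unfolding diff2_def using T[of i j k] T[of j k i] T[of k i j] ijk by simp
  qed
  have "closed_seq A C"
    unfolding closed_seq_def n_def[symmetric] using C_flip C_nz C_cl by blast
  moreover have "\<omega> x y = hform (alg_dim A) C x y" if "x \<in> alg_space A" "y \<in> alg_space A" for x y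
  proof -
    have "\<Omega> x y = hform n C x y"
      by (rule bilinear_eq_on_evec[where n = n])
        (use lin linear_hform that \<Omega>_evec hform_evec in \<open>auto simp: alg_space_def n_def\<close>)
    then show ?thesis using \<omega>\<Omega>[OF that] by (simp add: n_def)
  qed
  ultimately show thesis by (rule that)
qed

lemma homogeneous_symplectic_iff:
  assumes "1 \<le> alg_dim A"
  shows "homogeneous_symplectic A \<omega> \<longleftrightarrow> (\<exists>C. closed_seq A C \<and>
    (\<forall>x\<in>alg_space A. \<forall>y\<in>alg_space A. \<omega> x y = hform (alg_dim A) C x y))" (is "_ \<longleftrightarrow> ?R")
proof
  assume "homogeneous_symplectic A \<omega>"
  then show ?R by (rule homogeneous_symplecticD[OF assms]) blast
next
  assume ?R
  then obtain C where C: "closed_seq A C"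
    and \<omega>: "\<And>x y. \<lbrakk>x \<in> alg_space A; y \<in> alg_space A\<rbrakk> \<Longrightarrow> \<omega> x y = hform (alg_dim A) C x y"
    by blast
  have "homogeneous A (alg_dim A + 1) \<omega>"
    by (rule homogeneous_hform[of A C]) (use C \<omega> in \<open>auto simp: closed_seq_def\<close>)
  moreover have "symplectic_form (alg_space A) (alg_bracket A) \<omega>"
    by (rule symplectic_form_cong[OF _ symplectic_hform[OF C]]) (rule \<omega>)
  ultimately show "homogeneous_symplectic A \<omega>"
    unfolding homogeneous_symplectic_def by blast
qed

lemma closed_seq_scale: "closed_seq A C \<Longrightarrow> c \<noteq> 0 \<Longrightarrow> closed_seq A (\<lambda>i. c * C i)"
proof -
  assume C: "closed_seq A C" and c: "c \<noteq> 0"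
  have "tab A j k * (c * C i) + tab A k i * (c * C j) + tab A i j * (c * C k)
    = c * (tab A j k * C i + tab A k i * C j + tab A i j * C k)" for i j k
    by (simp add: algebra_simps)
  then show "closed_seq A (\<lambda>i. c * C i)" using C c unfolding closed_seq_def by simp
qed

lemma closed_seq_cong:
  assumes "closed_seq A C" and eq: "\<And>i. i \<in> {1..alg_dim A} \<Longrightarrow> C i = D i"
  shows "closed_seq A D"
  unfolding closed_seq_def
proof (intro conjI ballI allI impI)
  fix i assume i: "i \<in> {1..alg_dim A}"
  then have "alg_dim A + 1 - i \<in> {1..alg_dim A}" by auto
  then show "D i \<noteq> 0" "D (alg_dim A + 1 - i) = - D i"
    using assms(1) i eq[of i] eq[of "alg_dim A + 1 - i"] unfolding closed_seq_def by auto
next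
  fix i j k assume ijk: "1 \<le> i \<and> 1 \<le> j \<and> 1 \<le> k \<and> i + j + k = alg_dim A + 1"
  then have "D i = C i" "D j = C j" "D k = C k" using eq by auto
  then show "tab A j k * D i + tab A k i * D j + tab A i j * D k = 0"
    using assms(1) ijk unfolding closed_seq_def by simp
qed

text \<open>The converse of \<open>closed_seq_of_table\<close>. The dimension is even, so row
  \<open>n + 1\<close> misses the diagonal, where \<open>alt\<close> would put 0.\<close>

lemma closed_seq_extend:
  assumes A: "A \<in> symplectic_list" and C: "closed_seq A C"
  defines "T \<equiv> alt (\<lambda>i j. if i + j = alg_dim A + 1 then C i else tab A i j)"
  shows "lie_table (alg_dim A + 1) T"
    and "\<And>i j. \<lbrakk>1 \<le> i; 1 \<le> j; i + j \<le> alg_dim A\<rbrakk> \<Longrightarrow> T i j = tab A i j"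
    and "\<And>i. \<lbrakk>1 \<le> i; i \<le> alg_dim A\<rbrakk> \<Longrightarrow> T i (alg_dim A + 1 - i) = C i"
proof -
  show low: "T i j = tab A i j" if "1 \<le> i" "1 \<le> j" "i + j \<le> alg_dim A" for i j
    using that tab_anti[of A i j] tab_anti[of A j j] by (auto simp: T_def alt_def)
  show top: "T i (alg_dim A + 1 - i) = C i" if i: "1 \<le> i" "i \<le> alg_dim A" for i
  proof -
    have "C (alg_dim A + 1 - i) = - C i" using C i unfolding closed_seq_def by simp
    moreover have "alg_dim A + 1 - i \<noteq> i" using alg_dim_even(1)[OF A] i by presburger
    ultimately show ?thesis using i by (auto simp: T_def alt_def)
  qed
  show "lie_table (alg_dim A + 1) T"
  proof (rule lie_tableI)
    show "T j i = - T i j" for i j unfolding T_def by (rule alt_anti)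
  next
    fix i j k assume ijk: "1 \<le> i" "i < j" "j < k" "i + j + k \<le> alg_dim A + 1"
    have l: "T i j = tab A i j" "T j k = tab A j k" "T k i = tab A k i"
      by (rule low; use ijk in linarith)+
    show "jac T i j k = 0"
    proof (cases "i + j + k = alg_dim A + 1")
      case True
      then have w: "j + k = alg_dim A + 1 - i" "k + i = alg_dim A + 1 - j" "i + j = alg_dim A + 1 - k"
        by linarith+
      have "tab A j k * C i + tab A k i * C j + tab A i j * C k = 0"
        using C ijk True unfolding closed_seq_def by simp
      moreover have "T i (j + k) = C i" "T j (k + i) = C j" "T k (i + j) = C k"
        unfolding w by (rule top; use ijk in linarith)+
      ultimately show ?thesis unfolding jac_def l by simp
    next
      case False
      have "T i (j + k) = tab A i (j + k)" "T j (k + i) = tab A j (k + i)" "T k (i + j) = tab A k (i + j)"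
        by (rule low; use ijk False in linarith)+
      then have "jac T i j k = jac (tab A) i j k" unfolding jac_def l by simp
      also have "\<dots> = 0" by (rule lie_table_jac[OF lie_table_tab[OF A]]) (use ijk False in auto)
      finally show ?thesis .
    qed
  qed
qed

lemma closed_seq_M0:
  assumes k: "2 \<le> k" and C: "closed_seq (M0 (2 * k)) C" and C1: "C 1 = 1"
  shows "\<exists>\<beta>. \<beta> \<noteq> 0 \<and> (\<forall>i\<in>{1..2 * k}. C i = ext_seq \<beta> (M0 (2 * k)) i)"
proof (intro exI[of _ "C 2"] conjI ballI)
  show "C 2 \<noteq> 0" using C k unfolding closed_seq_def by simp
  have flip: "C (2 * k + 1 - i) = - C i" if "i \<in> {1..2 * k}" for i
    using C that unfolding closed_seq_def by simp
  \<comment> \<open>Closedness on (1, i, 2k - i) gives \<open>C (2 * k - i) = C i\<close>, and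
    antisymmetry turns the left side into \<open>- C (i + 1)\<close>. So the sequence alternates
    from \<open>C 2\<close> on, and \<open>C 2\<close> is the parameter \<beta>.\<close>
  have step: "C (Suc i) = - C i" if i: "2 \<le> i" "i + 2 \<le> 2 * k" for i
  proof -
    define j where "j = 2 * k - i"
    have j: "2 \<le> j" "1 + i + j = 2 * k + 1" using i by (auto simp: j_def)
    have "tab (M0 (2 * k)) i j * C 1 + tab (M0 (2 * k)) j 1 * C i + tab (M0 (2 * k)) 1 i * C j = 0"
      using C i j unfolding closed_seq_def by simp
    then have "C j = C i" using i j by (auto simp: tab_def alt_def split: if_splits)
    moreover have "C j = - C (Suc i)" using flip[of "Suc i"] i by (simp add: j_def)
    ultimately show ?thesis by simp
  qed
  have alt: "C i = (- 1) ^ i * C 2" if "2 \<le> i" "i + 1 \<le> 2 * k" for i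
    using that
  proof (induction i rule: nat_induct_at_least)
    case (Suc i)
    then show ?case using step[of i] by simp
  qed simp
  fix i assume i: "i \<in> {1..2 * k}"
  have ext: "ext_table \<beta> (M0 (2 * k)) i (2 * k + 1 - i) = C i" if "i < 2 * k + 1 - i" and \<beta>: "\<beta> = C 2" and "1 \<le> i" for i \<beta>
    using that alt[of i] C1 by (auto simp: alt_def)
  show "C i = ext_seq (C 2) (M0 (2 * k)) i"
  proof (cases "i < 2 * k + 1 - i")
    case True
    then show ?thesis using ext[of i "C 2"] i unfolding ext_seq_def by simp
  next
    case False
    define j where "j = 2 * k + 1 - i"
    have j: "j < 2 * k + 1 - j" "1 \<le> j" "2 * k + 1 - j = i"
      using False i unfolding j_def atLeastAtMost_iff by presburger+
    have "ext_table (C 2) (M0 (2 * k)) j i = C j" using ext[of j "C 2"] j by simp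
    then have "ext_table (C 2) (M0 (2 * k)) i j = - C j"
      using ext_table_anti[of "C 2" "M0 (2 * k)" i j] by linarith
    moreover have "C j = - C i" using flip[of i] i by (simp add: j_def)
    ultimately show ?thesis unfolding ext_seq_def alg_dim.simps j_def[symmetric] by linarith
  qed
qed

text \<open>Row \<open>n + 1\<close> has odd weight at least 9, so \<open>weight_unique_odd\<close>
  determines it once the coefficient is non-zero. On \<open>M0\<close> the coefficient is zero, and
  for \<open>V 6\<close> the weight is 7; hence the two exclusions.\<close>

lemma closed_seq_rigid:
  assumes A: "A \<in> symplectic_list" and no: "A \<noteq> V 6" "\<And>k. A \<noteq> M0 k"
    and C: "closed_seq A C" and C1: "C 1 = ext_seq 1 A 1" and i: "i \<in> {1..alg_dim A}"
  shows "C i = ext_seq 1 A i"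
proof -
  define n where "n = alg_dim A"
  define T where "T = alt (\<lambda>i j. if i + j = alg_dim A + 1 then C i else tab A i j)"
  have n8: "8 \<le> n" using A no unfolding n_def by (elim symplectic_list_cases) auto
  have ne: "even n" using alg_dim_even[OF A] by (simp add: n_def)
  \<comment> \<open>The running product of \<open>tab A 1 i\<close>, which is \<open>i - 1\<close>
    for \<open>V\<close> and 1 for the other families.\<close>
  define s :: "nat \<Rightarrow> real" where "s i = (case A of V n \<Rightarrow> fact (i - 2) | _ \<Rightarrow> 1)" for i
  have "T i (n + 1 - i) = ext_table 1 A i (n + 1 - i)"
  proof (rule weight_unique_odd[where N = "n + 1" and w = "n + 1" and s = s])
    show "lie_table (n + 1) T" using closed_seq_extend(1)[OF A C] by (simp add: T_def n_def)
    show "lie_table (n + 1) (ext_table 1 A)" using lie_table_ext[OF A] by (simp add: n_def)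
    show "T i j = ext_table 1 A i j" if "1 \<le> i" "1 \<le> j" "i + j < n + 1" for i j
      using that closed_seq_extend(2)[OF A C, of i j] ext_table_eq_tab[OF A, of i j 1]
      by (simp add: T_def n_def)
    show "T 1 (n + 1 - 1) = ext_table 1 A 1 (n + 1 - 1)"
      using closed_seq_extend(3)[OF A C, of 1] C1 n8 by (simp add: T_def n_def ext_seq_def)
    show "s i \<noteq> 0" for i by (simp add: s_def split: alg.splits)
    show "s (i + 1) = T 1 i * s i" if i: "2 \<le> i" "i + 2 < n + 1" for i
    proof -
      have "T 1 i = tab A 1 i"
        using closed_seq_extend(2)[OF A C, of 1 i] i by (simp add: T_def n_def)
      moreover have "i - Suc 0 = Suc (i - 2)" using i by simp
      moreover have "real (Suc (i - 2)) = real i - 1" using i by simp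
      ultimately show ?thesis
        using tab_first[OF A, of i] i unfolding n_def s_def
        by (simp add: n_def split: alg.splits del: of_nat_Suc)
    qed
    show "ext_table 1 A 2 3 / (s 5 * s (n + 1 - 5)) + ext_table 1 A 3 (n + 1 - 5) / (s 2 * s (n + 1 - 2))
      + ext_table 1 A 2 (n + 1 - 5) / (s 3 * s (n + 1 - 3)) \<noteq> 0"
      using A
    proof (cases rule: symplectic_list_cases)
      case (M0 k)
      then show ?thesis using no by simp
    next
      case (V k)
      have "table_V 2 3 / (s 5 * s (n + 1 - 5)) > 0" "table_V 3 (n + 1 - 5) / (s 2 * s (n + 1 - 2)) > 0"
        "table_V 2 (n + 1 - 5) / (s 3 * s (n + 1 - 3)) > 0"
        using n8 V by (auto simp: table_V_def s_def intro!: divide_pos_pos)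
      then show ?thesis unfolding V(1) ext_table.simps by linarith
    next
      case (G8 \<alpha>)
      then show ?thesis by (simp add: n_def s_def table_G_values algebra_simps)
    next
      case (G10 \<alpha>)
      have "(2 + \<alpha>) + (2 * \<alpha> + 2) / (2 * \<alpha> + 5) + \<alpha> = 4 * (\<alpha>^2 + 4 * \<alpha> + 3) / (2 * \<alpha> + 5)"
        using G10 by (simp add: divide_simps) (simp add: algebra_simps power2_eq_square)
      then show ?thesis using G10 by (simp add: n_def s_def table_G_values)
    qed
  qed (use n8 i in \<open>auto simp: n_def\<close>)
  then show ?thesis
    using closed_seq_extend(3)[OF A C, of i] i by (simp add: T_def n_def ext_seq_def)
qed

lemma closed_seq_unique:
  assumes A: "A \<in> symplectic_list" "A \<noteq> V 6" and C: "closed_seq A C"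
  shows "\<exists>\<beta> c. \<beta> \<noteq> 0 \<and> c \<noteq> 0 \<and> (\<forall>i\<in>{1..alg_dim A}. C i = c * ext_seq \<beta> A i)"
proof -
  define c where "c = C 1 / ext_seq 1 A 1"
  have one: "1 \<in> {1..alg_dim A}" using alg_dim_even(2)[OF A(1)] by simp
  have "C 1 \<noteq> 0" "ext_seq 1 A 1 \<noteq> 0"
    using C closed_ext_seq[OF A(1), of 1] one unfolding closed_seq_def by auto
  then have c: "c \<noteq> 0" "(1 / c) * C 1 = ext_seq 1 A 1" by (simp_all add: c_def)
  define D where "D i = (1 / c) * C i" for i
  have D: "closed_seq A D"
    using closed_seq_scale[OF C, of "1 / c"] c unfolding D_def by simp
  have "\<exists>\<beta>. \<beta> \<noteq> 0 \<and> (\<forall>i\<in>{1..alg_dim A}. D i = ext_seq \<beta> A i)"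
  proof (cases "\<exists>k. A = M0 k")
    case True
    obtain k where k: "A = M0 (2 * k)" "2 \<le> k"
      using A(1) True by (elim symplectic_list_cases) auto
    have "ext_seq 1 A 1 = 1" using k by (simp add: ext_seq_def alt_def)
    then have "D 1 = 1" using c by (simp add: D_def)
    then show ?thesis using closed_seq_M0[of k D] D k by simp
  next
    case False
    have "D 1 = ext_seq 1 A 1" using c by (simp add: D_def)
    then have "\<forall>i\<in>{1..alg_dim A}. D i = ext_seq 1 A i"
      using closed_seq_rigid[OF A _ D] False by blast
    then show ?thesis using zero_neq_one by metis
  qed
  then obtain \<beta> where "\<beta> \<noteq> 0" "\<forall>i\<in>{1..alg_dim A}. D i = ext_seq \<beta> A i" by blast
  moreover have "C i = c * D i" for i using c by (simp add: D_def)
  ultimately show ?thesis using c(1) by auto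
qed

theorem homogeneous_symplectic_listed:
  assumes A: "A \<in> symplectic_list" "A \<noteq> V 6"
  shows "homogeneous_symplectic A \<omega> \<longleftrightarrow> (\<exists>\<omega>'\<in>listed_forms A. proportional A \<omega> \<omega>')"
proof -
  have n: "1 \<le> alg_dim A" using alg_dim_even(2)[OF A(1)] by simp
  show ?thesis
    unfolding homogeneous_symplectic_iff[OF n] listed_forms_eq[OF A(1)] proportional_def
  proof
    assume "\<exists>C. closed_seq A C \<and> (\<forall>x\<in>alg_space A. \<forall>y\<in>alg_space A. \<omega> x y = hform (alg_dim A) C x y)"
    then obtain C where C: "closed_seq A C"
      and \<omega>: "\<And>x y. x \<in> alg_space A \<Longrightarrow> y \<in> alg_space A \<Longrightarrow> \<omega> x y = hform (alg_dim A) C x y" by blast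
    obtain \<beta> c where \<beta>: "\<beta> \<noteq> 0" and c: "c \<noteq> 0" and eq: "\<forall>i\<in>{1..alg_dim A}. C i = c * ext_seq \<beta> A i"
      using closed_seq_unique[OF A C] by blast
    have "hform (alg_dim A) C = hform (alg_dim A) (\<lambda>i. c * ext_seq \<beta> A i)"
      by (rule hform_cong) (use eq in auto)
    then have "\<omega> x y = c * hform (alg_dim A) (ext_seq \<beta> A) x y" if "x \<in> alg_space A" "y \<in> alg_space A" for x y
      using \<omega>[OF that] by (simp add: hform_scale)
    then show "\<exists>\<omega>'\<in>{hform (alg_dim A) (ext_seq \<beta> A) | \<beta>. \<beta> \<noteq> 0}.
      \<exists>c. c \<noteq> 0 \<and> (\<forall>x\<in>alg_space A. \<forall>y\<in>alg_space A. \<omega> x y = c * \<omega>' x y)"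
      using \<beta> c by blast
  next
    assume "\<exists>\<omega>'\<in>{hform (alg_dim A) (ext_seq \<beta> A) | \<beta>. \<beta> \<noteq> 0}.
      \<exists>c. c \<noteq> 0 \<and> (\<forall>x\<in>alg_space A. \<forall>y\<in>alg_space A. \<omega> x y = c * \<omega>' x y)"
    then obtain \<beta> c where \<beta>: "\<beta> \<noteq> 0" and c: "c \<noteq> 0"
      and \<omega>: "\<forall>x\<in>alg_space A. \<forall>y\<in>alg_space A. \<omega> x y = c * hform (alg_dim A) (ext_seq \<beta> A) x y" by blast
    then show "\<exists>C. closed_seq A C \<and> (\<forall>x\<in>alg_space A. \<forall>y\<in>alg_space A. \<omega> x y = hform (alg_dim A) C x y)"
      using closed_seq_scale[OF closed_ext_seq[OF A(1) \<beta>] c] by (intro exI conjI) (auto simp: hform_scale)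
  qed
qed

section \<open>The one-parameter family of forms on V 6\<close>

definition seq_V6 :: "real \<Rightarrow> nat \<Rightarrow> real" where
  "seq_V6 \<gamma> i = (if i = 1 then 5 else if i = 2 then 3 + \<gamma> else if i = 3 then 1 - 3 * \<gamma>
     else if i = 4 then 3 * \<gamma> - 1 else if i = 5 then - 3 - \<gamma> else - 5)"

lemma form_V6_eq: "form_V6 \<gamma> = hform 6 (seq_V6 \<gamma>)"
proof (intro ext)
  fix x y
  have "hform (2 * 3) (seq_V6 \<gamma>) x y = (\<Sum>i=1..3. seq_V6 \<gamma> i * ee i (2 * 3 + 1 - i) x y)"
  proof (rule hform_half)
    fix i :: nat assume "i \<in> {1..2 * 3}"
    then have "i = 1 \<or> i = 2 \<or> i = 3 \<or> i = 4 \<or> i = 5 \<or> i = 6" by auto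
    then show "seq_V6 \<gamma> (2 * 3 + 1 - i) = - seq_V6 \<gamma> i" by (elim disjE) (simp_all add: seq_V6_def)
  qed
  moreover have "{1..3::nat} = {1,2,3}" by auto
  ultimately show "form_V6 \<gamma> x y = hform 6 (seq_V6 \<gamma>) x y"
    by (simp add: form_V6_def form_V_def seq_V6_def algebra_simps)
qed

text \<open>Only the triple (1, 2, 4) has weight 7, and it imposes one linear relation on the three
  independent coefficients. At \<gamma> = -3 and \<gamma> = 1/3 the second and the third coefficient
  vanish.\<close>

lemma closed_seq_V6:
  assumes "\<gamma> \<noteq> -3" "\<gamma> \<noteq> 1/3"
  shows "closed_seq (V 6) (seq_V6 \<gamma>)"
proof -
  define T where "T = alt (\<lambda>i j. if i + j = 7 then seq_V6 \<gamma> i else real j - real i)"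
  have top: "T i (7 - i) = seq_V6 \<gamma> i" if "1 \<le> i" "i \<le> 6" for i
  proof -
    have "i = 1 \<or> i = 2 \<or> i = 3 \<or> i = 4 \<or> i = 5 \<or> i = 6" using that by auto
    then show ?thesis by (elim disjE) (simp_all add: T_def alt_def seq_V6_def)
  qed
  have "closed_seq (V 6) (\<lambda>i. T i (alg_dim (V 6) + 1 - i))"
  proof (rule closed_seq_of_table)
    show "lie_table (alg_dim (V 6) + 1) T"
    proof (rule lie_tableI)
      show "T j i = - T i j" for i j unfolding T_def by (rule alt_anti)
      fix i j k :: nat assume "1 \<le> i" "i < j" "j < k" "i + j + k \<le> alg_dim (V 6) + 1"
      then have "i = 1 \<and> j = 2 \<and> k = 3 \<or> i = 1 \<and> j = 2 \<and> k = 4" by auto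
      then show "jac T i j k = 0"
        by (elim disjE conjE) (simp_all add: jac_def T_def alt_def seq_V6_def)
    qed
    show "T i j = tab (V 6) i j" if "1 \<le> i" "1 \<le> j" "i + j \<le> alg_dim (V 6)" for i j
      using that by (auto simp: T_def tab_def alt_def)
    fix i assume i: "1 \<le> i" "i \<le> alg_dim (V 6)"
    have "seq_V6 \<gamma> i \<noteq> 0" using assms by (auto simp: seq_V6_def)
    then show "T i (alg_dim (V 6) + 1 - i) \<noteq> 0" using top[of i] i by simp
  qed
  then show ?thesis
    by (rule closed_seq_cong) (use top in auto)
qed

lemma closed_seq_V6_unique:
  assumes C: "closed_seq (V 6) C"
  shows "\<exists>\<gamma> c. \<gamma> \<noteq> -3 \<and> \<gamma> \<noteq> 1/3 \<and> c \<noteq> 0 \<and> (\<forall>i\<in>{1..6}. C i = c * seq_V6 \<gamma> i)"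
proof -
  have nz: "C 1 \<noteq> 0" "C 2 \<noteq> 0" "C 3 \<noteq> 0" and flip: "C 6 = - C 1" "C 5 = - C 2" "C 4 = - C 3"
  proof -
    have *: "C i \<noteq> 0" "C (7 - i) = - C i" if "i \<in> {1..6}" for i
      using C that unfolding closed_seq_def by auto
    show "C 1 \<noteq> 0" "C 2 \<noteq> 0" "C 3 \<noteq> 0" "C 6 = - C 1" "C 5 = - C 2" "C 4 = - C 3"
      using *[of 1] *[of 2] *[of 3] by simp_all
  qed
  have "tab (V 6) 2 4 * C 1 + tab (V 6) 4 1 * C 2 + tab (V 6) 1 2 * C 4 = 0"
    using C unfolding closed_seq_def by simp
  then have C3: "C 3 = 2 * C 1 - 3 * C 2"
    using flip by (simp add: tab_def alt_def)
  define c where "c = C 1 / 5"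
  define \<gamma> where "\<gamma> = C 2 / c - 3"
  have c: "c \<noteq> 0" "C 1 = 5 * c" using nz by (simp_all add: c_def)
  have 2: "C 2 = c * (3 + \<gamma>)" using c by (simp add: \<gamma>_def)
  have 3: "C 3 = c * (1 - 3 * \<gamma>)" unfolding C3 2 c(2) by (simp add: algebra_simps)
  have "\<gamma> \<noteq> -3" "\<gamma> \<noteq> 1/3" using nz 2 3 by auto
  moreover have "C i = c * seq_V6 \<gamma> i" if "i \<in> {1..6}" for i
  proof -
    have "i = 1 \<or> i = 2 \<or> i = 3 \<or> i = 4 \<or> i = 5 \<or> i = 6" using that by auto
    then show ?thesis
      using flip c(2) 2 3 by (elim disjE) (simp_all add: seq_V6_def algebra_simps)
  qed
  ultimately show ?thesis using c(1) by blast
qed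

theorem homogeneous_symplectic_V6:
  "homogeneous_symplectic (V 6) \<omega> \<longleftrightarrow>
    (\<exists>\<gamma>. \<gamma> \<noteq> -3 \<and> \<gamma> \<noteq> 1/3 \<and> proportional (V 6) \<omega> (form_V6 \<gamma>))"
proof -
  have n: "1 \<le> alg_dim (V 6)" by simp
  have six: "alg_dim (V 6) = 6" by simp
  show ?thesis
    unfolding homogeneous_symplectic_iff[OF n] form_V6_eq proportional_def six
  proof
    assume "\<exists>C. closed_seq (V 6) C \<and> (\<forall>x\<in>alg_space (V 6). \<forall>y\<in>alg_space (V 6). \<omega> x y = hform 6 C x y)"
    then obtain C where C: "closed_seq (V 6) C"
      and \<omega>: "\<And>x y. x \<in> alg_space (V 6) \<Longrightarrow> y \<in> alg_space (V 6) \<Longrightarrow> \<omega> x y = hform 6 C x y" by blast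
    obtain \<gamma> c where \<gamma>: "\<gamma> \<noteq> -3" "\<gamma> \<noteq> 1/3" and c: "c \<noteq> 0" and eq: "\<forall>i\<in>{1..6}. C i = c * seq_V6 \<gamma> i"
      using closed_seq_V6_unique[OF C] by blast
    have "hform 6 C = hform 6 (\<lambda>i. c * seq_V6 \<gamma> i)"
      by (rule hform_cong) (use eq in auto)
    then have "\<omega> x y = c * hform 6 (seq_V6 \<gamma>) x y" if "x \<in> alg_space (V 6)" "y \<in> alg_space (V 6)" for x y
      using \<omega>[OF that] by (simp add: hform_scale)
    then show "\<exists>\<gamma>. \<gamma> \<noteq> -3 \<and> \<gamma> \<noteq> 1/3 \<and> (\<exists>c. c \<noteq> 0 \<and>
        (\<forall>x\<in>alg_space (V 6). \<forall>y\<in>alg_space (V 6). \<omega> x y = c * hform 6 (seq_V6 \<gamma>) x y))"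
      using \<gamma> c by blast
  next
    assume "\<exists>\<gamma>. \<gamma> \<noteq> -3 \<and> \<gamma> \<noteq> 1/3 \<and> (\<exists>c. c \<noteq> 0 \<and>
        (\<forall>x\<in>alg_space (V 6). \<forall>y\<in>alg_space (V 6). \<omega> x y = c * hform 6 (seq_V6 \<gamma>) x y))"
    then obtain \<gamma> c where \<gamma>: "\<gamma> \<noteq> -3" "\<gamma> \<noteq> 1/3" and c: "c \<noteq> 0"
      and \<omega>: "\<forall>x\<in>alg_space (V 6). \<forall>y\<in>alg_space (V 6). \<omega> x y = c * hform 6 (seq_V6 \<gamma>) x y" by blast
    then show "\<exists>C. closed_seq (V 6) C \<and> (\<forall>x\<in>alg_space (V 6). \<forall>y\<in>alg_space (V 6). \<omega> x y = hform 6 C x y)"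
      using closed_seq_scale[OF closed_seq_V6[OF \<gamma>] c] by (intro exI conjI) (auto simp: hform_scale)
  qed
qed

lemma listed_forms_symplectic:
  assumes "A \<in> symplectic_list" "\<omega> \<in> listed_forms A"
  shows "homogeneous A (alg_dim A + 1) \<omega>" "symplectic_form (alg_space A) (alg_bracket A) \<omega>"
proof -
  obtain \<beta> where \<beta>: "\<beta> \<noteq> 0" and \<omega>: "\<omega> = hform (alg_dim A) (ext_seq \<beta> A)"
    using assms listed_forms_eq by blast
  show "homogeneous A (alg_dim A + 1) \<omega>"
    by (rule homogeneous_hform[of A "ext_seq \<beta> A"]) (use ext_seq_flip \<omega> in auto)
  show "symplectic_form (alg_space A) (alg_bracket A) \<omega>"
    unfolding \<omega> by (rule symplectic_hform[OF closed_ext_seq[OF assms(1) \<beta>]])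
qed

lemma symplectic_listed:
  assumes "A \<in> symplectic_list"
  shows "symplectic (alg_space A) (alg_bracket A)"
  unfolding symplectic_def
  using symplectic_hform[OF closed_ext_seq[OF assms, of 1]] by auto

section \<open>Non-isomorphism\<close>

lemma inj_evec: "inj evec"
  by (rule injI) (metis lookup_evec zero_neq_one)

lemma independent_evec: "independent (evec ` {1..n})"
proof (rule independent_if_scalars_zero)
  fix f :: "fsupp \<Rightarrow> real" and x
  assume s: "(\<Sum>x\<in>evec ` {1..n}. f x *\<^sub>R x) = 0" and "x \<in> evec ` {1..n}"
  then obtain i where i: "i \<in> {1..n}" "x = evec i" by blast
  have "(\<Sum>k=1..n. f (evec k) *\<^sub>R evec k) = 0"
    using s by (simp add: sum.reindex[OF inj_on_subset[OF inj_evec]] o_def)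
  then have "0 = coord (\<Sum>k=1..n. f (evec k) *\<^sub>R evec k) i"
    by simp
  also have "\<dots> = (\<Sum>k=1..n. if k = i then f (evec i) else 0)"
    unfolding lookup_sum by (rule sum.cong) (auto simp: lookup_evec)
  finally show "f x = 0" using i by simp
qed simp

lemma card_evec: "card (evec ` {1..n}) = n"
  by (simp add: card_image[OF inj_on_subset[OF inj_evec]])

lemma dim_alg_space: "dim (alg_space A) = alg_dim A"
  unfolding alg_space_def by (metis card_evec dim_eq_card_independent dim_span independent_evec)

lemma lookup_alg_bracket:
  assumes xy: "x \<in> alg_space A" "y \<in> alg_space A" and m: "1 \<le> m" "m \<le> alg_dim A"
  shows "coord (alg_bracket A x y) m =
    (\<Sum>p=1..m-1. tab A p (m - p) * coord x p * coord y (m - p))"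
proof (rule bilinear_eq_on_evec[where n = "alg_dim A"])
  show "linear (\<lambda>x. coord (alg_bracket A x y) m)"
    "linear (\<lambda>x. coord (alg_bracket A y x) m)" for y
    using linear_compose[OF linear_alg_bracket(1) linear_lookup]
      linear_compose[OF linear_alg_bracket(2) linear_lookup] by (auto simp: o_def)
  show "linear (\<lambda>x. \<Sum>p=1..m-1. tab A p (m - p) * coord x p * coord y (m - p))" for y
    by (rule linearI) (simp_all add: lookup_add sum.distrib sum_distrib_left algebra_simps)
  show "linear (\<lambda>y. \<Sum>p=1..m-1. tab A p (m - p) * coord x p * coord y (m - p))" for x
    by (rule linearI) (simp_all add: lookup_add sum.distrib sum_distrib_left algebra_simps)
  fix i j assume ij: "i \<in> {1..alg_dim A}" "j \<in> {1..alg_dim A}"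
  have "(\<Sum>p=1..m-1. tab A p (m - p) * coord (evec i) p * coord (evec j) (m - p))
    = (\<Sum>p=1..m-1. if p = i then (if i + j = m then tab A i j else 0) else 0)"
    by (rule sum.cong) (auto simp: lookup_evec)
  also have "\<dots> = (if i + j = m then tab A i j else 0)" using ij by auto
  finally show "coord (alg_bracket A (evec i) (evec j)) m =
    (\<Sum>p=1..m-1. tab A p (m - p) * coord (evec i) p * coord (evec j) (m - p))"
    using ij m by (auto simp: alg_bracket_evec lookup_evec)
qed (use xy in \<open>auto simp: alg_space_def\<close>)

text \<open>An isomorphism need not respect the gradings, but it respects the filtrations by the
  subspaces spanned by \<open>evec i, evec (i + 1), \<dots>\<close>, so its diagonal part is an isomorphism too.\<close>

lemma lie_iso_diagonal:
  assumes A: "A \<in> symplectic_list" and B: "B \<in> symplectic_list"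
    and f: "lie_iso f (alg_space A) (alg_bracket A) (alg_space B) (alg_bracket B)"
  shows "alg_dim A = alg_dim B"
    and "\<exists>lam. (\<forall>i\<in>{1..alg_dim A}. lam i \<noteq> 0) \<and> (\<forall>i j. 1 \<le> i \<and> i < j \<and> i + j \<le> alg_dim A \<longrightarrow>
      tab A i j * lam (i + j) = tab B i j * lam i * lam j)"
proof -
  have lin: "linear f" and bij: "bij_betw f (alg_space A) (alg_space B)"
    and hom: "\<And>x y. \<lbrakk>x \<in> alg_space A; y \<in> alg_space A\<rbrakk> \<Longrightarrow> f (alg_bracket A x y) = alg_bracket B (f x) (f y)"
    using f unfolding lie_iso_def by auto
  have inj: "inj_on f (alg_space A)" and img: "f ` alg_space A = alg_space B"
    using bij by (auto simp: bij_betw_def)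
  have "independent (f ` evec ` {1..alg_dim A})"
    by (rule linear_independent_injective_image[OF lin independent_evec])
      (use inj in \<open>simp add: alg_space_def\<close>)
  moreover have "span (f ` evec ` {1..alg_dim A}) = alg_space B"
    using img linear_span_image[OF lin] by (simp add: alg_space_def)
  moreover have "card (f ` evec ` {1..alg_dim A}) = alg_dim A"
  proof -
    have "inj_on f (evec ` {1..alg_dim A})"
      by (rule inj_on_subset[OF inj]) (simp add: alg_space_def span_superset)
    from card_image[OF this] show ?thesis by (simp only: card_evec)
  qed
  ultimately have "dim (alg_space B) = alg_dim A"
    using dim_eq_card_independent dim_span by metis
  then show dims: "alg_dim A = alg_dim B" by (simp add: dim_alg_space)
  define n where "n = alg_dim A"
  have n4: "4 \<le> n" using alg_dim_even(2)[OF A] by (simp add: n_def)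
  have nB: "alg_dim B = n" using dims by (simp add: n_def)
  define F where "F i m = coord (f (evec i)) m" for i m
  have fin: "f (evec i) \<in> alg_space B" if "1 \<le> i" "i \<le> n" for i
    using img evec_in_alg_space[of i A] that by (auto simp: n_def)
  have key: "tab A i j * F (i + j) m = (\<Sum>p=1..m-1. tab B p (m - p) * F i p * F j (m - p))"
    if ij: "1 \<le> i" "1 \<le> j" "i + j \<le> n" and m: "1 \<le> m" "m \<le> n" for i j m
  proof -
    have "f (alg_bracket A (evec i) (evec j)) = alg_bracket B (f (evec i)) (f (evec j))"
      by (rule hom; rule evec_in_alg_space) (use ij in \<open>auto simp: n_def\<close>)
    then have "tab A i j *\<^sub>R f (evec (i + j)) = alg_bracket B (f (evec i)) (f (evec j))"
      using ij by (simp add: alg_bracket_evec linear_scale[OF lin] n_def)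
    then have "tab A i j * F (i + j) m = coord (alg_bracket B (f (evec i)) (f (evec j))) m"
      unfolding F_def by (metis lookup_scaleR real_scaleR_def)
    then show ?thesis
      using lookup_alg_bracket[OF fin fin, of i j m] ij m nB by (simp add: F_def)
  qed
  have A1: "tab A 1 i \<noteq> 0" and B1: "tab B 1 i \<noteq> 0" if "2 \<le> i" "i < n" for i
    using tab_first_nonzero[OF A, of i] tab_first_nonzero[OF B, of i] that nB by (auto simp: n_def)
  have self: "tab B i i = 0" for i using tab_anti[of B i i] by simp
  \<comment> \<open>From degree 3 on the basis vectors are multiples of brackets with e_1, so images
    lie in the filtration step of their degree. Coordinate 2 of the image of e_3 vanishes because
    \<open>tab B 1 1 = 0\<close>.\<close>
  have low: "F i m = 0" if "3 \<le> i" "i \<le> n" "1 \<le> m" "m < i" for i m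
    using that
  proof (induction i arbitrary: m rule: nat_induct_at_least)
    case base
    have "tab A 1 2 * F 3 m = (\<Sum>p=1..m-1. tab B p (m - p) * F 1 p * F 2 (m - p))"
      using key[of 1 2 m] base by (simp add: numeral_3_eq_3)
    also have "\<dots> = 0"
    proof (rule sum.neutral, rule ballI)
      fix p assume "p \<in> {1..m-1}"
      then have "p = 1" "m - p = 1" using base by auto
      then show "tab B p (m - p) * F 1 p * F 2 (m - p) = 0" using self by simp
    qed
    finally show ?case using A1[of 2] n4 by simp
  next
    case (Suc i)
    have "tab A 1 i * F (1 + i) m = (\<Sum>p=1..m-1. tab B p (m - p) * F 1 p * F i (m - p))"
      using key[of 1 i m] Suc by simp
    also have "\<dots> = 0"
      by (rule sum.neutral) (use Suc in auto)
    finally show ?case using A1[of i] Suc by simp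
  qed
  define lam where "lam i = F i i" for i
  have lam_step: "tab A 1 i * lam (i + 1) = tab B 1 i * lam 1 * lam i" if i: "3 \<le> i" "i < n" for i
  proof -
    have "tab A 1 i * F (1 + i) (i + 1) = (\<Sum>p=1..i+1-1. tab B p (i + 1 - p) * F 1 p * F i (i + 1 - p))"
      using key[of 1 i "i + 1"] i by simp
    also have "\<dots> = (\<Sum>p=1..i+1-1. if p = 1 then tab B 1 i * F 1 1 * F i i else 0)"
      by (rule sum.cong) (use low[of i] i in auto)
    also have "\<dots> = tab B 1 i * F 1 1 * F i i" using i by simp
    finally show ?thesis by (simp add: lam_def)
  qed
  \<comment> \<open>The image of e_n is \<open>lam n\<close> times e_n, so injectivity makes
    \<open>lam n\<close> non-zero; \<open>lam_step\<close> carries this down to degree 3.\<close>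
  have "lam n \<noteq> 0"
  proof
    assume z: "lam n = 0"
    have "coord (f (evec n)) m = 0" for m
    proof (cases "1 \<le> m \<and> m \<le> n")
      case True
      then show ?thesis using low[of n m] z n4 by (cases "m = n") (auto simp: lam_def F_def)
    next
      case False
      then show ?thesis
        using span_evecD(1)[of "f (evec n)" n m] fin[of n] n4 nB by (auto simp: alg_space_def)
    qed
    then have "f (evec n) = 0" by (intro poly_mapping_eqI) simp
    moreover have "f 0 = 0" by (rule linear_0[OF lin])
    moreover have "evec n \<in> alg_space A" "0 \<in> alg_space A"
      using evec_in_alg_space[of n A] n4 subspace_0[OF subspace_alg_space] by (auto simp: n_def)
    ultimately have "evec n = 0" using inj unfolding inj_on_def by metis
    then show False using evec_nonzero by simp
  qed
  have lam3: "lam i \<noteq> 0" if "3 \<le> i" "i \<le> n" for i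
    using that(2,1)
  proof (induction i rule: inc_induct)
    case base
    show ?case using \<open>lam n \<noteq> 0\<close> .
  next
    case (step i)
    then show ?case using lam_step[of i] A1[of i] by auto
  qed
  have lam1: "lam 1 \<noteq> 0"
    using lam_step[of 3] lam3[of 4] A1[of 3] n4 by auto
  \<comment> \<open>e_2 is not a bracket, so it needs an argument of its own. The image of
    \<open>[e2, e3]\<close> has no coordinate 4, while the bracket of the images has
    \<open>tab B 1 3 * F 2 1 * F 3 3\<close> there. In dimension 4 the bracket is zero and
    \<open>key\<close> does not cover it.\<close>
  have F21: "F 2 1 = 0"
  proof -
    have "(\<Sum>p=1..(4::nat)-1. tab B p (4 - p) * F 2 p * F 3 (4 - p)) = 0"
    proof (cases "5 \<le> n")
      case True
      then show ?thesis using key[of 2 3 4] low[of 5 4] by simp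
    next
      case False
      have "f (alg_bracket A (evec 2) (evec 3)) = alg_bracket B (f (evec 2)) (f (evec 3))"
        by (rule hom; rule evec_in_alg_space) (use n4 in \<open>auto simp: n_def\<close>)
      moreover have "alg_bracket A (evec 2) (evec 3) = 0"
        using False by (simp add: alg_bracket_evec n_def)
      ultimately have "alg_bracket B (f (evec 2)) (f (evec 3)) = 0"
        using linear_0[OF lin] by simp
      then show ?thesis
        using lookup_alg_bracket[OF fin fin, of 2 3 4] n4 nB by (simp add: F_def)
    qed
    also have "(\<Sum>p=1..(4::nat)-1. tab B p (4 - p) * F 2 p * F 3 (4 - p))
      = (\<Sum>p=1..(4::nat)-1. if p = 1 then tab B 1 3 * F 2 1 * F 3 3 else 0)"
      by (rule sum.cong) (use low[of 3] n4 in auto)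
    finally have "tab B 1 3 * F 2 1 * F 3 3 = 0" by simp
    then show ?thesis using B1[of 3] lam3[of 3] n4 by (auto simp: lam_def)
  qed
  have low2: "F i m = 0" if "2 \<le> i" "i \<le> n" "1 \<le> m" "m < i" for i m
    using low[of i m] F21 that by (cases "i = 2"; cases "m = 1") auto
  \<comment> \<open>In coordinate \<open>i + j\<close> the filtration leaves only the product of the
    two diagonal entries.\<close>
  have rel: "tab A i j * lam (i + j) = tab B i j * lam i * lam j" if ij: "1 \<le> i" "i < j" "i + j \<le> n" for i j
  proof -
    have "tab A i j * F (i + j) (i + j) = (\<Sum>p=1..i+j-1. tab B p (i + j - p) * F i p * F j (i + j - p))"
      by (rule key) (use ij in auto)
    also have "\<dots> = (\<Sum>p=1..i+j-1. if p = i then tab B i j * F i i * F j j else 0)"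
    proof (rule sum.cong)
      fix p assume p: "p \<in> {1..i+j-1}"
      consider "p = i" | "p < i" | "i < p" by linarith
      then show "tab B p (i + j - p) * F i p * F j (i + j - p) = (if p = i then tab B i j * F i i * F j j else 0)"
      proof cases
        case 2
        then have "F i p = 0" using p ij by (intro low2) auto
        then show ?thesis using 2 by simp
      next
        case 3
        then have "F j (i + j - p) = 0" using p ij by (intro low2) auto
        then show ?thesis using 3 by simp
      qed simp
    qed simp
    also have "\<dots> = tab B i j * F i i * F j j" using ij by simp
    finally show ?thesis by (simp add: lam_def)
  qed
  have lam2: "lam 2 \<noteq> 0"
    using rel[of 1 2] A1[of 2] lam3[of 3] n4 by (auto simp: numeral_3_eq_3)
  have "lam i \<noteq> 0" if "i \<in> {1..n}" for i
  proof -
    have "i = 1 \<or> i = 2 \<or> 3 \<le> i" using that by auto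
    then show ?thesis using lam1 lam2 lam3[of i] that by auto
  qed
  then show "\<exists>lam. (\<forall>i\<in>{1..alg_dim A}. lam i \<noteq> 0) \<and> (\<forall>i j. 1 \<le> i \<and> i < j \<and> i + j \<le> alg_dim A \<longrightarrow>
      tab A i j * lam (i + j) = tab B i j * lam i * lam j)"
    using rel unfolding n_def by blast
qed

text \<open>The relations with e_1 express \<open>lam 3\<close>, ..., \<open>lam 7\<close> through
  \<open>lam 1\<close> and \<open>lam 2\<close>, and \<open>[e3, e4] = e7\<close> forces
  \<open>lam 2 = lam 1 ^ 2\<close>. Both sides of the relation for \<open>[e2, e3]\<close> then
  carry the factor \<open>lam 1 ^ 5\<close>.\<close>

lemma lie_iso_G_parameter:
  assumes lam: "\<And>i. i \<in> {1..8} \<Longrightarrow> lam i \<noteq> (0::real)"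
    and rel: "\<And>i j. \<lbrakk>1 \<le> i; i < j; i + j \<le> 8\<rbrakk> \<Longrightarrow> table_G \<alpha> i j * lam (i + j) = table_G \<alpha>' i j * lam i * lam j"
  shows "\<alpha> = \<alpha>'"
proof -
  have l3: "lam 3 = lam 1 * lam 2" using rel[of 1 2] by (simp add: table_G_values numeral_3_eq_3)
  have l4: "lam 4 = lam 1 * lam 3" using rel[of 1 3] by (simp add: table_G_values)
  have l5: "lam 5 = lam 1 * lam 4" using rel[of 1 4] by (simp add: table_G_values)
  have l6: "lam 6 = lam 1 * lam 5" using rel[of 1 5] by (simp add: table_G_values)
  have l7: "lam 7 = lam 1 * lam 6" using rel[of 1 6] by (simp add: table_G_values)
  have "lam 7 = lam 3 * lam 4" using rel[of 3 4] by (simp add: table_G_values)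
  then have "(lam 1 ^ 3 * lam 2) * (lam 1 ^ 2) = (lam 1 ^ 3 * lam 2) * lam 2"
    unfolding l7 l6 l5 l4 l3 by (simp add: power2_eq_square power3_eq_cube algebra_simps)
  then have l2: "lam 2 = lam 1 ^ 2" using lam[of 1] lam[of 2] by simp
  have "(2 + \<alpha>) * lam 5 = (2 + \<alpha>') * lam 2 * lam 3" using rel[of 2 3] by (simp add: table_G_values)
  then have "(2 + \<alpha>) * lam 1 ^ 5 = (2 + \<alpha>') * lam 1 ^ 5"
    unfolding l5 l4 l3 l2 by (simp add: power_numeral_reduce algebra_simps)
  then show ?thesis using lam[of 1] by simp
qed

text \<open>A diagonal isomorphism preserves which structure constants vanish. In equal dimension
  (2, 3) separates \<open>M0\<close> from \<open>V\<close>, and (3, 4) separates it from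
  \<open>G8\<close> and \<open>G10\<close>; the dimensions of \<open>V\<close>, 6 or at least 12,
  never meet 8 and 10.\<close>

theorem not_lie_iso_listed:
  assumes A: "A \<in> symplectic_list" and B: "B \<in> symplectic_list" and ne: "A \<noteq> B"
  shows "\<not> lie_iso f (alg_space A) (alg_bracket A) (alg_space B) (alg_bracket B)"
proof
  assume f: "lie_iso f (alg_space A) (alg_bracket A) (alg_space B) (alg_bracket B)"
  have dims: "alg_dim A = alg_dim B" by (rule lie_iso_diagonal(1)[OF A B f])
  obtain lam where lam: "\<And>i. i \<in> {1..alg_dim A} \<Longrightarrow> lam i \<noteq> 0"
    and rel: "\<And>i j. \<lbrakk>1 \<le> i; i < j; i + j \<le> alg_dim A\<rbrakk> \<Longrightarrow> tab A i j * lam (i + j) = tab B i j * lam i * lam j"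
    using lie_iso_diagonal(2)[OF A B f] by blast
  have zero: "tab A i j = 0 \<longleftrightarrow> tab B i j = 0" if "1 \<le> i" "i < j" "i + j \<le> alg_dim A" for i j
    using rel[OF that] lam[of i] lam[of j] lam[of "i + j"] that by auto
  have tabG: "tab (G8 \<alpha>) i j = table_G \<alpha> i j" "tab (G10 \<alpha>) i j = table_G \<alpha> i j"
    if "1 \<le> i" "i < j" "i + j \<le> 8" for \<alpha> i j
    using that table_G_struct_const[of i j \<alpha>] by (simp_all add: tab_eq del: struct_const.simps)
  have zM: "tab (M0 m) i j = 0" if "2 \<le> i" "i < j" for m i j
    using that by (simp add: tab_eq)
  have nzV: "tab (V m) i j \<noteq> 0" if "i < j" for m i j
    using that by (simp add: tab_eq)
  have nzG: "tab (G8 \<alpha>) 3 4 \<noteq> 0" "tab (G10 \<alpha>) 3 4 \<noteq> 0" for \<alpha>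
    by (simp_all add: tabG table_G_values)
  have par8: "\<alpha> = \<alpha>'" if "A = G8 \<alpha>" "B = G8 \<alpha>'" for \<alpha> \<alpha>'
  proof (rule lie_iso_G_parameter[of lam])
    show "table_G \<alpha> i j * lam (i + j) = table_G \<alpha>' i j * lam i * lam j" if "1 \<le> i" "i < j" "i + j \<le> 8" for i j
      using rel[of i j] tabG(1)[OF that] \<open>A = _\<close> \<open>B = _\<close> that by simp
  qed (use lam that in simp)
  have par10: "\<alpha> = \<alpha>'" if "A = G10 \<alpha>" "B = G10 \<alpha>'" for \<alpha> \<alpha>'
  proof (rule lie_iso_G_parameter[of lam])
    show "table_G \<alpha> i j * lam (i + j) = table_G \<alpha>' i j * lam i * lam j" if "1 \<le> i" "i < j" "i + j \<le> 8" for i j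
      using rel[of i j] tabG(2)[OF that] \<open>A = _\<close> \<open>B = _\<close> that by simp
  qed (use lam that in simp)
  have z23: "tab A 2 3 = 0 \<longleftrightarrow> tab B 2 3 = 0" if "5 \<le> alg_dim A" using zero[of 2 3] that by simp
  have z34: "tab A 3 4 = 0 \<longleftrightarrow> tab B 3 4 = 0" if "7 \<le> alg_dim A" using zero[of 3 4] that by simp
  show False
    using A
  proof (cases rule: symplectic_list_cases)
    case a: (M0 k)
    show ?thesis
      using B
    proof (cases rule: symplectic_list_cases)
      case (M0 l)
      then show ?thesis using a dims ne by simp
    next
      case (V l)
      then show ?thesis using a dims z23 zM[of 2 3] nzV[of 2 3] by auto
    next
      case (G8 \<alpha>)
      then show ?thesis using a dims z34 zM[of 3 4] nzG by auto
    next
      case (G10 \<alpha>)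
      then show ?thesis using a dims z34 zM[of 3 4] nzG by auto
    qed
  next
    case a: (V k)
    show ?thesis
      using B
    proof (cases rule: symplectic_list_cases)
      case (M0 l)
      then show ?thesis using a dims z23 zM[of 2 3] nzV[of 2 3] by auto
    next
      case (V l)
      then show ?thesis using a dims ne by simp
    qed (use a dims in auto)
  next
    case a: (G8 \<alpha>)
    show ?thesis
      using B
    proof (cases rule: symplectic_list_cases)
      case (M0 l)
      then show ?thesis using a dims z34 zM[of 3 4] nzG by auto
    next
      case (G8 \<alpha>')
      then show ?thesis using par8[OF a(1) G8(1)] a(1) ne by simp
    qed (use a dims in auto)
  next
    case a: (G10 \<alpha>)
    show ?thesis
      using B
    proof (cases rule: symplectic_list_cases)
      case (M0 l)
      then show ?thesis using a dims z34 zM[of 3 4] nzG by auto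
    next
      case (G10 \<alpha>')
      then show ?thesis using par10[OF a(1) G10(1)] a(1) ne by simp
    qed (use a dims in auto)
  qed
qed

section \<open>From symplectic graded filiform algebras to tables\<close>

lemma underdetermined:
  fixes w :: "'i \<Rightarrow> 'j \<Rightarrow> real"
  assumes "finite J" "finite I" "card J < card I"
  shows "\<exists>c. (\<exists>i\<in>I. c i \<noteq> 0) \<and> (\<forall>j\<in>J. (\<Sum>i\<in>I. c i * w i j) = 0)"
  using assms
proof (induction J arbitrary: I w rule: finite_induct)
  case empty
  then have "I \<noteq> {}" by auto
  then show ?case by (intro exI[of _ "\<lambda>_. 1"]) auto
next
  case (insert j J)
  show ?case
  proof (cases "\<forall>i\<in>I. w i j = 0")
    case True
    have "card J < card I" using insert by simp
    then obtain c where "\<exists>i\<in>I. c i \<noteq> 0" "\<forall>j\<in>J. (\<Sum>i\<in>I. c i * w i j) = 0"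
      using insert.IH[of I w] insert.prems by blast
    then show ?thesis using True by (intro exI[of _ c]) auto
  next
    case False
    then obtain p where p: "p \<in> I" "w p j \<noteq> 0" by blast
    \<comment> \<open>Gaussian elimination with pivot \<open>p\<close>: equation \<open>j\<close> is
      solved for the unknown \<open>p\<close>, and \<open>w'\<close> is the system left for the
      others.\<close>
    define w' where "w' i l = w i l - w i j / w p j * w p l" for i l
    have "card J < card (I - {p})" using insert p by simp
    then obtain c where c: "\<exists>i\<in>I - {p}. c i \<noteq> 0" "\<forall>l\<in>J. (\<Sum>i\<in>I - {p}. c i * w' i l) = 0"
      using insert.IH[of "I - {p}" w'] insert.prems by blast
    define d where "d i = (if i = p then - (\<Sum>i\<in>I - {p}. c i * w i j) / w p j else c i)" for i
    have s: "(\<Sum>i\<in>I. d i * w i l) = (\<Sum>i\<in>I - {p}. c i * w' i l)" for l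
    proof -
      have "(\<Sum>i\<in>I. d i * w i l) = d p * w p l + (\<Sum>i\<in>I - {p}. d i * w i l)"
        using p insert.prems by (simp add: sum.remove)
      also have "(\<Sum>i\<in>I - {p}. d i * w i l) = (\<Sum>i\<in>I - {p}. c i * w i l)"
        by (rule sum.cong) (auto simp: d_def)
      also have "d p * w p l = - (\<Sum>i\<in>I - {p}. c i * (w i j / w p j * w p l))"
        by (simp add: d_def sum_distrib_right sum_distrib_left sum_divide_distrib algebra_simps)
      finally show ?thesis
        by (simp add: w'_def right_diff_distrib sum_subtractf)
    qed
    have "w' i j = 0" for i using p by (simp add: w'_def)
    then have "\<forall>l\<in>insert j J. (\<Sum>i\<in>I. d i * w i l) = 0" using s c by simp
    moreover have "\<exists>i\<in>I. d i \<noteq> 0" using c by (auto simp: d_def)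
    ultimately show ?thesis by blast
  qed
qed

text \<open>Rows \<open>m\<close> to \<open>n\<close> vanish in all columns from
  \<open>n + 1 - m\<close> on: past the antidiagonal by assumption, and on it the only candidate is
  the given zero. These \<open>n + 1 - m\<close> rows live in \<open>n - m\<close> columns, hence
  are dependent.\<close>

lemma antitriangular_degenerate:
  fixes w :: "nat \<Rightarrow> nat \<Rightarrow> real"
  assumes tri: "\<And>i j. \<lbrakk>i \<in> {1..n}; j \<in> {1..n}; n + 1 < i + j\<rbrakk> \<Longrightarrow> w i j = 0"
    and m: "m \<in> {1..n}" "w m (n + 1 - m) = 0"
  shows "\<exists>c. (\<exists>i\<in>{1..n}. c i \<noteq> 0) \<and> (\<forall>j\<in>{1..n}. (\<Sum>i=1..n. c i * w i j) = 0)"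
proof -
  have "card {1..n - m} < card {m..n}" using m by auto
  then obtain c where c: "\<exists>i\<in>{m..n}. c i \<noteq> 0" "\<forall>j\<in>{1..n - m}. (\<Sum>i\<in>{m..n}. c i * w i j) = 0"
    using underdetermined[of "{1..n - m}" "{m..n}" w] by blast
  define d where "d i = (if m \<le> i then c i else 0)" for i
  have "(\<Sum>i=1..n. d i * w i j) = 0" if j: "j \<in> {1..n}" for j
  proof -
    have "(\<Sum>i=1..n. d i * w i j) = (\<Sum>i\<in>{m..n}. c i * w i j)"
      by (rule sum.mono_neutral_cong_right) (use m in \<open>auto simp: d_def\<close>)
    also have "\<dots> = 0"
    proof (cases "j \<le> n - m")
      case True
      then show ?thesis using c j by auto
    next
      case False
      have "c i * w i j = 0" if i: "i \<in> {m..n}" for i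
      proof (cases "i + j = n + 1")
        case True
        then have "i = m" "j = n + 1 - m" using False i j m by auto
        then show ?thesis using m by simp
      next
        case ne: False
        then have "w i j = 0" using tri[of i j] False i j m by auto
        then show ?thesis by simp
      qed
      then show ?thesis by (rule sum.neutral[OF ballI])
    qed
    finally show ?thesis .
  qed
  moreover have "\<exists>i\<in>{1..n}. d i \<noteq> 0"
  proof -
    obtain i where "i \<in> {m..n}" "c i \<noteq> 0" using c by blast
    then show ?thesis using m by (intro bexI[of _ i]) (auto simp: d_def)
  qed
  ultimately show ?thesis by blast
qed

text \<open>Closedness on the triples \<open>(1, i, j)\<close> forces the matrix of a symplectic form to vanish in
  weights above \<open>n + 1\<close>, up to a single parameter in weight \<open>n + 2\<close> that nondegeneracy kills.\<close>

lemma symplectic_matrix: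
  fixes w :: "nat \<Rightarrow> nat \<Rightarrow> real"
  assumes n: "3 \<le> n"
    and anti: "\<And>i j. w j i = - w i j"
    and closed: "\<And>i j. \<lbrakk>2 \<le> i; i \<le> n; 2 \<le> j; j \<le> n; n < i + j\<rbrakk> \<Longrightarrow> w (i + 1) j + w i (j + 1) = 0"
    and outside: "\<And>j. w (n + 1) j = 0"
    and nd: "\<And>c. \<forall>j\<in>{1..n}. (\<Sum>i=1..n. c i * w i j) = 0 \<Longrightarrow> \<forall>i\<in>{1..n}. c i = 0"
  shows "even n" and "\<And>i. i \<in> {1..n} \<Longrightarrow> w i (n + 1 - i) \<noteq> 0"
proof -
  have self: "w i i = 0" for i using anti[of i i] by simp
  \<comment> \<open>Downward induction along a fixed weight from the zero row \<open>n + 1\<close>.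
    Its first step uses column \<open>v - 1 - n\<close>, which is at least 2 from weight
    \<open>n + 3\<close> on; in weight \<open>n + 2\<close> the entry \<open>w 2 n\<close> stays
    free.\<close>
  have high: "w i j = 0" if ij: "i \<in> {1..n}" "j \<in> {1..n}" "n + 3 \<le> i + j" for i j
  proof -
    define v where "v = i + j"
    have "w k (v - k) = 0" if "k \<le> n + 1" "v - 1 - n \<le> k" for k
      using that
    proof (induction k rule: inc_induct)
      case base
      show ?case by (rule outside)
    next
      case (step k)
      have k: "2 \<le> k" "k \<le> n" "2 \<le> v - 1 - k" "v - 1 - k \<le> n" "n < k + (v - 1 - k)"
        "v - 1 - k + 1 = v - k" "v - Suc k = v - 1 - k" "v - 1 - n \<le> Suc k"
        using step.hyps step.prems ij unfolding v_def by linarith+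
      have "w (k + 1) (v - 1 - k) = 0" using step.IH[OF k(8)] unfolding k(7) by (simp only: Suc_eq_plus1)
      moreover have "w (k + 1) (v - 1 - k) + w k (v - 1 - k + 1) = 0" by (rule closed; fact)
      ultimately show ?case unfolding k(6) by linarith
    qed
    from this[of i] show ?thesis using ij by (simp add: v_def)
  qed
  have mid: "w i (n + 2 - i) = (- 1) ^ i * w 2 n" if "2 \<le> i" "i \<le> n" for i
    using that
  proof (induction i rule: nat_induct_at_least)
    case (Suc i)
    have "w (i + 1) (n + 1 - i) + w i (n + 1 - i + 1) = 0"
      by (rule closed) (use Suc in linarith)+
    moreover have "n + 1 - i + 1 = n + 2 - i" "n + 2 - Suc i = n + 1 - i" using Suc by auto
    ultimately show ?case using Suc by simp
  qed simp
  have tri0: "w i j = 0" if "w 2 n = 0" and ij: "i \<in> {1..n}" "j \<in> {1..n}" "n + 1 < i + j" for i j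
  proof (cases "n + 3 \<le> i + j")
    case False
    then have "j = n + 2 - i" "2 \<le> i" using ij by auto
    then show ?thesis using mid[of i] that by simp
  qed (use high ij in blast)
  have nondeg: "w m (n + 1 - m) \<noteq> 0" if "w 2 n = 0" "m \<in> {1..n}" for m
  proof
    assume z: "w m (n + 1 - m) = 0"
    have "\<exists>c. (\<exists>i\<in>{1..n}. c i \<noteq> 0) \<and> (\<forall>j\<in>{1..n}. (\<Sum>i=1..n. c i * w i j) = 0)"
      by (rule antitriangular_degenerate[where m = m]) (use tri0[OF that(1)] that(2) z in blast)+
    then show False using nd by blast
  qed
  show ev: "even n"
  proof (rule ccontr)
    assume odd: "odd n"
    show False
    proof (cases "w 2 n = 0")
      case True
      have "even (n + 1)" using odd by simp
      then obtain m where m: "n + 1 = 2 * m" by blast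
      have "n + 1 - m = m" "m \<in> {1..n}" using m n by auto
      then show False using nondeg[of m] True self[of m] by simp
    next
      case False
      \<comment> \<open>An antisymmetric matrix of odd size is singular. Some non-zero
        \<open>c\<close> has \<open>S j = 0\<close> for all \<open>j \<ge> 2\<close>. The block on
        2, ..., n is antitriangular with non-zero antidiagonal, so \<open>c 1 \<noteq> 0\<close>.
        The double sum of \<open>c i * c j * w i j\<close> is its own negative, which leaves
        \<open>c 1 * S 1 = 0\<close>.\<close>
      have "card {2..n} < card {1..n}" using n by simp
      then obtain c where c: "\<exists>i\<in>{1..n}. c i \<noteq> 0" "\<forall>j\<in>{2..n}. (\<Sum>i=1..n. c i * w i j) = 0"
        using underdetermined[of "{2..n}" "{1..n}" w] by auto
      define S where "S j = (\<Sum>i=1..n. c i * w i j)" for j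
      have S0: "S j = 0" if "j \<in> {2..n}" for j using c that by (simp add: S_def)
      have "c 1 \<noteq> 0"
      proof
        assume c1: "c 1 = 0"
        define p where "p = (LEAST i. i \<in> {1..n} \<and> c i \<noteq> 0)"
        have "\<exists>i. i \<in> {1..n} \<and> c i \<noteq> 0" using c by blast
        from LeastI_ex[OF this] have p: "p \<in> {1..n}" "c p \<noteq> 0" unfolding p_def by blast+
        have below: "c i = 0" if "i \<in> {1..n}" "i < p" for i
          using not_less_Least[of i "\<lambda>i. i \<in> {1..n} \<and> c i \<noteq> 0"] that unfolding p_def by blast
        have "p \<noteq> 1" using p c1 by metis
        then have p2: "2 \<le> p" using p by auto
        \<comment> \<open>Rows before \<open>p\<close> have coefficient 0, and rows after it meet
          this column in weight at least \<open>n + 3\<close>.\<close>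
        have "S (n + 2 - p) = (\<Sum>i=1..n. if i = p then c p * w p (n + 2 - p) else 0)"
          unfolding S_def
        proof (rule sum.cong)
          fix i assume i: "i \<in> {1..n}"
          consider "i = p" | "i < p" | "p < i" by linarith
          then show "c i * w i (n + 2 - p) = (if i = p then c p * w p (n + 2 - p) else 0)"
          proof cases
            case 2
            then show ?thesis using below[OF i] by simp
          next
            case 3
            have "w i (n + 2 - p) = 0" by (rule high) (use i 3 p2 p in auto)
            then show ?thesis using 3 by simp
          qed simp
        qed simp
        also have "\<dots> = c p * w p (n + 2 - p)" using p by simp
        finally have Sp: "S (n + 2 - p) = c p * w p (n + 2 - p)" .
        have "n + 2 - p \<in> {2..n}" using p p2 by auto
        then have "c p * w p (n + 2 - p) = 0" using S0 Sp by simp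
        then show False using p mid[of p] p2 False by simp
      qed
      have "(\<Sum>j=1..n. c j * S j) = - (\<Sum>j=1..n. c j * S j)"
      proof -
        have "(\<Sum>j=1..n. c j * S j) = (\<Sum>j=1..n. \<Sum>i=1..n. c j * c i * w i j)"
          by (simp add: S_def sum_distrib_left mult.assoc)
        also have "\<dots> = (\<Sum>i=1..n. \<Sum>j=1..n. c j * c i * w i j)" by (rule sum.swap)
        also have "\<dots> = (\<Sum>i=1..n. \<Sum>j=1..n. - (c i * c j * w j i))"
        proof (rule sum.cong[OF refl], rule sum.cong[OF refl])
          fix i j show "c j * c i * w i j = - (c i * c j * w j i)" using anti[of i j] by simp
        qed
        also have "\<dots> = - (\<Sum>j=1..n. c j * S j)"
          by (simp add: S_def sum_distrib_left mult.assoc sum_negf)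
        finally show ?thesis .
      qed
      then have "(\<Sum>j=1..n. c j * S j) = 0" by simp
      moreover have "(\<Sum>j=1..n. c j * S j) = (\<Sum>j=1..n. if j = 1 then c 1 * S 1 else 0)"
        by (rule sum.cong) (use S0 in auto)
      ultimately have "c 1 * S 1 = 0" using n by simp
      then have "S 1 = 0" using \<open>c 1 \<noteq> 0\<close> by simp
      then have "S j = 0" if "j \<in> {1..n}" for j
        using S0[of j] that by (cases "j = 1") auto
      then have "\<forall>j\<in>{1..n}. (\<Sum>i=1..n. c i * w i j) = 0" by (simp add: S_def)
      then show False using nd c by blast
    qed
  qed
  \<comment> \<open>For even \<open>n\<close> the antidiagonal of weight \<open>n + 2\<close>
    crosses the diagonal, which forces \<open>w 2 n = 0\<close>.\<close>
  obtain m where m: "n = 2 * m" using ev by blast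
  have "n + 2 - (m + 1) = m + 1" "2 \<le> m + 1" "m + 1 \<le> n" using m n by auto
  then have "w 2 n = 0" using mid[of "m + 1"] self[of "m + 1"] by simp
  then show "w i (n + 1 - i) \<noteq> 0" if "i \<in> {1..n}" for i
    using nondeg that by blast
qed

section \<open>Adapted bases and the isomorphism\<close>

lemma dim_1_span:
  assumes "subspace S" "dim S = 1" "v \<in> S" "v \<noteq> 0"
  shows "S = span {v}"
proof -
  obtain B where B: "B \<subseteq> S" "S \<subseteq> span B" "card B = dim S" by (rule basis_exists)
  obtain b where b: "B = {b}" using B assms(2) by (auto simp: card_1_singleton_iff)
  obtain k where k: "v = k *\<^sub>R b" using B b assms(3) by (auto simp: span_singleton)
  then have "b = (1 / k) *\<^sub>R v" using assms(4) by auto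
  then have "b \<in> span {v}" by (metis span_base span_scale singletonI)
  then have "span {b} \<subseteq> span {v}" by (intro span_minimal) auto
  moreover have "span {v} \<subseteq> S" using assms by (intro span_minimal) auto
  ultimately show ?thesis using B b by blast
qed

lemma graded_filiformD:
  assumes "graded_filiform n L br g"
  shows "3 \<le> n" "lie_algebra L br"
    and "\<And>i. i \<in> {1..n} \<Longrightarrow> subspace (g i) \<and> g i \<subseteq> L \<and> dim (g i) = 1"
    and "\<And>i. i \<notin> {1..n} \<Longrightarrow> g i = {0}"
    and "\<And>x. x \<in> L \<Longrightarrow> \<exists>!c. (\<forall>i. c i \<in> g i) \<and> x = (\<Sum>i=1..n. c i)"
    and "\<And>i j x y. \<lbrakk>1 \<le> i; 1 \<le> j; x \<in> g i; y \<in> g j\<rbrakk> \<Longrightarrow> br x y \<in> g (i + j)"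
    and "\<And>i. 2 \<le> i \<Longrightarrow> span {br x y | x y. x \<in> g 1 \<and> y \<in> g i} = g (i + 1)"
proof -
  note D = assms[unfolded graded_filiform_def]
  show "3 \<le> n" using D[THEN conjunct1] .
  note D = D[THEN conjunct2]
  show "lie_algebra L br" using D[THEN conjunct1] .
  note D = D[THEN conjunct2]
  show "subspace (g i) \<and> g i \<subseteq> L \<and> dim (g i) = 1" if "i \<in> {1..n}" for i
    using D[THEN conjunct1] that by blast
  note D = D[THEN conjunct2]
  show "g i = {0}" if "i \<notin> {1..n}" for i using D[THEN conjunct1] that by blast
  note D = D[THEN conjunct2]
  show "\<exists>!c. (\<forall>i. c i \<in> g i) \<and> x = (\<Sum>i=1..n. c i)" if "x \<in> L" for x
    using D[THEN conjunct1, rule_format, OF that] .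
  note D = D[THEN conjunct2]
  show "br x y \<in> g (i + j)" if "1 \<le> i" "1 \<le> j" "x \<in> g i" "y \<in> g j" for i j x y
    using D[THEN conjunct1, rule_format, OF that] .
  show "span {br x y | x y. x \<in> g 1 \<and> y \<in> g i} = g (i + 1)" if "2 \<le> i" for i
    using D[THEN conjunct2, rule_format, OF that] .
qed

text \<open>The vector of degree \<open>i + 1\<close> is taken to be \<open>[e1, ei]\<close>. It is
  non-zero because \<open>g 1\<close> and \<open>g i\<close> are lines whose brackets span the
  non-zero \<open>g (i + 1)\<close>.\<close>

lemma graded_filiform_basis:
  assumes "graded_filiform n L br g"
  obtains e where "\<And>i. i \<in> {1..n} \<Longrightarrow> e i \<noteq> 0" "\<And>i. i \<in> {1..n} \<Longrightarrow> g i = span {e i}"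
    and "\<And>i. \<lbrakk>2 \<le> i; i < n\<rbrakk> \<Longrightarrow> br (e 1) (e i) = e (i + 1)"
proof -
  note n = graded_filiformD(1)[OF assms] and lie = graded_filiformD(2)[OF assms]
    and comp = graded_filiformD(3)[OF assms] and grad = graded_filiformD(6)[OF assms]
    and gen = graded_filiformD(7)[OF assms]
  have nz: "\<exists>v\<in>g i. v \<noteq> 0" if "i \<in> {1..n}" for i
  proof (rule ccontr)
    assume "\<not> ?thesis"
    moreover have "0 \<in> g i" using comp[OF that] subspace_0 by blast
    ultimately have "g i = span {}" by (auto simp: span_empty)
    then have "dim (g i) = card ({} :: 'a set)"
      by (metis dim_span dim_eq_card_independent independent_empty)
    then show False using comp[OF that] by simp
  qed
  obtain e1 where e1: "e1 \<in> g 1" "e1 \<noteq> 0" using nz[of 1] n by auto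
  obtain e2 where e2: "e2 \<in> g 2" "e2 \<noteq> 0" using nz[of 2] n by auto
  define e where "e i = (if i = 1 then e1 else (br e1 ^^ (i - 2)) e2)" for i
  have g1: "g 1 = span {e1}" by (rule dim_1_span) (use comp[of 1] e1 n in auto)
  have br_scale: "br (a *\<^sub>R x) (b *\<^sub>R y) = (a * b) *\<^sub>R br x y" if "x \<in> L" "y \<in> L" for a b x y
  proof -
    have bil: "bilinear_on L br" and "subspace L" using lie unfolding lie_algebra_def by auto
    then have "b *\<^sub>R y \<in> L" using that by (simp add: subspace_scale)
    then have "br (a *\<^sub>R x) (b *\<^sub>R y) = a *\<^sub>R br x (b *\<^sub>R y)" using bil that unfolding bilinear_on_def by blast
    also have "br x (b *\<^sub>R y) = b *\<^sub>R br x y" using bil that unfolding bilinear_on_def by blast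
    finally show ?thesis by simp
  qed
  have e: "e i \<in> g i \<and> e i \<noteq> 0" if "2 \<le> i" "i \<le> n" for i
    using that
  proof (induction i rule: nat_induct_at_least)
    case base
    show ?case using e2 by (simp add: e_def)
  next
    case (Suc i)
    have i: "2 \<le> i" "i < n" using Suc by auto
    have IH: "e i \<in> g i" "e i \<noteq> 0" using Suc by auto
    have "Suc i - 2 = Suc (i - 2)" using i by simp
    then have es: "e (Suc i) = br e1 (e i)" using i by (simp add: e_def)
    have gi: "g i = span {e i}" by (rule dim_1_span) (use comp[of i] IH i in auto)
    have "br e1 (e i) \<noteq> 0"
    proof
      assume z: "br e1 (e i) = 0"
      have "br x y = 0" if xy: "x \<in> g 1" "y \<in> g i" for x y
      proof -
        obtain a b where "x = a *\<^sub>R e1" "y = b *\<^sub>R e i"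
          using xy g1 gi by (auto simp: span_singleton)
        moreover have "e1 \<in> L" "e i \<in> L" using e1 IH comp[of 1] comp[of i] i n by auto
        ultimately show ?thesis using br_scale z by simp
      qed
      then have "{br x y | x y. x \<in> g 1 \<and> y \<in> g i} \<subseteq> {0}" by blast
      then have "span {br x y | x y. x \<in> g 1 \<and> y \<in> g i} \<subseteq> span {0}" by (rule span_mono)
      then have "g (i + 1) \<subseteq> {0}" unfolding gen[OF i(1)] by simp
      then show False using nz[of "i + 1"] i by auto
    qed
    moreover have "br e1 (e i) \<in> g (1 + i)" by (rule grad) (use e1 IH i in auto)
    ultimately show ?case using es by simp
  qed
  have e': "e i \<in> g i" "e i \<noteq> 0" if "i \<in> {1..n}" for i
    using e[of i] e1 that by (cases "i = 1"; auto simp: e_def)+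
  show thesis
  proof (rule that)
    show "e i \<noteq> 0" if "i \<in> {1..n}" for i using e' that by blast
    show "g i = span {e i}" if "i \<in> {1..n}" for i
      by (rule dim_1_span) (use comp[OF that] e'[OF that] in auto)
    show "br (e 1) (e i) = e (i + 1)" if "2 \<le> i" "i < n" for i
    proof -
      have "Suc i - 2 = Suc (i - 2)" using that by simp
      then show ?thesis using that by (simp add: e_def)
    qed
  qed
qed

lemma graded_filiform_independent:
  assumes "graded_filiform n L br g"
    and e: "\<And>i. i \<in> {1..n} \<Longrightarrow> e i \<noteq> 0" "\<And>i. i \<in> {1..n} \<Longrightarrow> g i = span {e i}"
  shows "inj_on e {1..n}" "independent (e ` {1..n})" "L = span (e ` {1..n})"
proof -
  note lie = graded_filiformD(2)[OF assms(1)] and comp = graded_filiformD(3)[OF assms(1)]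
    and out = graded_filiformD(4)[OF assms(1)] and dec = graded_filiformD(5)[OF assms(1)]
  have subL: "subspace L" using lie unfolding lie_algebra_def by blast
  have scal: "u i = 0" if s: "(\<Sum>i=1..n. u i *\<^sub>R e i) = 0" and i: "i \<in> {1..n}" for u i
  proof -
    \<comment> \<open>Extended by zero, \<open>c\<close> is a graded decomposition of 0, and
      uniqueness makes it the zero one.\<close>
    define c where "c i = (if i \<in> {1..n} then u i *\<^sub>R e i else 0)" for i
    have "c i \<in> g i" for i
      by (cases "i \<in> {1..n}") (auto simp: c_def e out span_base span_scale)
    moreover have "(\<Sum>i=1..n. c i) = 0" using s by (simp add: c_def)
    moreover have "0 \<in> g i" for i using comp[of i] out[of i] subspace_0 by (cases "i \<in> {1..n}") auto
    ultimately have "c = (\<lambda>i. 0)" using dec[of 0] subspace_0[OF subL] by (metis (no_types, lifting) sum.neutral)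
    then have "u i *\<^sub>R e i = 0" using i by (metis c_def)
    then show ?thesis using e(1)[OF i] by simp
  qed
  show inj: "inj_on e {1..n}"
  proof (rule inj_onI, rule ccontr)
    fix i j assume ij: "i \<in> {1..n}" "j \<in> {1..n}" "e i = e j" "i \<noteq> j"
    have "(\<Sum>k=1..n. ((if k = i then 1 else 0) - (if k = j then 1 else 0)) *\<^sub>R e k) =
      (\<Sum>k=1..n. (if k = i then e i else 0) - (if k = j then e j else 0))"
      by (rule sum.cong) auto
    also have "\<dots> = 0" using ij by (simp add: sum_subtractf)
    finally have "(if i = i then 1 else 0) - (if i = j then 1 else 0) = (0::real)"
      using scal[of "\<lambda>k. (if k = i then 1 else 0) - (if k = j then 1 else 0)" i] ij by blast
    then show False using ij by simp
  qed
  show "independent (e ` {1..n})"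
  proof (rule independent_if_scalars_zero)
    fix f x assume s: "(\<Sum>x\<in>e ` {1..n}. f x *\<^sub>R x) = 0" and "x \<in> e ` {1..n}"
    then obtain i where i: "i \<in> {1..n}" "x = e i" by blast
    have "(\<Sum>i=1..n. f (e i) *\<^sub>R e i) = 0"
      using s unfolding sum.reindex[OF inj] o_def .
    then show "f x = 0" using scal[of "\<lambda>i. f (e i)"] i by blast
  qed simp
  show "L = span (e ` {1..n})"
  proof
    show "span (e ` {1..n}) \<subseteq> L"
    proof (rule span_minimal[OF _ subL])
      have "e i \<in> L" if "i \<in> {1..n}" for i
        using comp[OF that] e(2)[OF that] span_base[of "e i" "{e i}"] by auto
      then show "e ` {1..n} \<subseteq> L" by blast
    qed
    show "L \<subseteq> span (e ` {1..n})"
    proof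
      fix x assume "x \<in> L"
      then obtain c where c: "\<forall>i. c i \<in> g i" "x = (\<Sum>i=1..n. c i)" using dec by blast
      have "c i \<in> span (e ` {1..n})" if "i \<in> {1..n}" for i
      proof -
        have "c i \<in> span {e i}" using c e(2)[OF that] by blast
        also have "\<dots> \<subseteq> span (e ` {1..n})" by (rule span_mono) (use that in auto)
        finally show ?thesis .
      qed
      then show "x \<in> span (e ` {1..n})" unfolding c(2) by (rule span_sum)
    qed
  qed
qed

text \<open>\<open>br\<close> is bilinear on \<open>L\<close> only, so it is not a linear map in
  either argument. Instead the vectors satisfying the identity are shown to form a subspace that
  contains the basis, one argument at a time.\<close>

lemma linear_hom_on_span:
  fixes f :: "'a::real_vector \<Rightarrow> fsupp"
  assumes lin: "linear f" and L: "L = span (e ` {1..n})" and bil: "bilinear_on L br"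
    and basis: "\<And>i j. \<lbrakk>i \<in> {1..n}; j \<in> {1..n}\<rbrakk> \<Longrightarrow> f (br (e i) (e j)) = alg_bracket A (f (e i)) (f (e j))"
    and x: "x \<in> L" and y: "y \<in> L"
  shows "f (br x y) = alg_bracket A (f x) (f y)"
proof -
  have sub: "subspace L" unfolding L by (rule subspace_span)
  have eL: "e i \<in> L" if "i \<in> {1..n}" for i using that unfolding L by (auto intro: span_base)
  have addl: "br (u + v) z = br u z + br v z" and addr: "br z (u + v) = br z u + br z v"
    if "u \<in> L" "v \<in> L" "z \<in> L" for u v z
    using bil that unfolding bilinear_on_def by blast+
  have scl: "br (c *\<^sub>R u) z = c *\<^sub>R br u z" and scr: "br z (c *\<^sub>R u) = c *\<^sub>R br z u"
    if "u \<in> L" "z \<in> L" for u z c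
    using bil that unfolding bilinear_on_def by blast+
  have 0: "0 \<in> L" by (rule subspace_0[OF sub])
  note lb = linear_alg_bracket[of A]
  note simps = linear_add[OF lin] linear_scale[OF lin] linear_0[OF lin] linear_add[OF lb(1)] linear_add[OF lb(2)]
    linear_scale[OF lb(1)] linear_scale[OF lb(2)] linear_0[OF lb(1)] linear_0[OF lb(2)]
  have 1: "f (br (e i) y) = alg_bracket A (f (e i)) (f y)" if i: "i \<in> {1..n}" for i
  proof -
    let ?S = "{y \<in> L. f (br (e i) y) = alg_bracket A (f (e i)) (f y)}"
    have "br (e i) 0 = 0" using scr[of 0 "e i" 0] eL[OF i] 0 by simp
    then have "subspace ?S"
      using sub eL[OF i] unfolding subspace_def by (auto simp: addr scr simps)
    moreover have "e ` {1..n} \<subseteq> ?S" using basis[OF i] eL by auto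
    ultimately have "span (e ` {1..n}) \<subseteq> ?S" by (rule span_minimal[rotated])
    then show ?thesis using y unfolding L by blast
  qed
  let ?S = "{x \<in> L. f (br x y) = alg_bracket A (f x) (f y)}"
  have "br 0 y = 0" using scl[of 0 y 0] y 0 by simp
  then have "subspace ?S"
    using sub y unfolding subspace_def by (auto simp: addl scl simps)
  moreover have "e ` {1..n} \<subseteq> ?S" using 1 eL by auto
  ultimately have "span (e ` {1..n}) \<subseteq> ?S" by (rule span_minimal[rotated])
  then show ?thesis using x unfolding L by blast
qed

lemma span_scale_basis:
  assumes "t \<noteq> (0::real)"
  shows "span {t *\<^sub>R v} = span {v::'a::real_vector}"
proof -
  have "v = (1 / t) *\<^sub>R (t *\<^sub>R v)" using assms by simp
  then have "v \<in> span {t *\<^sub>R v}" by (metis span_base span_scale singletonI)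
  then show ?thesis
    by (intro subset_antisym span_minimal) (auto intro: span_base span_scale)
qed

text \<open>The map sends \<open>e i\<close> to \<open>t i\<close> times \<open>evec i\<close>;
  \<open>table_of\<close> is its compatibility with brackets of basis vectors.\<close>

lemma lie_iso_of_table:
  fixes e :: "nat \<Rightarrow> 'a::real_vector"
  assumes inj: "inj_on e {1..n}" and ind: "independent (e ` {1..n})" and L: "L = span (e ` {1..n})"
    and g: "\<And>i. i \<in> {1..n} \<Longrightarrow> g i = span {e i}" "\<And>i. i \<notin> {1..n} \<Longrightarrow> g i = {0}"
    and bil: "bilinear_on L br"
    and br: "\<And>i j. \<lbrakk>i \<in> {1..n}; j \<in> {1..n}\<rbrakk> \<Longrightarrow> br (e i) (e j) = (if i + j \<le> n then a i j *\<^sub>R e (i + j) else 0)"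
    and a: "\<And>i j. a j i = - a i j"
    and A: "alg_dim A = n" and t: "table_of A t a"
  shows "\<exists>f. lie_iso f L br (alg_space A) (alg_bracket A) \<and> (\<forall>i. f ` g i = alg_grade A i)"
proof -
  obtain f where lin: "linear f" and "\<forall>v\<in>e ` {1..n}. f v = t (the_inv_into {1..n} e v) *\<^sub>R evec (the_inv_into {1..n} e v)"
    using linear_independent_extend[OF ind, of "\<lambda>v. t (the_inv_into {1..n} e v) *\<^sub>R evec (the_inv_into {1..n} e v)"] by blast
  then have f: "f (e i) = t i *\<^sub>R evec i" if "i \<in> {1..n}" for i
    using that the_inv_into_f_f[OF inj] by auto
  have t0: "t i \<noteq> 0" if "1 \<le> i" for i using t that unfolding table_of_def by blast
  have lt: "a i j * t (i + j) = t i * t j * tab A i j" if "1 \<le> i" "i < j" "i + j \<le> n" for i j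
    using t that A unfolding table_of_def by (simp add: tab_eq)
  have all: "a i j * t (i + j) = t i * t j * tab A i j" if "1 \<le> i" "1 \<le> j" "i + j \<le> n" for i j
  proof -
    consider "i < j" | "i = j" | "j < i" by linarith
    then show ?thesis
    proof cases
      case 1
      then show ?thesis using lt that by blast
    next
      case 2
      have "a i i = 0" "tab A i i = 0" using a[of i i] tab_anti[of A i i] by simp_all
      then show ?thesis using 2 by simp
    next
      case 3
      have "a j i * t (j + i) = t j * t i * tab A j i" by (rule lt) (use that 3 in auto)
      then show ?thesis unfolding a[of i j] tab_anti[of A i j] by (simp add: add.commute mult.commute)
    qed
  qed
  have "f (br (e i) (e j)) = alg_bracket A (f (e i)) (f (e j))" if ij: "i \<in> {1..n}" "j \<in> {1..n}" for i j
  proof -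
    have "alg_bracket A (f (e i)) (f (e j)) = (t i * t j) *\<^sub>R alg_bracket A (evec i) (evec j)"
      using f ij by (simp add: linear_scale[OF linear_alg_bracket(1)] linear_scale[OF linear_alg_bracket(2)])
    also have "\<dots> = f (br (e i) (e j))"
    proof (cases "i + j \<le> n")
      case True
      then show ?thesis
        using ij all[of i j] f[of "i + j"] A by (simp add: br alg_bracket_evec linear_scale[OF lin])
    next
      case False
      then show ?thesis using ij A by (simp add: br alg_bracket_evec linear_0[OF lin])
    qed
    finally show ?thesis by simp
  qed
  then have hom: "f (br x y) = alg_bracket A (f x) (f y)" if "x \<in> L" "y \<in> L" for x y
    using linear_hom_on_span[OF lin L bil] that by blast
  have img: "f ` L = alg_space A"
  proof -
    have "f ` L = span (f ` e ` {1..n})" unfolding L by (rule linear_span_image[OF lin, symmetric])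
    also have "\<dots> = span (evec ` {1..n})"
    proof (intro subset_antisym span_minimal subspace_span)
      show "f ` e ` {1..n} \<subseteq> span (evec ` {1..n})"
      proof
        fix v assume "v \<in> f ` e ` {1..n}"
        then obtain i where i: "i \<in> {1..n}" "v = t i *\<^sub>R evec i" using f by auto
        have "evec i \<in> span (evec ` {1..n})" by (rule span_base) (use i in blast)
        then show "v \<in> span (evec ` {1..n})" unfolding i(2) by (rule span_scale)
      qed
      show "evec ` {1..n} \<subseteq> span (f ` e ` {1..n})"
      proof
        fix v assume "v \<in> evec ` {1..n}"
        then obtain i where i: "i \<in> {1..n}" "v = evec i" by blast
        then have "v = (1 / t i) *\<^sub>R f (e i)" using f t0[of i] by simp
        moreover have "f (e i) \<in> span (f ` e ` {1..n})" using i by (auto intro: span_base)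
        ultimately show "v \<in> span (f ` e ` {1..n})" by (simp add: span_scale)
      qed
    qed
    finally show ?thesis by (simp add: alg_space_def A)
  qed
  have "inj_on f L"
    unfolding linear_inj_on_iff_eq_0[OF lin subspace_span[of "e ` {1..n}", folded L]]
  proof (intro ballI impI)
    fix x assume x: "x \<in> L" and z: "f x = 0"
    obtain u where "x = (\<Sum>v\<in>e ` {1..n}. u v *\<^sub>R v)"
      using x span_finite[of "e ` {1..n}"] unfolding L by auto
    then have xs: "x = (\<Sum>i=1..n. u (e i) *\<^sub>R e i)" unfolding sum.reindex[OF inj] o_def .
    have "u (e k) = 0" if k: "k \<in> {1..n}" for k
    proof -
      have "0 = coord (f x) k" using z by simp
      also have "f x = (\<Sum>i=1..n. (u (e i) * t i) *\<^sub>R evec i)"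
        unfolding xs linear_sum[OF lin] by (rule sum.cong) (use f in \<open>auto simp: linear_scale[OF lin]\<close>)
      also have "coord \<dots> k = (\<Sum>i=1..n. if i = k then u (e k) * t k else 0)"
        unfolding lookup_sum by (rule sum.cong) (auto simp: lookup_evec)
      also have "\<dots> = u (e k) * t k" using k by simp
      finally show ?thesis using t0[of k] k by simp
    qed
    then show "x = 0" unfolding xs by (simp add: sum.neutral)
  qed
  then have "bij_betw f L (alg_space A)" using img unfolding bij_betw_def by blast
  moreover have "f ` g i = alg_grade A i" for i
  proof (cases "i \<in> {1..n}")
    case True
    have "f ` span {e i} = span (f ` {e i})" by (rule linear_span_image[OF lin, symmetric])
    also have "\<dots> = span {evec i}" using f[OF True] span_scale_basis t0[of i] True by simp
    finally show ?thesis using True g(1)[OF True] A by (simp add: alg_grade_def)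
  next
    case False
    then show ?thesis using g(2)[OF False] A linear_0[OF lin] by (auto simp: alg_grade_def)
  qed
  ultimately show ?thesis using lin hom unfolding lie_iso_def by blast
qed

lemma bilinear_on_sum:
  fixes e :: "nat \<Rightarrow> 'a::real_vector" and \<omega> :: "'a \<Rightarrow> 'a \<Rightarrow> real"
  assumes bil: "bilinear_on L \<omega>" and sub: "subspace L" and e: "\<And>i. i \<in> S \<Longrightarrow> e i \<in> L"
    and y: "y \<in> L" and S: "finite S"
  shows "\<omega> (\<Sum>i\<in>S. c i *\<^sub>R e i) y = (\<Sum>i\<in>S. c i * \<omega> (e i) y)"
  using S e
proof (induction S rule: finite_induct)
  case empty
  have "\<omega> (0 *\<^sub>R y) y = 0 *\<^sub>R \<omega> y y" using bil y unfolding bilinear_on_def by blast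
  then show ?case by simp
next
  case (insert i S)
  have "c i *\<^sub>R e i \<in> L" "(\<Sum>i\<in>S. c i *\<^sub>R e i) \<in> L" "e i \<in> L"
    using insert.prems sub by (auto intro!: subspace_scale subspace_sum)
  then have "\<omega> (c i *\<^sub>R e i + (\<Sum>i\<in>S. c i *\<^sub>R e i)) y = c i * \<omega> (e i) y + \<omega> (\<Sum>i\<in>S. c i *\<^sub>R e i) y"
    using bil y unfolding bilinear_on_def by (metis real_scaleR_def)
  then show ?case using insert by simp
qed

theorem graded_filiform_classification:
  fixes L :: "'a::real_vector set"
  assumes gf: "graded_filiform n L br g" and sy: "symplectic L br"
  shows "\<exists>A\<in>symplectic_list. \<exists>f. lie_iso f L br (alg_space A) (alg_bracket A) \<and> (\<forall>i. f ` g i = alg_grade A i)"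
proof -
  note n3 = graded_filiformD(1)[OF gf] and lie = graded_filiformD(2)[OF gf]
    and out = graded_filiformD(4)[OF gf] and grad = graded_filiformD(6)[OF gf]
  obtain e where e0: "\<And>i. i \<in> {1..n} \<Longrightarrow> e i \<noteq> 0" and ge: "\<And>i. i \<in> {1..n} \<Longrightarrow> g i = span {e i}"
    and e1: "\<And>i. \<lbrakk>2 \<le> i; i < n\<rbrakk> \<Longrightarrow> br (e 1) (e i) = e (i + 1)"
    using graded_filiform_basis[OF gf] by blast
  have basis: "inj_on e {1..n}" "independent (e ` {1..n})" "L = span (e ` {1..n})"
    using graded_filiform_independent[OF gf e0 ge] by blast+
  obtain \<omega> where \<omega>: "symplectic_form L br \<omega>" using sy unfolding symplectic_def by blast
  have sub: "subspace L" and bil: "bilinear_on L br" and alt0: "\<And>x. x \<in> L \<Longrightarrow> br x x = 0"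
    and Jac: "\<And>x y z. \<lbrakk>x \<in> L; y \<in> L; z \<in> L\<rbrakk> \<Longrightarrow> br x (br y z) + br y (br z x) + br z (br x y) = 0"
    using lie unfolding lie_algebra_def by blast+
  have \<omega>bil: "bilinear_on L \<omega>" and \<omega>0: "\<And>x. x \<in> L \<Longrightarrow> \<omega> x x = 0"
    and nd: "\<And>x. \<lbrakk>x \<in> L; \<forall>y\<in>L. \<omega> x y = 0\<rbrakk> \<Longrightarrow> x = 0"
    and cl: "\<And>x y z. \<lbrakk>x \<in> L; y \<in> L; z \<in> L\<rbrakk> \<Longrightarrow> \<omega> (br x y) z + \<omega> (br y z) x + \<omega> (br z x) y = 0"
    using \<omega> unfolding symplectic_form_def two_form_def diff2_def by blast+
  have eL: "e i \<in> L" if "i \<in> {1..n}" for i using that basis(3) by (auto intro: span_base)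
  have flip: "h y x = - h x y"
    if "bilinear_on L h" "\<And>x. x \<in> L \<Longrightarrow> h x x = 0" "x \<in> L" "y \<in> L" for h :: "'a \<Rightarrow> 'a \<Rightarrow> 'c::real_vector" and x y
  proof -
    have "x + y \<in> L" using that sub by (simp add: subspace_add)
    then have "0 = h (x + y) (x + y)" using that(2) by simp
    also have "\<dots> = h x (x + y) + h y (x + y)" using that \<open>x + y \<in> L\<close> unfolding bilinear_on_def by blast
    also have "h x (x + y) = h x x + h x y" using that unfolding bilinear_on_def by blast
    also have "h y (x + y) = h y x + h y y" using that unfolding bilinear_on_def by blast
    finally have "h x y + h y x = 0" using that(2)[OF that(3)] that(2)[OF that(4)] by simp
    then show ?thesis by (simp add: add_eq_0_iff)
  qed
  have "\<exists>c. br (e i) (e j) = c *\<^sub>R e (i + j)" if "i \<in> {1..n}" "j \<in> {1..n}" "i + j \<le> n" for i j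
  proof -
    have "br (e i) (e j) \<in> g (i + j)"
      by (rule grad) (use that ge in \<open>auto intro: span_base\<close>)
    then show ?thesis using ge[of "i + j"] that by (auto simp: span_singleton)
  qed
  then obtain a0 where a0: "br (e i) (e j) = a0 i j *\<^sub>R e (i + j)" if "i \<in> {1..n}" "j \<in> {1..n}" "i + j \<le> n" for i j
    by metis
  \<comment> \<open>\<open>a0\<close> is controlled only within range; keeping its upper triangle
    makes antisymmetry hold for all indices.\<close>
  define a where "a = alt a0"
  have a_anti: "a j i = - a i j" for i j unfolding a_def by (rule alt_anti)
  have br: "br (e i) (e j) = (if i + j \<le> n then a i j *\<^sub>R e (i + j) else 0)"
    if ij: "i \<in> {1..n}" "j \<in> {1..n}" for i j
  proof (cases "i + j \<le> n")
    case False
    have "br (e i) (e j) \<in> g (i + j)"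
      by (rule grad) (use ij ge in \<open>auto intro: span_base\<close>)
    then show ?thesis using out[of "i + j"] False by simp
  next
    case True
    consider "i < j" | "i = j" | "j < i" by linarith
    then show ?thesis
    proof cases
      case 1
      then show ?thesis using a0[OF ij True] True by (simp add: a_def alt_def)
    next
      case 2
      then show ?thesis using alt0[OF eL[OF ij(1)]] True by (simp add: a_def alt_def)
    next
      case 3
      have "br (e i) (e j) = - br (e j) (e i)" by (rule flip[OF bil alt0 eL eL]) (use ij in auto)
      then show ?thesis using a0[of j i] True ij 3 by (simp add: a_def alt_def add.commute)
    qed
  qed
  have a1: "a 1 i = 1" if "2 \<le> i" "i < n" for i
    using br[of 1 i] e1[of i] e0[of "i + 1"] scaleR_cancel_right[of "a 1 i" "e (i + 1)" 1] that by auto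
  have brL: "br x y \<in> L" if "x \<in> L" "y \<in> L" for x y using lie that unfolding lie_algebra_def by blast
  have scr: "br x (c *\<^sub>R y) = c *\<^sub>R br x y" if "x \<in> L" "y \<in> L" for x y c
    using bil that unfolding bilinear_on_def by blast
  have br0: "br x 0 = 0" if "x \<in> L" for x using scr[OF that that, of 0] by simp
  have tabn: "lie_table n a"
  proof (rule lie_tableI)
    show "a j i = - a i j" for i j by (rule a_anti)
  next
    fix i j k assume ijk: "1 \<le> i" "i < j" "j < k" "i + j + k \<le> n"
    have br2: "br (e p) (br (e q) (e r)) = (a q r * a p (q + r)) *\<^sub>R e (p + q + r)"
      if "1 \<le> p" "1 \<le> q" "1 \<le> r" "p + q + r \<le> n" for p q r
    proof -
      have "br (e q) (e r) = a q r *\<^sub>R e (q + r)" using br[of q r] that by simp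
      then have "br (e p) (br (e q) (e r)) = a q r *\<^sub>R br (e p) (e (q + r))"
        using scr eL that by simp
      also have "br (e p) (e (q + r)) = a p (q + r) *\<^sub>R e (p + q + r)"
        using br[of p "q + r"] that by (simp add: add.assoc)
      finally show ?thesis by simp
    qed
    have w: "j + k + i = i + j + k" "k + i + j = i + j + k" by auto
    have "br (e i) (br (e j) (e k)) + br (e j) (br (e k) (e i)) + br (e k) (br (e i) (e j)) = 0"
      by (rule Jac; rule eL) (use ijk in auto)
    then have "jac a i j k *\<^sub>R e (i + j + k) = 0"
      using br2[of i j k] br2[of j k i] br2[of k i j] ijk by (simp add: jac_def scaleR_add_left w)
    then show "jac a i j k = 0" using e0[of "i + j + k"] ijk by simp
  qed
  \<comment> \<open>Zero outside the range, so that recursions may pass through index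
    \<open>n + 1\<close>.\<close>
  define w where "w i j = (if i \<in> {1..n} \<and> j \<in> {1..n} then \<omega> (e i) (e j) else 0)" for i j
  have w_anti: "w j i = - w i j" for i j
    using flip[OF \<omega>bil \<omega>0 eL eL, of i j] by (auto simp: w_def)
  have w_br: "\<omega> (br (e i) (e j)) (e k) = (if i + j \<le> n then a i j * w (i + j) k else 0)"
    if ijk: "i \<in> {1..n}" "j \<in> {1..n}" "k \<in> {1..n}" for i j k
  proof -
    have sc: "\<omega> (c *\<^sub>R x) y = c * \<omega> x y" if "x \<in> L" "y \<in> L" for c x y
      using \<omega>bil that unfolding bilinear_on_def by auto
    have "\<omega> 0 (e k) = 0" using sc[of "e k" "e k" 0] eL ijk by simp
    then show ?thesis using br[OF ijk(1,2)] sc[OF eL eL, of "i + j" k] ijk by (auto simp: w_def)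
  qed
  have w_cl: "(if i + j \<le> n then a i j * w (i + j) k else 0) + (if j + k \<le> n then a j k * w (j + k) i else 0)
      + (if k + i \<le> n then a k i * w (k + i) j else 0) = 0"
    if ijk: "i \<in> {1..n}" "j \<in> {1..n}" "k \<in> {1..n}" for i j k
    using cl[OF eL[OF ijk(1)] eL[OF ijk(2)] eL[OF ijk(3)]] w_br ijk by simp
  have "even n \<and> (\<forall>i\<in>{1..n}. w i (n + 1 - i) \<noteq> 0)"
  proof -
    \<comment> \<open>Closedness on (1, i, j): the bracket of e_i and e_j vanishes because
      \<open>i + j > n\<close>. If \<open>i\<close> or \<open>j\<close> is \<open>n\<close>, its
      bracket with e_1 vanishes, matching the zero of \<open>w\<close> at
      \<open>n + 1\<close>.\<close>
    have closed: "w (i + 1) j + w i (j + 1) = 0"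
      if ij: "2 \<le> i" "i \<le> n" "2 \<le> j" "j \<le> n" "n < i + j" for i j
    proof -
      have "(if i < n then w (i + 1) j else 0) + (if j < n then - w (j + 1) i else 0) = 0"
        using w_cl[of 1 i j] ij a1[of i] a1[of j] a_anti[of j 1]
        by (cases "i = n"; cases "j = n"; auto split: if_splits)
      moreover have "w (n + 1) j = 0" "w i (n + 1) = 0" by (simp_all add: w_def)
      moreover have "w (j + 1) i = - w i (j + 1)" by (rule w_anti)
      ultimately show ?thesis using ij by (cases "i = n"; cases "j = n") auto
    qed
    have nondeg: "\<forall>i\<in>{1..n}. c i = 0" if z: "\<forall>j\<in>{1..n}. (\<Sum>i=1..n. c i * w i j) = 0" for c
    proof -
      define x where "x = (\<Sum>i=1..n. c i *\<^sub>R e i)"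
      have xL: "x \<in> L" unfolding x_def using eL sub by (auto intro!: subspace_sum subspace_scale)
      have x_e: "\<omega> x (e j) = 0" if j: "j \<in> {1..n}" for j
      proof -
        have "\<omega> x (e j) = (\<Sum>i=1..n. c i * \<omega> (e i) (e j))"
          unfolding x_def by (rule bilinear_on_sum[OF \<omega>bil sub]) (use eL j in auto)
        also have "\<dots> = (\<Sum>i=1..n. c i * w i j)" by (rule sum.cong) (use j in \<open>auto simp: w_def\<close>)
        finally show ?thesis using z j by simp
      qed
      have "\<omega> x y = 0" if y: "y \<in> L" for y
      proof -
        obtain u where "y = (\<Sum>v\<in>e ` {1..n}. u v *\<^sub>R v)"
          using y span_finite[of "e ` {1..n}"] unfolding basis(3) by auto
        then have ys: "y = (\<Sum>i=1..n. u (e i) *\<^sub>R e i)" unfolding sum.reindex[OF basis(1)] o_def .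
        have "\<omega> y x = (\<Sum>i=1..n. u (e i) * \<omega> (e i) x)"
          unfolding ys by (rule bilinear_on_sum[OF \<omega>bil sub]) (use eL xL in auto)
        also have "\<dots> = 0"
        proof (rule sum.neutral, rule ballI)
          fix i assume i: "i \<in> {1..n}"
          have "\<omega> (e i) x = - \<omega> x (e i)" by (rule flip[OF \<omega>bil \<omega>0 xL eL[OF i]])
          then show "u (e i) * \<omega> (e i) x = 0" using x_e[OF i] by simp
        qed
        finally show ?thesis using flip[OF \<omega>bil \<omega>0 y xL] by simp
      qed
      then have "x = 0" using nd[OF xL] by blast
      have inv: "the_inv_into {1..n} e (e i) = i" if "i \<in> {1..n}" for i
        by (rule the_inv_into_f_f[OF basis(1) that])
      have "(\<Sum>v\<in>e ` {1..n}. c (the_inv_into {1..n} e v) *\<^sub>R v) =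
          (\<Sum>i=1..n. c (the_inv_into {1..n} e (e i)) *\<^sub>R e i)"
        unfolding sum.reindex[OF basis(1)] o_def ..
      also have "\<dots> = x" unfolding x_def by (rule sum.cong) (use inv in auto)
      also have "x = 0" using \<open>x = 0\<close> .
      finally have s: "(\<Sum>v\<in>e ` {1..n}. c (the_inv_into {1..n} e v) *\<^sub>R v) = 0" .
      show ?thesis
      proof
        fix i assume i: "i \<in> {1..n}"
        then have "c (the_inv_into {1..n} e (e i)) = 0"
          by (intro independentD[OF basis(2) _ subset_refl s]) auto
        then show "c i = 0" using inv[OF i] by simp
      qed
    qed
    have outside: "w (n + 1) j = 0" for j by (simp add: w_def)
    note sm = symplectic_matrix[of n w, OF n3 w_anti]
    show ?thesis
    proof (intro conjI ballI)
      show "even n" by (rule sm(1)) (fact closed outside nondeg)+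
      show "w i (n + 1 - i) \<noteq> 0" if "i \<in> {1..n}" for i
        by (rule sm(2)) (fact closed outside nondeg that)+
    qed
  qed
  then have ev: "even n" and wn: "\<And>i. i \<in> {1..n} \<Longrightarrow> w i (n + 1 - i) \<noteq> 0" by auto
  have n4: "4 \<le> n" using ev n3 by presburger
  \<comment> \<open>Division by \<open>K\<close> makes the first entry of the new row 1, so that
    \<open>b\<close> is normalised in weight \<open>n + 1\<close> too.\<close>
  define K where "K = w 1 n"
  have K: "K \<noteq> 0" using wn[of 1] n4 by (simp add: K_def)
  define b where "b i j = (if i + j = n + 1 then w i j / K else a i j)" for i j
  have b_anti: "b j i = - b i j" for i j
    using w_anti[of j i] a_anti[of j i] by (simp add: b_def add.commute)
  have b_low: "b i j = a i j" if "i + j \<le> n" for i j using that by (simp add: b_def)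
  have "lie_table (n + 1) b"
  proof (rule lie_tableI)
    show "b j i = - b i j" for i j by (rule b_anti)
  next
    fix i j k assume ijk: "1 \<le> i" "i < j" "j < k" "i + j + k \<le> n + 1"
    have low: "b i j = a i j" "b j k = a j k" "b k i = a k i"
      by (rule b_low; use ijk in linarith)+
    show "jac b i j k = 0"
    proof (cases "i + j + k = n + 1")
      case True
      have "a i j * w (i + j) k + a j k * w (j + k) i + a k i * w (k + i) j = 0"
        using w_cl[of i j k] ijk True by auto
      moreover have "b i (j + k) = w i (j + k) / K" "b j (k + i) = w j (k + i) / K" "b k (i + j) = w k (i + j) / K"
        using True by (auto simp: b_def)
      moreover have "w (i + j) k = - w k (i + j)" "w (j + k) i = - w i (j + k)" "w (k + i) j = - w j (k + i)"
        by (rule w_anti)+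
      ultimately have "K * jac b i j k = 0"
        using K unfolding jac_def low by (simp add: distrib_left)
      then show ?thesis using K by simp
    next
      case False
      have "b i (j + k) = a i (j + k)" "b j (k + i) = a j (k + i)" "b k (i + j) = a k (i + j)"
        by (rule b_low; use ijk False in linarith)+
      then have "jac b i j k = jac a i j k" unfolding jac_def low by simp
      then show ?thesis using lie_table_jac[OF tabn, of i j k] ijk False by simp
    qed
  qed
  moreover have "b 1 i = 1" if "2 \<le> i" "i \<le> n" for i
    using a1[of i] that K by (cases "i = n") (auto simp: b_def K_def)
  moreover have "b i (n + 1 - i) \<noteq> 0" if "1 \<le> i" "i \<le> n" for i
    using wn[of i] that K by (simp add: b_def)
  ultimately obtain A t where A: "A \<in> symplectic_list" "alg_dim A = n" and t: "table_of A t b"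
    using table_class[of n b] ev n4 by blast
  have "table_of A t a"
    using t A b_low unfolding table_of_def by auto
  then show ?thesis
    using lie_iso_of_table[OF basis ge out bil br a_anti A(2)] A(1) by blast
qed

theorem theorem6p2:
  shows
    \<comment> \<open>the listed algebras are symplectic graded filiform Lie algebras\<close>
    "(\<forall>A\<in>symplectic_list.
        graded_filiform (alg_dim A) (alg_space A) (alg_bracket A) (alg_grade A) \<and>
        symplectic (alg_space A) (alg_bracket A)) \<and>
     \<comment> \<open>they are pairwise non-isomorphic\<close>
     (\<forall>A\<in>symplectic_list. \<forall>B\<in>symplectic_list. A \<noteq> B \<longrightarrow>
        \<not> (\<exists>f. lie_iso f (alg_space A) (alg_bracket A) (alg_space B) (alg_bracket B))) \<and>
     \<comment> \<open>every symplectic graded filiform Lie algebra occurs, compatibly with the gradings\<close>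
     (\<forall>n (L :: 'a::real_vector set) br g.
        graded_filiform n L br g \<and> symplectic L br \<longrightarrow>
        (\<exists>A\<in>symplectic_list. \<exists>f.
           lie_iso f L br (alg_space A) (alg_bracket A) \<and> (\<forall>i. f ` g i = alg_grade A i))) \<and>
     \<comment> \<open>the listed forms are homogeneous of weight dimension plus one and symplectic\<close>
     (\<forall>A\<in>symplectic_list. \<forall>\<omega>\<in>listed_forms A.
        homogeneous A (alg_dim A + 1) \<omega> \<and> symplectic_form (alg_space A) (alg_bracket A) \<omega>) \<and>
     \<comment> \<open>up to non-zero factors there are no other homogeneous symplectic forms\<close>
     (\<forall>A\<in>symplectic_list. A \<noteq> V 6 \<longrightarrow>
        (\<forall>\<omega>. homogeneous_symplectic A \<omega> \<longleftrightarrow> (\<exists>\<omega>'\<in>listed_forms A. proportional A \<omega> \<omega>'))) \<and>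
     (\<forall>\<omega>. homogeneous_symplectic (V 6) \<omega> \<longleftrightarrow>
        (\<exists>\<gamma>. \<gamma> \<noteq> -3 \<and> \<gamma> \<noteq> 1/3 \<and> proportional (V 6) \<omega> (form_V6 \<gamma>)))"
proof (intro conjI ballI allI impI)
  fix A assume A: "A \<in> symplectic_list"
  show "graded_filiform (alg_dim A) (alg_space A) (alg_bracket A) (alg_grade A)"
    by (rule graded_filiform_listed[OF A])
  show "symplectic (alg_space A) (alg_bracket A)"
    by (rule symplectic_listed[OF A])
next
  fix A B assume "A \<in> symplectic_list" "B \<in> symplectic_list" "A \<noteq> B"
  then show "\<not> (\<exists>f. lie_iso f (alg_space A) (alg_bracket A) (alg_space B) (alg_bracket B))"
    using not_lie_iso_listed by blast
next
  fix n br g and L :: "'a set"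
  assume "graded_filiform n L br g \<and> symplectic L br"
  then show "\<exists>A\<in>symplectic_list. \<exists>f. lie_iso f L br (alg_space A) (alg_bracket A) \<and>
      (\<forall>i. f ` g i = alg_grade A i)"
    using graded_filiform_classification by blast
next
  fix A \<omega> assume "A \<in> symplectic_list" "\<omega> \<in> listed_forms A"
  then show "homogeneous A (alg_dim A + 1) \<omega>" "symplectic_form (alg_space A) (alg_bracket A) \<omega>"
    by (rule listed_forms_symplectic)+
next
  fix A \<omega> assume "A \<in> symplectic_list" "A \<noteq> V 6"
  then show "homogeneous_symplectic A \<omega> \<longleftrightarrow> (\<exists>\<omega>'\<in>listed_forms A. proportional A \<omega> \<omega>')"
    by (rule homogeneous_symplectic_listed)
next
  fix \<omega>
  show "homogeneous_symplectic (V 6) \<omega> \<longleftrightarrow>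
      (\<exists>\<gamma>. \<gamma> \<noteq> -3 \<and> \<gamma> \<noteq> 1/3 \<and> proportional (V 6) \<omega> (form_V6 \<gamma>))"
    by (rule homogeneous_symplectic_V6)
qed

end
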